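(* Let $k=k_N$ be positive integers with $k=o(N)$, and let $A\subseteq\mathbb R$ be a fixed Borel set with $\mathrm P(Z\in A)=1/2$ for $Z\sim N(0,1)$. Consider the Sparse Balanced Gaussian model: $\theta$ is uniform on $\Theta=\{\theta\in\{0,1/\sqrt k\}^N:\|\theta\|_0=k\}$; independently, $X_1,\dots,X_n$ are i.i.d. $N(0,I_N)$; and one observes $(Y_i,X_i)$, $i=1,\dots,n$, where $Y_i=\mathbf 1(\langle X_i,\theta\rangle\in A)$. Then this model exhibits the all-or-nothing phenomenon at $$n^*=\left\lfloor\frac{\log\binom Nk}{\log 2}\right\rfloor=(1+o(1))\,k\log_2\frac Nk.$$
   Context: $\|\theta\|_0$ is the number of nonzero coordinates of $\theta$; $\log$ is the natural logarithm. $\mathrm{MMSE}_N(n)=\mathbb E\|\theta-\mathbb E[\theta\mid Y^n,X^n]\|^2$, where $Y^n=(Y_i)_{i\le n}$, $X^n=(X_i)_{i\le n}$. The model exhibits the all-or-nothing phenomenon at critical sample sizes $n_c$ if $\lim_{N\to\infty}\mathrm{MMSE}_N(\lfloor\beta n_c\rfloor)=1$ for every fixed $\beta<1$ and $\lim_{N\to\infty}\mathrm{MMSE}_N(\lfloor\beta n_c\rfloor)=0$ for every fixed $\beta>1$. *)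

theory Defs
  imports "HOL-Probability.Probability"
begin

definition Theta :: "nat \<Rightarrow> nat \<Rightarrow> (nat \<Rightarrow> real) set" where
  "Theta N k = {t \<in> {..<N} \<rightarrow>\<^sub>E {0, 1 / sqrt (real k)}. card {j \<in> {..<N}. t j \<noteq> 0} = k}"

definition std_gauss :: "real measure" where
  "std_gauss = density lborel std_normal_density"

definition design :: "nat \<Rightarrow> nat \<Rightarrow> (nat \<Rightarrow> nat \<Rightarrow> real) measure" where
  "design N n = PiM {..<n} (\<lambda>_. PiM {..<N} (\<lambda>_. std_gauss))"

definition model :: "nat \<Rightarrow> nat \<Rightarrow> nat \<Rightarrow> ((nat \<Rightarrow> real) \<times> (nat \<Rightarrow> nat \<Rightarrow> real)) measure" where
  "model N k n = uniform_count_measure (Theta N k) \<Otimes>\<^sub>M design N n"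

definition inprod :: "nat \<Rightarrow> (nat \<Rightarrow> real) \<Rightarrow> (nat \<Rightarrow> real) \<Rightarrow> real" where
  "inprod N x t = (\<Sum>j<N. x j * t j)"

definition obs :: "real set \<Rightarrow> nat \<Rightarrow> nat \<Rightarrow> (nat \<Rightarrow> real) \<times> (nat \<Rightarrow> nat \<Rightarrow> real)
    \<Rightarrow> (nat \<Rightarrow> real) \<times> (nat \<Rightarrow> nat \<Rightarrow> real)" where
  "obs A N n \<omega> = ((\<lambda>i\<in>{..<n}. indicator A (inprod N (snd \<omega> i) (fst \<omega>))), snd \<omega>)"

definition obs_space :: "nat \<Rightarrow> nat \<Rightarrow> ((nat \<Rightarrow> real) \<times> (nat \<Rightarrow> nat \<Rightarrow> real)) measure" where
  "obs_space N n = PiM {..<n} (\<lambda>_. (borel :: real measure)) \<Otimes>\<^sub>M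
                   PiM {..<n} (\<lambda>_. PiM {..<N} (\<lambda>_. (borel :: real measure)))"

definition obs_sigma :: "real set \<Rightarrow> nat \<Rightarrow> nat \<Rightarrow> nat \<Rightarrow> ((nat \<Rightarrow> real) \<times> (nat \<Rightarrow> nat \<Rightarrow> real)) measure" where
  "obs_sigma A N k n = vimage_algebra (space (model N k n)) (obs A N n) (obs_space N n)"

definition MMSE :: "real set \<Rightarrow> nat \<Rightarrow> nat \<Rightarrow> nat \<Rightarrow> real" where
  "MMSE A N k n = (\<integral>\<omega>. (\<Sum>j<N. (fst \<omega> j -
       real_cond_exp (model N k n) (obs_sigma A N k n) (\<lambda>\<omega>'. fst \<omega>' j) \<omega>)\<^sup>2) \<partial>model N k n)"

definition n_star :: "nat \<Rightarrow> nat \<Rightarrow> nat" where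
  "n_star N k = nat \<lfloor>ln (real (N choose k)) / ln 2\<rfloor>"

end

theory Submission
  imports Defs
begin

text \<open>
  Write \<open>f = 2 * indicator A - 1\<close> and let \<open>stab t\<close> be the expectation of \<open>f Z * f Z'\<close> for standard
  Gaussians with correlation \<open>t\<close>. Two parameters with overlap \<open>t\<close> agree on one observation with
  probability \<open>(1 + stab t) / 2\<close>. The estimate \<open>1 + stab t \<le> 2 powr t\<close> makes the first moment method
  work for all \<open>\<beta> > 1\<close>: with high probability every parameter that is consistent with the data overlaps almost
  entirely with the true one, and the expected number of consistent parameters is \<open>exp (o (ln (N choose k)))\<close>.

  This forces the converse. After \<open>(1 + \<epsilon>)\<close> times \<open>n_star\<close> observations the entropy of the observations is nearly
  \<open>ln (N choose k)\<close>, although each contributes at most \<open>ln 2\<close> minus a multiple of the posterior mean of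
  \<open>stab\<close> of the overlap of two posterior samples. The latter is monotone in the number of observations, hence
  small at all times \<open>\<beta> * n_star\<close> with \<open>\<beta> < 1\<close>; as \<open>stab\<close> is increasing and positive for positive arguments, the
  posterior overlap, which is \<open>1 - MMSE\<close>, vanishes as well.
\<close>


section \<open>Rotation invariance and Gram matrices\<close>

text \<open>The form of \<open>1 + stab t \<le> 2 powr t\<close> is dictated by counting. Up to
  factors depending on \<open>j / k\<close>, at most about \<open>(N / k) ^ j\<close> parameters
  miss \<open>j\<close> support points of the truth; their overlap with it is
  \<open>1 - j / k\<close>, and at the critical sample size the bound lets each of them survive with
  probability about \<open>(k / N) ^ j\<close>. So all distances become critical at the same sample
  size. Since \<open>A\<close> is an arbitrary Borel set, no formula for \<open>stab\<close> is at
  hand. Its properties are extracted from the fact that applying \<open>stab\<close> entrywise to a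
  Gram matrix gives a positive semidefinite matrix; this plays the role of a Hermite expansion with
  nonnegative coefficients. Convexity with the two endpoint values is not enough: the chord
  \<open>1 + t\<close> lies above \<open>2 powr t\<close>. Hence the additional bounds at an inner
  point and near 0. A finely oscillating \<open>A\<close> makes \<open>stab\<close> tiny away from
  1, so no positive lower bound is uniform in \<open>A\<close>. But \<open>A\<close> is fixed while
  \<open>N\<close> grows, and bare positivity suffices.\<close>

lemma sets_std_gauss[simp, measurable_cong]: "sets std_gauss = sets borel"
  and space_std_gauss[simp]: "space std_gauss = UNIV"
  by (auto simp: std_gauss_def)

lemma prob_space_std_gauss: "prob_space std_gauss"
  unfolding std_gauss_def by (rule prob_space_normal_density) simp

interpretation std_gauss: prob_space std_gauss
  by (rule prob_space_std_gauss)

interpretation std_gauss_pair: pair_prob_space std_gauss std_gauss ..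

lemma nn_integral_std_gauss:
  assumes [measurable]: "F \<in> borel_measurable borel"
  shows "(\<integral>\<^sup>+x. F x \<partial>std_gauss) = (\<integral>\<^sup>+x. ennreal (std_normal_density x) * F x \<partial>lborel)"
  unfolding std_gauss_def by (subst nn_integral_density) auto

lemma nn_integral_std_gauss_uminus:
  assumes [measurable]: "F \<in> borel_measurable borel"
  shows "(\<integral>\<^sup>+x. F (- x) \<partial>std_gauss) = (\<integral>\<^sup>+x. F x \<partial>std_gauss)"
  using nn_integral_real_affine[of "\<lambda>x. ennreal (std_normal_density x) * F x" "-1" 0]
  by (simp add: nn_integral_std_gauss std_normal_density_def)

lemma nn_integral_std_gauss_swap:
  fixes F :: "real \<Rightarrow> real \<Rightarrow> ennreal"
  assumes "case_prod F \<in> borel_measurable (borel \<Otimes>\<^sub>M borel)"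
  shows "(\<integral>\<^sup>+u. \<integral>\<^sup>+v. F u v \<partial>std_gauss \<partial>std_gauss) = (\<integral>\<^sup>+v. \<integral>\<^sup>+u. F u v \<partial>std_gauss \<partial>std_gauss)"
  using std_gauss_pair.Fubini'[of F] assms by simp

lemma std_normal_density_rotate:
  assumes "c\<^sup>2 + s\<^sup>2 = 1"
  shows "std_normal_density (c * u + s * v) * std_normal_density (c * v - s * u)
    = std_normal_density u * std_normal_density v"
proof -
  have "(c * u + s * v)\<^sup>2 + (c * v - s * u)\<^sup>2 = (c\<^sup>2 + s\<^sup>2) * (u\<^sup>2 + v\<^sup>2)"
    by (simp add: power2_eq_square algebra_simps)
  then have "(c * u + s * v)\<^sup>2 + (c * v - s * u)\<^sup>2 = u\<^sup>2 + v\<^sup>2"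
    using assms by simp
  then have "- (c * u + s * v)\<^sup>2 / 2 + - (c * v - s * u)\<^sup>2 / 2 = - u\<^sup>2 / 2 + - v\<^sup>2 / 2"
    by argo
  then show ?thesis
    unfolding std_normal_density_def by (simp add: mult_exp_exp)
qed

text \<open>A rotation is factored into two one-dimensional affine substitutions, in
  \<open>v\<close> and, after exchanging the integrals, in \<open>u\<close>. The Jacobians
  \<open>1 / c\<close> and \<open>c\<close> cancel and the product density is rotation invariant.
  Division by \<open>c\<close> excludes quarter turns, which are an exchange combined with a
  reflection.\<close>

lemma nn_integral_std_gauss_rotate_aux:
  fixes F :: "real \<Rightarrow> real \<Rightarrow> ennreal"
  assumes F[measurable]: "case_prod F \<in> borel_measurable (borel \<Otimes>\<^sub>M borel)"
    and cs: "c\<^sup>2 + s\<^sup>2 = 1" and c0: "c \<noteq> 0"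
  shows "(\<integral>\<^sup>+u. \<integral>\<^sup>+v. F (c * u - s * v) (s * u + c * v) \<partial>std_gauss \<partial>std_gauss)
    = (\<integral>\<^sup>+u. \<integral>\<^sup>+v. F u v \<partial>std_gauss \<partial>std_gauss)"
proof -
  define d where "d u v = ennreal (std_normal_density u) * ennreal (std_normal_density v)" for u v
  have [measurable]: "case_prod d \<in> borel_measurable (borel \<Otimes>\<^sub>M borel)"
    by (simp add: d_def[abs_def])
  have dd: "(\<integral>\<^sup>+u. \<integral>\<^sup>+v. G u v \<partial>std_gauss \<partial>std_gauss) = (\<integral>\<^sup>+u. \<integral>\<^sup>+v. d u v * G u v \<partial>lborel \<partial>lborel)"
    if [measurable]: "case_prod G \<in> borel_measurable (borel \<Otimes>\<^sub>M borel)" for G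
    by (subst (1 2) nn_integral_std_gauss) (auto simp: nn_integral_cmult[symmetric] d_def mult.assoc)
  have cs2: "c * c + s * s = 1" using cs by (simp add: power2_eq_square)
  have e1: "c * u - s * ((v - s * u) / c) = (u - s * v) / c" for u v
  proof -
    have "c * u - s * ((v - s * u) / c) = ((c * c + s * s) * u - s * v) / c"
      using c0 by (simp add: field_simps)
    then show ?thesis using cs2 by simp
  qed
  have e1': "s * u + c * ((v - s * u) / c) = v" for u v
    using c0 by simp
  have e2: "((c * u + s * v) - s * v) / c = u" for u v
    using c0 by simp
  have e3: "(v - s * (c * u + s * v)) / c = c * v - s * u" for u v
  proof -
    have "v - s * (c * u + s * v) = (c * c + s * s) * v - s * (c * u + s * v)" using cs2 by simp
    then show ?thesis using c0 by (simp add: field_simps)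
  qed
  have "(\<integral>\<^sup>+u. \<integral>\<^sup>+v. F (c * u - s * v) (s * u + c * v) \<partial>std_gauss \<partial>std_gauss)
    = (\<integral>\<^sup>+u. \<integral>\<^sup>+v. d u v * F (c * u - s * v) (s * u + c * v) \<partial>lborel \<partial>lborel)"
    by (rule dd) measurable
  also have "\<dots> = (\<integral>\<^sup>+u. \<integral>\<^sup>+v. ennreal \<bar>1/c\<bar> * (d u ((v - s * u) / c) * F ((u - s * v) / c) v) \<partial>lborel \<partial>lborel)"
  proof (rule nn_integral_cong)
    fix u :: real
    have eq: "-(s * u / c) + (1 / c) * v = (v - s * u) / c" for v
      by (simp add: diff_divide_distrib)
    show "(\<integral>\<^sup>+v. d u v * F (c * u - s * v) (s * u + c * v) \<partial>lborel)
      = (\<integral>\<^sup>+v. ennreal \<bar>1/c\<bar> * (d u ((v - s * u) / c) * F ((u - s * v) / c) v) \<partial>lborel)"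
      using c0
      by (subst nn_integral_real_affine[where c="1/c" and t="-(s*u/c)"])
         (simp_all only: eq e1 e1', simp_all add: nn_integral_cmult)
  qed
  also have "\<dots> = (\<integral>\<^sup>+v. \<integral>\<^sup>+u. ennreal \<bar>1/c\<bar> * (d u ((v - s * u) / c) * F ((u - s * v) / c) v) \<partial>lborel \<partial>lborel)"
    by (rule lborel_pair.Fubini') measurable
  also have "\<dots> = (\<integral>\<^sup>+v. \<integral>\<^sup>+u. d u v * F u v \<partial>lborel \<partial>lborel)"
  proof (rule nn_integral_cong)
    fix v :: real
    have eq: "s * v + c * u = c * u + s * v" for u by simp
    have "(\<integral>\<^sup>+u. ennreal \<bar>1/c\<bar> * (d u ((v - s * u) / c) * F ((u - s * v) / c) v) \<partial>lborel)
      = (\<integral>\<^sup>+u. ennreal \<bar>c\<bar> * (ennreal \<bar>1/c\<bar> * (d (c * u + s * v) (c * v - s * u) * F u v)) \<partial>lborel)"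
      using c0
      by (subst nn_integral_real_affine[where c="c" and t="s * v"])
         (auto simp: eq e2 e3 nn_integral_cmult[symmetric])
    also have "\<dots> = (\<integral>\<^sup>+u. d u v * F u v \<partial>lborel)"
    proof (rule nn_integral_cong)
      fix u
      have "d (c * u + s * v) (c * v - s * u) = d u v"
        unfolding d_def by (simp add: ennreal_mult[symmetric] std_normal_density_rotate[OF cs])
      moreover have "ennreal \<bar>c\<bar> * ennreal \<bar>1/c\<bar> = 1"
        using c0 by (simp add: ennreal_mult[symmetric] abs_mult[symmetric])
      ultimately show "ennreal \<bar>c\<bar> * (ennreal \<bar>1/c\<bar> * (d (c * u + s * v) (c * v - s * u) * F u v)) = d u v * F u v"
        by (simp add: mult.assoc[symmetric])
    qed
    finally show "(\<integral>\<^sup>+u. ennreal \<bar>1/c\<bar> * (d u ((v - s * u) / c) * F ((u - s * v) / c) v) \<partial>lborel)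
      = (\<integral>\<^sup>+u. d u v * F u v \<partial>lborel)" .
  qed
  also have "\<dots> = (\<integral>\<^sup>+u. \<integral>\<^sup>+v. d u v * F u v \<partial>lborel \<partial>lborel)"
    by (rule lborel_pair.Fubini') measurable
  also have "\<dots> = (\<integral>\<^sup>+u. \<integral>\<^sup>+v. F u v \<partial>std_gauss \<partial>std_gauss)"
    by (rule dd[symmetric]) measurable
  finally show ?thesis .
qed

lemma nn_integral_std_gauss_rotate:
  fixes F :: "real \<Rightarrow> real \<Rightarrow> ennreal"
  assumes F[measurable]: "case_prod F \<in> borel_measurable (borel \<Otimes>\<^sub>M borel)"
    and cs: "c\<^sup>2 + s\<^sup>2 = 1"
  shows "(\<integral>\<^sup>+u. \<integral>\<^sup>+v. F (c * u - s * v) (s * u + c * v) \<partial>std_gauss \<partial>std_gauss)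
    = (\<integral>\<^sup>+u. \<integral>\<^sup>+v. F u v \<partial>std_gauss \<partial>std_gauss)"
proof (cases "c = 0")
  case False
  then show ?thesis using nn_integral_std_gauss_rotate_aux assms by blast
next
  case True
  then have "s = 1 \<or> s = -1" using cs by (simp add: power2_eq_1_iff)
  then show ?thesis
  proof
    assume s: "s = 1"
    have "(\<integral>\<^sup>+u. \<integral>\<^sup>+v. F (- v) u \<partial>std_gauss \<partial>std_gauss) = (\<integral>\<^sup>+u. \<integral>\<^sup>+v. F v u \<partial>std_gauss \<partial>std_gauss)"
      by (intro nn_integral_cong nn_integral_std_gauss_uminus) measurable
    also have "\<dots> = (\<integral>\<^sup>+v. \<integral>\<^sup>+u. F v u \<partial>std_gauss \<partial>std_gauss)"
      by (rule nn_integral_std_gauss_swap) measurable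
    finally show ?thesis using s True by simp
  next
    assume s: "s = -1"
    have "(\<integral>\<^sup>+u. \<integral>\<^sup>+v. F v (- u) \<partial>std_gauss \<partial>std_gauss) = (\<integral>\<^sup>+v. \<integral>\<^sup>+u. F v (- u) \<partial>std_gauss \<partial>std_gauss)"
      by (rule nn_integral_std_gauss_swap) measurable
    also have "\<dots> = (\<integral>\<^sup>+v. \<integral>\<^sup>+u. F v u \<partial>std_gauss \<partial>std_gauss)"
      by (intro nn_integral_cong nn_integral_std_gauss_uminus) measurable
    finally show ?thesis using s True by simp
  qed
qed

text \<open>\<open>(c, s)\<close> is the normalized vector \<open>(\<alpha>, p)\<close>, so the
  rotation it defines carries that vector to the first axis. The zero vector gets an arbitrary
  direction, which spares later proofs a case distinction.\<close>

lemma unit_direction: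
  fixes \<alpha> p :: real
  obtains c s where "c\<^sup>2 + s\<^sup>2 = 1" "\<alpha> * c + p * s = sqrt (\<alpha>\<^sup>2 + p\<^sup>2)" "p * c - \<alpha> * s = 0"
proof (cases "\<alpha>\<^sup>2 + p\<^sup>2 = 0")
  case True
  then have "\<alpha> = 0" "p = 0" by (simp_all add: sum_power2_eq_zero_iff)
  then show ?thesis using that[of 1 0] by simp
next
  case False
  define n where "n = sqrt (\<alpha>\<^sup>2 + p\<^sup>2)"
  have n2: "n\<^sup>2 = \<alpha>\<^sup>2 + p\<^sup>2" and n0: "n \<noteq> 0"
    using False by (auto simp: n_def)
  show ?thesis
  proof (rule that)
    show "(\<alpha> / n)\<^sup>2 + (p / n)\<^sup>2 = 1"
      using n0 by (simp add: power_divide add_divide_distrib[symmetric] n2[symmetric])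
    have "\<alpha> * (\<alpha> / n) + p * (p / n) = n\<^sup>2 / n"
      unfolding n2 by (simp add: power2_eq_square add_divide_distrib)
    then show "\<alpha> * (\<alpha> / n) + p * (p / n) = sqrt (\<alpha>\<^sup>2 + p\<^sup>2)"
      using n0 unfolding n_def[symmetric] by (simp add: power2_eq_square)
    show "p * (\<alpha> / n) - \<alpha> * (p / n) = 0" by simp
  qed
qed

text \<open>Rotating \<open>(w, r)\<close> to the first axis makes the integrand independent of the
  second variable, which then integrates to 1.\<close>

lemma nn_integral_std_gauss_sum:
  fixes H :: "real \<Rightarrow> ennreal"
  assumes [measurable]: "H \<in> borel_measurable borel"
  shows "(\<integral>\<^sup>+v. \<integral>\<^sup>+b. H (w * v + r * b) \<partial>std_gauss \<partial>std_gauss) = (\<integral>\<^sup>+b. H (sqrt (w\<^sup>2 + r\<^sup>2) * b) \<partial>std_gauss)"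
proof -
  obtain c s where cs: "c\<^sup>2 + s\<^sup>2 = 1" "w * c + r * s = sqrt (w\<^sup>2 + r\<^sup>2)" "r * c - w * s = 0"
    by (rule unit_direction)
  have e: "w * (c * u - s * v) + r * (s * u + c * v) = sqrt (w\<^sup>2 + r\<^sup>2) * u" for u v
  proof -
    have "w * (c * u - s * v) + r * (s * u + c * v) = (w * c + r * s) * u + (r * c - w * s) * v"
      by (simp add: algebra_simps)
    then show ?thesis by (simp only: cs mult_zero_left add_0_right)
  qed
  have "(\<integral>\<^sup>+v. \<integral>\<^sup>+b. H (w * v + r * b) \<partial>std_gauss \<partial>std_gauss)
    = (\<integral>\<^sup>+u. \<integral>\<^sup>+v. H (w * (c * u - s * v) + r * (s * u + c * v)) \<partial>std_gauss \<partial>std_gauss)"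
    by (rule nn_integral_std_gauss_rotate[where F="\<lambda>v b. H (w * v + r * b)", OF _ cs(1), symmetric]) measurable
  then show ?thesis unfolding e by (simp add: std_gauss.emeasure_space_1[simplified])
qed

text \<open>Two rotations bring three independent Gaussians into the triangular form of a QR decomposition.\<close>

lemma std_gauss_triangular:
  fixes \<alpha> \<beta> p q r :: real
  obtains p' q' r' where "0 \<le> p'" "0 \<le> r'" "p'\<^sup>2 = \<alpha>\<^sup>2 + p\<^sup>2" "p' * q' = \<alpha> * \<beta> + p * q"
    "q'\<^sup>2 + r'\<^sup>2 = \<beta>\<^sup>2 + q\<^sup>2 + r\<^sup>2"
    "\<And>F :: real \<Rightarrow> real \<Rightarrow> ennreal. case_prod F \<in> borel_measurable (borel \<Otimes>\<^sub>M borel) \<Longrightarrow>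
     (\<integral>\<^sup>+x. \<integral>\<^sup>+a. \<integral>\<^sup>+b. F (\<alpha> * x + p * a) (\<beta> * x + (q * a + r * b)) \<partial>std_gauss \<partial>std_gauss \<partial>std_gauss)
     = (\<integral>\<^sup>+a. \<integral>\<^sup>+b. F (p' * a) (q' * a + r' * b) \<partial>std_gauss \<partial>std_gauss)"
proof -
  define p' where "p' = sqrt (\<alpha>\<^sup>2 + p\<^sup>2)"
  obtain c s where cs: "c\<^sup>2 + s\<^sup>2 = 1" and p': "\<alpha> * c + p * s = p'" and z: "p * c - \<alpha> * s = 0"
    unfolding p'_def by (rule unit_direction)
  define q' where "q' = \<beta> * c + q * s"
  \<comment> \<open>The coefficient that the second linear form keeps on the other rotated variable.
    The second rotation merges it with \<open>r\<close>.\<close>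
  define w where "w = q * c - \<beta> * s"
  define r' where "r' = sqrt (w\<^sup>2 + r\<^sup>2)"
  have \<alpha>: "\<alpha> = p' * c" and p: "p = p' * s"
  proof -
    have "p' * c = \<alpha> * (c\<^sup>2 + s\<^sup>2) + (p * c - \<alpha> * s) * s"
      unfolding p'[symmetric] by (simp add: algebra_simps power2_eq_square)
    then show "\<alpha> = p' * c" using cs z by simp
    have "p' * s = p * (c\<^sup>2 + s\<^sup>2) - (p * c - \<alpha> * s) * c"
      unfolding p'[symmetric] by (simp add: algebra_simps power2_eq_square)
    then show "p = p' * s" using cs z by simp
  qed
  have qw: "q'\<^sup>2 + w\<^sup>2 = (c\<^sup>2 + s\<^sup>2) * (\<beta>\<^sup>2 + q\<^sup>2)"
    unfolding q'_def w_def by (simp add: algebra_simps power2_eq_square)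
  show ?thesis
  proof (rule that[of p' r' q'])
    show "0 \<le> p'" "0 \<le> r'" by (simp_all add: p'_def r'_def)
    show "p'\<^sup>2 = \<alpha>\<^sup>2 + p\<^sup>2" by (simp add: p'_def)
    show "p' * q' = \<alpha> * \<beta> + p * q" unfolding \<alpha> p q'_def by (simp add: algebra_simps)
    show "q'\<^sup>2 + r'\<^sup>2 = \<beta>\<^sup>2 + q\<^sup>2 + r\<^sup>2"
      using qw cs by (simp add: r'_def algebra_simps)
    fix F :: "real \<Rightarrow> real \<Rightarrow> ennreal"
    assume [measurable]: "case_prod F \<in> borel_measurable (borel \<Otimes>\<^sub>M borel)"
    have e1: "\<alpha> * (c * u - s * v) + p * (s * u + c * v) = p' * u" for u v
    proof -
      have "\<alpha> * (c * u - s * v) + p * (s * u + c * v) = (\<alpha> * c + p * s) * u + (p * c - \<alpha> * s) * v"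
        by (simp add: algebra_simps)
      then show ?thesis by (simp only: p' z mult_zero_left add_0_right)
    qed
    have e2: "\<beta> * (c * u - s * v) + (q * (s * u + c * v) + r * b) = q' * u + (w * v + r * b)" for u v b
      by (simp add: q'_def w_def algebra_simps)
    have "(\<integral>\<^sup>+x. \<integral>\<^sup>+a. \<integral>\<^sup>+b. F (\<alpha> * x + p * a) (\<beta> * x + (q * a + r * b)) \<partial>std_gauss \<partial>std_gauss \<partial>std_gauss)
      = (\<integral>\<^sup>+u. \<integral>\<^sup>+v. \<integral>\<^sup>+b. F (\<alpha> * (c * u - s * v) + p * (s * u + c * v))
          (\<beta> * (c * u - s * v) + (q * (s * u + c * v) + r * b)) \<partial>std_gauss \<partial>std_gauss \<partial>std_gauss)"
      by (rule nn_integral_std_gauss_rotate[OF _ cs, symmetric,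
            where F="\<lambda>x a. \<integral>\<^sup>+b. F (\<alpha> * x + p * a) (\<beta> * x + (q * a + r * b)) \<partial>std_gauss"]) measurable
    also have "\<dots> = (\<integral>\<^sup>+u. \<integral>\<^sup>+v. \<integral>\<^sup>+b. F (p' * u) (q' * u + (w * v + r * b)) \<partial>std_gauss \<partial>std_gauss \<partial>std_gauss)"
      unfolding e1 e2 ..
    also have "\<dots> = (\<integral>\<^sup>+u. \<integral>\<^sup>+b. F (p' * u) (q' * u + r' * b) \<partial>std_gauss \<partial>std_gauss)"
      unfolding r'_def
    proof (rule nn_integral_cong)
      fix u
      show "(\<integral>\<^sup>+v. \<integral>\<^sup>+b. F (p' * u) (q' * u + (w * v + r * b)) \<partial>std_gauss \<partial>std_gauss)
        = (\<integral>\<^sup>+b. F (p' * u) (q' * u + sqrt (w\<^sup>2 + r\<^sup>2) * b) \<partial>std_gauss)"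
        by (rule nn_integral_std_gauss_sum[where H="\<lambda>y. F (p' * u) (q' * u + y)"]) measurable
    qed
    finally show "(\<integral>\<^sup>+x. \<integral>\<^sup>+a. \<integral>\<^sup>+b. F (\<alpha> * x + p * a) (\<beta> * x + (q * a + r * b)) \<partial>std_gauss \<partial>std_gauss \<partial>std_gauss)
     = (\<integral>\<^sup>+a. \<integral>\<^sup>+b. F (p' * a) (q' * a + r' * b) \<partial>std_gauss \<partial>std_gauss)" .
  qed
qed

section \<open>Joint law of two linear forms of a Gaussian vector\<close>

abbreviation gauss_vec :: "'i set \<Rightarrow> ('i \<Rightarrow> real) measure" where
  "gauss_vec J \<equiv> PiM J (\<lambda>_. std_gauss)"

lemma prob_space_gauss_vec: "prob_space (gauss_vec J)"
  by (intro prob_space_PiM prob_space_std_gauss)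

interpretation std_gauss_product: product_prob_space "\<lambda>_. std_gauss" UNIV
  by standard

text \<open>\<open>p\<close>, \<open>q\<close>, \<open>r\<close> are the entries of a triangular
  (Cholesky) factor of the Gram matrix of \<open>u\<close> and \<open>v\<close>. Coordinates are
  added one at a time, and \<open>std_gauss_triangular\<close> absorbs each new one into the
  factor.\<close>

lemma std_gauss_gram:
  fixes u v :: "'i \<Rightarrow> real"
  assumes "finite J"
  shows "\<exists>p q r. 0 \<le> p \<and> 0 \<le> r \<and> p\<^sup>2 = (\<Sum>j\<in>J. (u j)\<^sup>2) \<and> p * q = (\<Sum>j\<in>J. u j * v j)
    \<and> q\<^sup>2 + r\<^sup>2 = (\<Sum>j\<in>J. (v j)\<^sup>2)
    \<and> (\<forall>F :: real \<Rightarrow> real \<Rightarrow> ennreal. case_prod F \<in> borel_measurable (borel \<Otimes>\<^sub>M borel) \<longrightarrow>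
        (\<integral>\<^sup>+x. F (\<Sum>j\<in>J. x j * u j) (\<Sum>j\<in>J. x j * v j) \<partial>gauss_vec J)
        = (\<integral>\<^sup>+a. \<integral>\<^sup>+b. F (p * a) (q * a + r * b) \<partial>std_gauss \<partial>std_gauss))"
  using assms
proof induction
  case empty
  show ?case
    by (rule exI[of _ 0], rule exI[of _ 0], rule exI[of _ 0]) (auto simp: std_gauss_product.nn_integral_empty std_gauss.emeasure_space_1[simplified]
        prob_space.emeasure_space_1[OF prob_space_gauss_vec])
next
  case (insert i J)
  from insert.IH obtain p q r where pqr: "0 \<le> p" "0 \<le> r" "p\<^sup>2 = (\<Sum>j\<in>J. (u j)\<^sup>2)" "p * q = (\<Sum>j\<in>J. u j * v j)"
     "q\<^sup>2 + r\<^sup>2 = (\<Sum>j\<in>J. (v j)\<^sup>2)"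
    and IH: "\<And>F :: real \<Rightarrow> real \<Rightarrow> ennreal. case_prod F \<in> borel_measurable (borel \<Otimes>\<^sub>M borel) \<Longrightarrow>
        (\<integral>\<^sup>+x. F (\<Sum>j\<in>J. x j * u j) (\<Sum>j\<in>J. x j * v j) \<partial>gauss_vec J)
        = (\<integral>\<^sup>+a. \<integral>\<^sup>+b. F (p * a) (q * a + r * b) \<partial>std_gauss \<partial>std_gauss)"
    by blast
  obtain p' q' r' where pqr': "0 \<le> p'" "0 \<le> r'" "p'\<^sup>2 = (u i)\<^sup>2 + p\<^sup>2" "p' * q' = u i * v i + p * q"
    "q'\<^sup>2 + r'\<^sup>2 = (v i)\<^sup>2 + q\<^sup>2 + r\<^sup>2"
    and tri: "\<And>F :: real \<Rightarrow> real \<Rightarrow> ennreal. case_prod F \<in> borel_measurable (borel \<Otimes>\<^sub>M borel) \<Longrightarrow>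
     (\<integral>\<^sup>+x. \<integral>\<^sup>+a. \<integral>\<^sup>+b. F (u i * x + p * a) (v i * x + (q * a + r * b)) \<partial>std_gauss \<partial>std_gauss \<partial>std_gauss)
     = (\<integral>\<^sup>+a. \<integral>\<^sup>+b. F (p' * a) (q' * a + r' * b) \<partial>std_gauss \<partial>std_gauss)"
    by (rule std_gauss_triangular[of "u i" p "v i" q r]) blast
  have up: "(\<Sum>j\<in>insert i J. (x(i := y)) j * w j) = w i * y + (\<Sum>j\<in>J. x j * w j)" for x y and w :: "'i \<Rightarrow> real"
  proof -
    have "(\<Sum>j\<in>J. (x(i := y)) j * w j) = (\<Sum>j\<in>J. x j * w j)"
      using insert.hyps by (intro sum.cong) auto
    then show ?thesis using insert.hyps by simp
  qed
  show ?case
  proof (rule exI[of _ p'], rule exI[of _ q'], rule exI[of _ r'], intro conjI allI impI)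
    show "0 \<le> p'" "0 \<le> r'" "p'\<^sup>2 = (\<Sum>j\<in>insert i J. (u j)\<^sup>2)" "p' * q' = (\<Sum>j\<in>insert i J. u j * v j)"
       "q'\<^sup>2 + r'\<^sup>2 = (\<Sum>j\<in>insert i J. (v j)\<^sup>2)"
      using pqr pqr' insert.hyps by simp_all
    fix F :: "real \<Rightarrow> real \<Rightarrow> ennreal"
    assume [measurable]: "case_prod F \<in> borel_measurable (borel \<Otimes>\<^sub>M borel)"
    have "(\<integral>\<^sup>+x. F (\<Sum>j\<in>insert i J. x j * u j) (\<Sum>j\<in>insert i J. x j * v j) \<partial>gauss_vec (insert i J))
      = (\<integral>\<^sup>+y. \<integral>\<^sup>+x. F (\<Sum>j\<in>insert i J. (x(i := y)) j * u j) (\<Sum>j\<in>insert i J. (x(i := y)) j * v j) \<partial>gauss_vec J \<partial>std_gauss)"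
      by (rule std_gauss_product.product_nn_integral_insert_rev) (use insert.hyps in measurable)
    also have "\<dots> = (\<integral>\<^sup>+y. \<integral>\<^sup>+x. F (u i * y + (\<Sum>j\<in>J. x j * u j)) (v i * y + (\<Sum>j\<in>J. x j * v j)) \<partial>gauss_vec J \<partial>std_gauss)"
      unfolding up ..
    also have "\<dots> = (\<integral>\<^sup>+y. \<integral>\<^sup>+a. \<integral>\<^sup>+b. F (u i * y + p * a) (v i * y + (q * a + r * b)) \<partial>std_gauss \<partial>std_gauss \<partial>std_gauss)"
      by (intro nn_integral_cong IH) measurable
    also have "\<dots> = (\<integral>\<^sup>+a. \<integral>\<^sup>+b. F (p' * a) (q' * a + r' * b) \<partial>std_gauss \<partial>std_gauss)"
      by (rule tri) measurable
    finally show "(\<integral>\<^sup>+x. F (\<Sum>j\<in>insert i J. x j * u j) (\<Sum>j\<in>insert i J. x j * v j) \<partial>gauss_vec (insert i J))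
      = (\<integral>\<^sup>+a. \<integral>\<^sup>+b. F (p' * a) (q' * a + r' * b) \<partial>std_gauss \<partial>std_gauss)" .
  qed
qed

definition corr_gauss :: "real \<Rightarrow> (real \<times> real) measure" where
  "corr_gauss t = distr (std_gauss \<Otimes>\<^sub>M std_gauss) (borel \<Otimes>\<^sub>M borel) (\<lambda>(a, b). (a, t * a + sqrt (1 - t\<^sup>2) * b))"

lemma sets_corr_gauss[simp, measurable_cong]: "sets (corr_gauss t) = sets (borel \<Otimes>\<^sub>M borel)"
  and space_corr_gauss[simp]: "space (corr_gauss t) = UNIV"
  by (auto simp: corr_gauss_def space_pair_measure)

lemma prob_space_corr_gauss: "prob_space (corr_gauss t)"
  unfolding corr_gauss_def by (rule std_gauss_pair.prob_space_distr) measurable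

text \<open>Unit length forces \<open>p = 1\<close>; hence \<open>q\<close> is the inner product and
  \<open>r = sqrt (1 - q^2)\<close>, which is exactly the factor built into
  \<open>corr_gauss\<close>.\<close>

lemma distr_gauss_vec:
  fixes u v :: "'i \<Rightarrow> real"
  assumes J: "finite J" and u: "(\<Sum>j\<in>J. (u j)\<^sup>2) = 1" and v: "(\<Sum>j\<in>J. (v j)\<^sup>2) = 1"
  shows "distr (gauss_vec J) (borel \<Otimes>\<^sub>M borel) (\<lambda>x. (\<Sum>j\<in>J. x j * u j, \<Sum>j\<in>J. x j * v j))
    = corr_gauss (\<Sum>j\<in>J. u j * v j)"
proof -
  obtain p q r where pqr: "0 \<le> p" "0 \<le> r" "p\<^sup>2 = (\<Sum>j\<in>J. (u j)\<^sup>2)" "p * q = (\<Sum>j\<in>J. u j * v j)"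
     "q\<^sup>2 + r\<^sup>2 = (\<Sum>j\<in>J. (v j)\<^sup>2)"
    and F: "\<And>F :: real \<Rightarrow> real \<Rightarrow> ennreal. case_prod F \<in> borel_measurable (borel \<Otimes>\<^sub>M borel) \<Longrightarrow>
        (\<integral>\<^sup>+x. F (\<Sum>j\<in>J. x j * u j) (\<Sum>j\<in>J. x j * v j) \<partial>gauss_vec J)
        = (\<integral>\<^sup>+a. \<integral>\<^sup>+b. F (p * a) (q * a + r * b) \<partial>std_gauss \<partial>std_gauss)"
    using std_gauss_gram[OF J, of u v] by blast
  have p: "p = 1" using pqr(1,3) u by (simp add: power2_eq_1_iff)
  then have q: "q = (\<Sum>j\<in>J. u j * v j)" using pqr by simp
  have r: "r = sqrt (1 - q\<^sup>2)"
    using pqr(2,5) v by (metis add_diff_cancel_left' real_sqrt_unique)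
  show ?thesis
  proof (rule measure_eqI)
    fix A :: "(real \<times> real) set"
    assume "A \<in> sets (distr (gauss_vec J) (borel \<Otimes>\<^sub>M borel) (\<lambda>x. (\<Sum>j\<in>J. x j * u j, \<Sum>j\<in>J. x j * v j)))"
    then have A[measurable]: "A \<in> sets (borel \<Otimes>\<^sub>M borel)" by simp
    have "emeasure (distr (gauss_vec J) (borel \<Otimes>\<^sub>M borel) (\<lambda>x. (\<Sum>j\<in>J. x j * u j, \<Sum>j\<in>J. x j * v j))) A
      = (\<integral>\<^sup>+z. indicator A z \<partial>distr (gauss_vec J) (borel \<Otimes>\<^sub>M borel) (\<lambda>x. (\<Sum>j\<in>J. x j * u j, \<Sum>j\<in>J. x j * v j)))"
      by simp
    also have "\<dots> = (\<integral>\<^sup>+x. indicator A (\<Sum>j\<in>J. x j * u j, \<Sum>j\<in>J. x j * v j) \<partial>gauss_vec J)"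
      by (subst nn_integral_distr) measurable
    also have "\<dots> = (\<integral>\<^sup>+a. \<integral>\<^sup>+b. indicator A (p * a, q * a + r * b) \<partial>std_gauss \<partial>std_gauss)"
      by (rule F[where F="\<lambda>a b. indicator A (a, b)"]) measurable
    also have "\<dots> = (\<integral>\<^sup>+z. indicator A (fst z, q * fst z + r * snd z) \<partial>(std_gauss \<Otimes>\<^sub>M std_gauss))"
      by (subst std_gauss.nn_integral_fst[symmetric]) (auto simp: p)
    also have "\<dots> = (\<integral>\<^sup>+z. indicator A z \<partial>corr_gauss q)"
      unfolding corr_gauss_def r by (subst nn_integral_distr) (auto simp: case_prod_unfold)
    also have "\<dots> = emeasure (corr_gauss q) A" by simp
    finally show "emeasure (distr (gauss_vec J) (borel \<Otimes>\<^sub>M borel) (\<lambda>x. (\<Sum>j\<in>J. x j * u j, \<Sum>j\<in>J. x j * v j))) A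
      = emeasure (corr_gauss (\<Sum>j\<in>J. u j * v j)) A" by (simp add: q)
  qed simp
qed

section \<open>Noise stability of a balanced sign function\<close>

text \<open>Increments are nondecreasing. With \<open>n = i - 1\<close>, those up to
  \<open>i\<close> are at most \<open>d n\<close> and those after \<open>i\<close> are at least
  \<open>d n\<close>; comparing the two averages gives the chord bound.\<close>

lemma convex_seq_le_chord:
  fixes s :: "nat \<Rightarrow> real"
  assumes conv: "\<And>i. i + 2 \<le> m \<Longrightarrow> 2 * s (i + 1) \<le> s i + s (i + 2)" and im: "i \<le> m"
  shows "real m * s i \<le> (real m - real i) * s 0 + real i * s m"
proof (cases i)
  case (Suc n)
  define d where "d j = s (Suc j) - s j" for j
  have dmono: "d a \<le> d (a + k)" if "a + k < m" for a k
    using that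
  proof (induction k)
    case (Suc k)
    then show ?case using conv[of "a + k"] by (simp add: d_def)
  qed simp
  have low: "s j \<le> s 0 + real j * d n" if "j \<le> i" for j
    using that
  proof (induction j)
    case (Suc j)
    then show ?case using dmono[of j "n - j"] \<open>i = Suc n\<close> im by (simp add: d_def algebra_simps)
  qed simp
  have high: "s i + real k * d n \<le> s (i + k)" if "i + k \<le> m" for k
    using that
  proof (induction k)
    case (Suc k)
    then show ?case using dmono[of n "Suc k"] \<open>i = Suc n\<close> by (simp add: d_def algebra_simps)
  qed simp
  have "(real m - real i) * (s i - s 0) \<le> (real m - real i) * (real i * d n)"
    using low[of i] im by (intro mult_left_mono) auto
  also have "\<dots> = real i * (real (m - i) * d n)" using im by (simp add: of_nat_diff)
  also have "\<dots> \<le> real i * (s m - s i)"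
    using high[of "m - i"] im by (intro mult_left_mono) auto
  finally show ?thesis by (simp add: algebra_simps)
qed simp

text \<open>Midpoint convexity yields convexity only along grids. Monotonicity takes the place of
  continuity in passing from grid points to arbitrary ones, and the grid is then refined.\<close>

lemma mono_midpoint_convex_le_chord:
  fixes g :: "real \<Rightarrow> real"
  assumes mono: "\<And>x y. a \<le> x \<Longrightarrow> x \<le> y \<Longrightarrow> y \<le> c \<Longrightarrow> g x \<le> g y"
    and mid: "\<And>x h. a \<le> x \<Longrightarrow> 0 \<le> h \<Longrightarrow> x + 2 * h \<le> c \<Longrightarrow> 2 * g (x + h) \<le> g x + g (x + 2 * h)"
    and ac: "a < c" and b: "a \<le> b" "b \<le> c"
  shows "g b \<le> g a + (b - a) / (c - a) * (g c - g a)"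
proof -
  define \<tau> where "\<tau> = (b - a) / (c - a)"
  have \<tau>: "0 \<le> \<tau>" "\<tau> \<le> 1" "b = a + \<tau> * (c - a)" using ac b by (auto simp: \<tau>_def)
  have "g b \<le> g a + (\<tau> + 1 / real (Suc n)) * (g c - g a)" for n
  proof -
    define m where "m = Suc n"
    have m0: "0 < real m" by (simp add: m_def)
    define \<delta> where "\<delta> = (c - a) / real m"
    have \<delta>: "0 \<le> \<delta>" "real m * \<delta> = c - a" using ac m0 by (auto simp: \<delta>_def)
    have le: "a + real i * \<delta> \<le> c" if "i \<le> m" for i
    proof -
      have "real i * \<delta> \<le> real m * \<delta>" using that \<delta> by (intro mult_right_mono) auto
      then show ?thesis using \<delta> by simp
    qed
    \<comment> \<open>Rounding up keeps \<open>b\<close> below the grid point, as monotonicity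
      requires, at the price of an error of at most \<open>1 / m\<close> in
      \<open>\<tau>\<close>.\<close>
    define i where "i = nat \<lceil>\<tau> * real m\<rceil>"
    have i: "\<tau> * real m \<le> real i" "real i \<le> \<tau> * real m + 1"
      using \<tau> by (auto simp: i_def)
    have "\<tau> * real m \<le> real m" using \<tau> by (simp add: mult_left_le_one_le)
    then have im: "i \<le> m" by (simp add: i_def nat_le_iff ceiling_le_iff)
    have "real m * g (a + real i * \<delta>) \<le> (real m - real i) * g (a + real 0 * \<delta>) + real i * g (a + real m * \<delta>)"
    proof (rule convex_seq_le_chord[OF _ im])
      fix j assume "j + 2 \<le> m"
      then show "2 * g (a + real (j + 1) * \<delta>) \<le> g (a + real j * \<delta>) + g (a + real (j + 2) * \<delta>)"
        using mid[of "a + real j * \<delta>" \<delta>] le[of "j + 2"] \<delta> by (simp add: algebra_simps)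
    qed
    then have "real m * g (a + real i * \<delta>) \<le> real m * g a + real i * (g c - g a)"
      using \<delta> by (simp add: algebra_simps)
    also have "\<dots> \<le> real m * g a + (\<tau> * real m + 1) * (g c - g a)"
      using i mono[of a c] ac by (intro add_left_mono mult_right_mono) auto
    also have "\<dots> = real m * (g a + (\<tau> + 1 / real m) * (g c - g a))"
      using m0 by (simp add: field_simps)
    finally have "g (a + real i * \<delta>) \<le> g a + (\<tau> + 1 / real m) * (g c - g a)"
      using m0 by simp
    moreover have "g b \<le> g (a + real i * \<delta>)"
    proof (rule mono)
      have "\<tau> * real m * \<delta> \<le> real i * \<delta>" using i \<delta> by (intro mult_right_mono) auto
      then show "b \<le> a + real i * \<delta>" using \<tau> \<delta> by (simp add: mult.assoc)
    qed (use b im le in auto)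
    ultimately show ?thesis by (simp add: m_def)
  qed
  moreover have "(\<lambda>n. g a + (\<tau> + 1 / real (Suc n)) * (g c - g a)) \<longlonglongrightarrow> g a + (\<tau> + 0) * (g c - g a)"
    by (intro tendsto_intros LIMSEQ_Suc[OF lim_1_over_n])
  ultimately have "g b \<le> g a + (\<tau> + 0) * (g c - g a)"
    by (intro LIMSEQ_le_const) auto
  then show ?thesis by (simp add: \<tau>_def)
qed

locale balanced_sign =
  fixes f :: "real \<Rightarrow> real"
  assumes f_measurable[measurable]: "f \<in> borel_measurable borel"
    and f_sign: "f x = 1 \<or> f x = -1"
    and f_balanced: "(\<integral>x. f x \<partial>std_gauss) = 0"
begin

lemma f_sq[simp]: "f x * f x = 1" "(f x)\<^sup>2 = 1"
  using f_sign[of x] by auto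

lemma abs_f[simp]: "\<bar>f x\<bar> = 1"
  using f_sign[of x] by auto

lemma integrable_sign_prod:
  assumes "finite_measure M" and [measurable]: "g \<in> borel_measurable M" "h \<in> borel_measurable M"
  shows "integrable M (\<lambda>x. f (g x) * f (h x))"
  by (rule finite_measure.integrable_const_bound[OF assms(1), of _ 1]) (auto simp: abs_mult)

definition stab :: "real \<Rightarrow> real" where
  "stab t = (\<integral>z. f (fst z) * f (snd z) \<partial>corr_gauss t)"

lemma stab_gauss_vec:
  fixes u v :: "'i \<Rightarrow> real"
  assumes "finite J" "(\<Sum>j\<in>J. (u j)\<^sup>2) = 1" "(\<Sum>j\<in>J. (v j)\<^sup>2) = 1"
  shows "(\<integral>x. f (\<Sum>j\<in>J. x j * u j) * f (\<Sum>j\<in>J. x j * v j) \<partial>gauss_vec J) = stab (\<Sum>j\<in>J. u j * v j)"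
  unfolding stab_def distr_gauss_vec[OF assms, symmetric]
  by (subst integral_distr) auto

lemma stab_eq:
  "stab t = (\<integral>z. f (fst z) * f (t * fst z + sqrt (1 - t\<^sup>2) * snd z) \<partial>(std_gauss \<Otimes>\<^sub>M std_gauss))"
  unfolding stab_def corr_gauss_def by (subst integral_distr) (auto simp: case_prod_unfold)

lemma stab_1[simp]: "stab 1 = 1"
  unfolding stab_eq using std_gauss_pair.prob_space by simp

lemma stab_0[simp]: "stab 0 = 0"
proof -
  have "stab 0 = (\<integral>z. f (fst z) * f (snd z) \<partial>(std_gauss \<Otimes>\<^sub>M std_gauss))"
    unfolding stab_eq by simp
  also have "\<dots> = (\<integral>x. \<integral>y. f x * f y \<partial>std_gauss \<partial>std_gauss)"
    by (subst std_gauss_pair.integral_fst'[symmetric])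
       (auto intro!: integrable_sign_prod std_gauss_pair.finite_measure_axioms)
  also have "\<dots> = 0" by (simp add: f_balanced)
  finally show ?thesis .
qed

text \<open>The form is the second moment of a linear combination of signs \<open>f\<close>, all
  evaluated on one Gaussian vector. Special choices of \<open>u\<close> and \<open>a\<close> yield
  the sign, monotonicity and convexity of \<open>stab\<close>.\<close>

lemma stab_psd:
  fixes u :: "'a \<Rightarrow> 'i \<Rightarrow> real"
  assumes J: "finite J" and I: "finite I" and u: "\<And>i. i \<in> I \<Longrightarrow> (\<Sum>j\<in>J. (u i j)\<^sup>2) = 1"
  shows "0 \<le> (\<Sum>i\<in>I. \<Sum>l\<in>I. a i * a l * stab (\<Sum>j\<in>J. u i j * u l j))"
proof -
  let ?F = "\<lambda>i x. f (\<Sum>j\<in>J. x j * u i j)"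
  have int: "integrable (gauss_vec J) (\<lambda>x. ?F i x * ?F l x)" for i l
    by (intro integrable_sign_prod prob_space.finite_measure[OF prob_space_gauss_vec]) measurable
  have "(\<Sum>i\<in>I. \<Sum>l\<in>I. a i * a l * stab (\<Sum>j\<in>J. u i j * u l j))
    = (\<Sum>i\<in>I. \<Sum>l\<in>I. a i * a l * (\<integral>x. ?F i x * ?F l x \<partial>gauss_vec J))"
    by (intro sum.cong refl) (simp add: stab_gauss_vec J u)
  also have "\<dots> = (\<integral>x. (\<Sum>i\<in>I. \<Sum>l\<in>I. a i * a l * (?F i x * ?F l x)) \<partial>gauss_vec J)"
    using int by (simp add: integral_sum)
  also have "\<dots> = (\<integral>x. (\<Sum>i\<in>I. a i * ?F i x)\<^sup>2 \<partial>gauss_vec J)"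
    by (simp add: power2_eq_square sum_product algebra_simps)
  also have "\<dots> \<ge> 0" by simp
  finally show ?thesis .
qed

text \<open>Shorter vectors are completed to unit vectors by fresh private coordinates, in \<open>M\<close> independent copies:
  the diagonal terms that this introduces are negligible compared to the \<open>M\<^sup>2\<close> off-diagonal ones.\<close>

lemma stab_psd_subunit:
  fixes u :: "'a \<Rightarrow> 'i \<Rightarrow> real"
  assumes J: "finite J" and I: "finite I" and u: "\<And>i. i \<in> I \<Longrightarrow> (\<Sum>j\<in>J. (u i j)\<^sup>2) \<le> 1"
  shows "0 \<le> (\<Sum>i\<in>I. \<Sum>l\<in>I. a i * a l * stab (\<Sum>j\<in>J. u i j * u l j))" (is "0 \<le> ?S")
proof -
  define G where "G i l = (\<Sum>j\<in>J. u i j * u l j)" for i l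
  define D where "D = (\<Sum>i\<in>I. (a i)\<^sup>2 * (1 - stab (G i i)))"
  have GG: "G i i \<le> 1" if "i \<in> I" for i using u[OF that] by (simp add: G_def power2_eq_square)
  have "0 \<le> ?S + D / real (Suc n)" for n
  proof -
    define M where "M = Suc n"
    have M: "0 < real M" by (simp add: M_def)
    define w where "w p = (\<lambda>c. case c of Inl j \<Rightarrow> u (fst p) j
        | Inr q \<Rightarrow> if q = p then sqrt (1 - G (fst p) (fst p)) else 0)" for p :: "'a \<times> nat"
    define J' where "J' = J <+> (I \<times> {..<M})"
    have J': "finite J'" using J I by (simp add: J'_def)
    have inner: "(\<Sum>c\<in>J'. w p c * w q c) = G (fst p) (fst q) + (if p = q then 1 - G (fst p) (fst p) else 0)"
      if "p \<in> I \<times> {..<M}" for p q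
    proof -
      have "(\<Sum>c\<in>J'. w p c * w q c) = G (fst p) (fst q) + (\<Sum>r\<in>I \<times> {..<M}. w p (Inr r) * w q (Inr r))"
        unfolding J'_def using J I by (subst sum.Plus) (auto simp: w_def G_def)
      also have "(\<Sum>r\<in>I \<times> {..<M}. w p (Inr r) * w q (Inr r)) = (\<Sum>r\<in>I \<times> {..<M}. if r = p then w p (Inr p) * w q (Inr p) else 0)"
        by (intro sum.cong) (auto simp: w_def)
      also have "\<dots> = (if p = q then 1 - G (fst p) (fst p) else 0)"
        using that I GG[of "fst p"] by (subst sum.delta) (auto simp: w_def)
      finally show ?thesis .
    qed
    have copies: "(\<Sum>p\<in>I \<times> {..<M}. h (fst p)) = real M * (\<Sum>i\<in>I. h i)" for h :: "'a \<Rightarrow> real"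
      by (simp add: sum.cartesian_product' sum_distrib_left)
    have "0 \<le> (\<Sum>p\<in>I \<times> {..<M}. \<Sum>q\<in>I \<times> {..<M}. a (fst p) * a (fst q) * stab (\<Sum>c\<in>J'. w p c * w q c))"
    proof (rule stab_psd[OF J'])
      fix p assume "p \<in> I \<times> {..<M}"
      then show "(\<Sum>c\<in>J'. (w p c)\<^sup>2) = 1" using inner[of p p] by (simp add: power2_eq_square)
    qed (use I in auto)
    also have "\<dots> = (\<Sum>p\<in>I \<times> {..<M}. \<Sum>q\<in>I \<times> {..<M}. a (fst p) * a (fst q) * stab (G (fst p) (fst q))
        + (if q = p then (a (fst p))\<^sup>2 * (1 - stab (G (fst p) (fst p))) else 0))"
      by (intro sum.cong refl) (auto simp: inner power2_eq_square algebra_simps)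
    also have "\<dots> = (\<Sum>p\<in>I \<times> {..<M}. \<Sum>q\<in>I \<times> {..<M}. a (fst p) * a (fst q) * stab (G (fst p) (fst q)))
        + (\<Sum>p\<in>I \<times> {..<M}. (a (fst p))\<^sup>2 * (1 - stab (G (fst p) (fst p))))"
      using I by (simp add: sum.distrib sum.delta)
    also have "\<dots> = (real M)\<^sup>2 * ?S + real M * D"
    proof -
      have "(\<Sum>p\<in>I \<times> {..<M}. \<Sum>q\<in>I \<times> {..<M}. a (fst p) * a (fst q) * stab (G (fst p) (fst q)))
        = (\<Sum>p\<in>I \<times> {..<M}. real M * (\<Sum>l\<in>I. a (fst p) * a l * stab (G (fst p) l)))"
        by (intro sum.cong refl copies)
      also have "\<dots> = real M * (\<Sum>i\<in>I. real M * (\<Sum>l\<in>I. a i * a l * stab (G i l)))"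
        by (rule copies)
      finally show ?thesis
        unfolding copies[of "\<lambda>i. (a i)\<^sup>2 * (1 - stab (G i i))"]
        by (simp add: sum_distrib_left[symmetric] G_def D_def power2_eq_square)
    qed
    also have "\<dots> = (real M)\<^sup>2 * (?S + D / real M)"
      using M by (simp add: field_simps power2_eq_square)
    finally show ?thesis using M by (simp add: zero_le_mult_iff M_def)
  qed
  moreover have "(\<lambda>n. ?S + D * (1 / real (Suc n))) \<longlonglongrightarrow> ?S + D * 0"
    by (intro tendsto_intros LIMSEQ_Suc[OF lim_1_over_n])
  ultimately have "0 \<le> ?S + D * 0"
    by (intro LIMSEQ_le_const) auto
  then show ?thesis by simp
qed

text \<open>One vector of squared length \<open>t\<close> with coefficient 1. Admitting short
  vectors is essential here, since a unit vector would only speak about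
  \<open>stab 1\<close>.\<close>

lemma stab_nonneg:
  assumes "0 \<le> t" "t \<le> 1"
  shows "0 \<le> stab t"
  using stab_psd_subunit[of "{()}" "{()}" "\<lambda>_ _. sqrt t" "\<lambda>_. 1"] assms by simp

text \<open>Two vectors of squared length \<open>t\<close> share a component of squared length
  \<open>s\<close>; with coefficients 1 and -1 the form is
  \<open>2 * (stab t - stab s)\<close>.\<close>

lemma stab_mono:
  assumes "0 \<le> s" "s \<le> t" "t \<le> 1"
  shows "stab s \<le> stab t"
proof -
  define u where "u i j = (if j = 2 then sqrt s else if j = i then sqrt (t - s) else 0)" for i j :: nat
  have "0 \<le> (\<Sum>i\<in>{0,1::nat}. \<Sum>l\<in>{0,1}. (-1)^i * (-1)^l * stab (\<Sum>j\<in>{0,1,2::nat}. u i j * u l j))"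
    by (rule stab_psd_subunit) (use assms in \<open>auto simp: u_def\<close>)
  then show ?thesis using assms by (simp add: u_def)
qed

text \<open>Vectors are indexed by two bits. Each bit selects one of two private coordinates (0, 1
  and 2, 3) of weight \<open>sqrt h\<close>, and coordinate 4 is common, so inner products are
  \<open>t + h\<close> times the number of agreeing bits. With the parity signs the form is 4 times
  the second difference.\<close>

lemma stab_midpoint:
  assumes "0 \<le> t" "0 \<le> h" "t + 2 * h \<le> 1"
  shows "2 * stab (t + h) \<le> stab t + stab (t + 2 * h)"
proof -
  define u where "u p j = (if j = 4 then sqrt t else if j = fst p \<or> j = 2 + snd p then sqrt h else 0)" for p :: "nat \<times> nat" and j :: nat
  have "0 \<le> (\<Sum>i\<in>{(0,0),(0,1),(1,0),(1,1)}. \<Sum>l\<in>{(0,0),(0,1),(1,0),(1,1)}. 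
     (-1)^(fst i + snd i) * (-1)^(fst l + snd l) * stab (\<Sum>j\<in>{0,1,2,3,4}. u i j * u l j))"
    by (rule stab_psd_subunit) (use assms in \<open>auto simp: u_def\<close>)
  then show ?thesis using assms by (simp add: u_def algebra_simps)
qed

lemma stab_le_chord:
  assumes "0 \<le> a" "a < c" "c \<le> 1" "a \<le> b" "b \<le> c"
  shows "stab b \<le> stab a + (b - a) / (c - a) * (stab c - stab a)"
  by (rule mono_midpoint_convex_le_chord) (use assms in \<open>auto intro!: stab_mono stab_midpoint\<close>)

text \<open>The triangle inequality for the probability \<open>(1 - stab t) / 2\<close> that two signs disagree.\<close>

lemma stab_triangle:
  fixes u v w :: "'i \<Rightarrow> real"
  assumes J: "finite J" and unit: "(\<Sum>j\<in>J. (u j)\<^sup>2) = 1" "(\<Sum>j\<in>J. (v j)\<^sup>2) = 1" "(\<Sum>j\<in>J. (w j)\<^sup>2) = 1"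
  shows "stab (\<Sum>j\<in>J. u j * v j) + stab (\<Sum>j\<in>J. v j * w j) \<le> 1 + stab (\<Sum>j\<in>J. u j * w j)"
proof -
  interpret prob_space "gauss_vec J" by (rule prob_space_gauss_vec)
  let ?F = "\<lambda>u x. f (\<Sum>j\<in>J. x j * u j)"
  have int: "integrable (gauss_vec J) (\<lambda>x. ?F u x * ?F v x)" for u v
    by (intro integrable_sign_prod finite_measure_axioms) measurable
  have *: "f a * f b + f b * f c \<le> 1 + f a * f c" for a b c
    using f_sign[of a] f_sign[of b] f_sign[of c] by auto
  have "(\<integral>x. ?F u x * ?F v x + ?F v x * ?F w x \<partial>gauss_vec J) \<le> (\<integral>x. 1 + ?F u x * ?F w x \<partial>gauss_vec J)"
    by (intro integral_mono * Bochner_Integration.integrable_add int) simp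
  then show ?thesis
    using int prob_space by (simp add: stab_gauss_vec J unit)
qed

text \<open>The vector halfway between two orthogonal unit vectors has inner product
  \<open>sqrt (1/2)\<close> with both. The triangle inequality gives
  \<open>2 * stab (sqrt (1/2)) \<le> 1 + stab 0\<close>, and balance makes the last term 0.\<close>

lemma stab_sqrt_half: "stab (sqrt (1/2)) \<le> 1 / 2"
proof -
  define u where "u i = (if i = 0 then 1 else 0 :: real)" for i :: nat
  define w where "w i = (if i = 1 then 1 else 0 :: real)" for i :: nat
  have "stab (\<Sum>j\<in>{0,1}. u j * sqrt (1/2)) + stab (\<Sum>j\<in>{0,1}. sqrt (1/2) * w j) \<le> 1 + stab (\<Sum>j\<in>{0,1}. u j * w j)"
    by (rule stab_triangle) (auto simp: u_def w_def real_sqrt_divide power_divide)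
  then show ?thesis by (simp add: u_def w_def)
qed

end

section \<open>Stability at small correlation\<close>

lemma has_bochner_integral_abs_le:
  fixes f g :: "'a \<Rightarrow> real"
  assumes f: "has_bochner_integral M f a" and g: "has_bochner_integral M g b"
    and le: "\<And>x. \<bar>f x\<bar> \<le> g x"
  shows "\<bar>a\<bar> \<le> b"
proof -
  have "norm (\<integral>x. f x \<partial>M) \<le> (\<integral>x. norm (f x) \<partial>M)"
    by (rule integral_norm_bound)
  also have "\<dots> \<le> (\<integral>x. g x \<partial>M)"
    by (rule integral_mono) (use f g le in \<open>auto simp: has_bochner_integral_iff\<close>)
  finally show ?thesis using f g by (simp add: has_bochner_integral_iff)
qed

lemma has_bochner_integral_std_gauss_iff:
  fixes g :: "real \<Rightarrow> real"
  assumes [measurable]: "g \<in> borel_measurable borel"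
  shows "has_bochner_integral std_gauss g I \<longleftrightarrow> has_bochner_integral lborel (\<lambda>x. std_normal_density x * g x) I"
  unfolding std_gauss_def has_bochner_integral_iff
  by (simp add: integrable_density integral_density)

lemma std_gauss_moments:
  "has_bochner_integral std_gauss (\<lambda>x. x) 0"
  "has_bochner_integral std_gauss (\<lambda>x. x\<^sup>2) 1"
  "has_bochner_integral std_gauss (\<lambda>x. \<bar>x\<bar>) (sqrt (2 / pi))"
  using std_normal_moment_odd[of 0] std_normal_moment_even[of 1] std_normal_moment_abs_odd[of 0]
  by (simp_all add: has_bochner_integral_std_gauss_iff)

lemma std_gauss_exp_quadratic:
  fixes a d :: real
  assumes a: "a < 1 / 2"
  shows "has_bochner_integral std_gauss (\<lambda>b. exp (a * b\<^sup>2 + d * b)) (exp (d\<^sup>2 / (2 * (1 - 2 * a))) / sqrt (1 - 2 * a))"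
proof -
  define e where "e = 1 - 2 * a"
  have e: "0 < e" using a by (simp add: e_def)
  define \<sigma> where "\<sigma> = 1 / sqrt e"
  have \<sigma>: "0 < \<sigma>" "\<sigma>\<^sup>2 = 1 / e" using e by (simp_all add: \<sigma>_def power_divide)
  have "std_normal_density b * exp (a * b\<^sup>2 + d * b)
      = (exp (d\<^sup>2 / (2 * e)) / sqrt e) * normal_density (d / e) \<sigma> b" for b
  proof -
    have "- (b - d / e)\<^sup>2 / (2 * \<sigma>\<^sup>2) + d\<^sup>2 / (2 * e) = - b\<^sup>2 / 2 + (a * b\<^sup>2 + d * b)"
      using e unfolding \<sigma> by (simp add: e_def[symmetric] power2_eq_square field_simps) (simp add: e_def algebra_simps)
    moreover have "sqrt e * sqrt (2 * pi * \<sigma>\<^sup>2) = sqrt (2 * pi)"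
      using e unfolding \<sigma> by (simp add: real_sqrt_mult[symmetric])
    ultimately show ?thesis
      unfolding std_normal_density_def normal_density_def
      by (simp add: mult_exp_exp exp_add[symmetric] field_simps)
  qed
  moreover have "has_bochner_integral lborel (\<lambda>b. (exp (d\<^sup>2 / (2 * e)) / sqrt e) * normal_density (d / e) \<sigma> b)
     ((exp (d\<^sup>2 / (2 * e)) / sqrt e) * 1)"
    using \<sigma> by (intro has_bochner_integral_mult_right) (simp add: has_bochner_integral_iff)
  ultimately show ?thesis
    by (simp add: has_bochner_integral_std_gauss_iff e_def)
qed

text \<open>Density of \<open>N(t x, 1 - t\<^sup>2)\<close> with respect to the standard Gaussian (the Mehler kernel).\<close>

definition mehler :: "real \<Rightarrow> real \<Rightarrow> real \<Rightarrow> real" where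
  "mehler t x y = exp ((y\<^sup>2 - (y - t * x)\<^sup>2 / (1 - t\<^sup>2)) / 2) / sqrt (1 - t\<^sup>2)"

lemma measurable_mehler[measurable]: "mehler t x \<in> borel_measurable borel"
  unfolding mehler_def[abs_def] by measurable

lemma mehler_nonneg: "\<bar>t\<bar> < 1 \<Longrightarrow> 0 \<le> mehler t x y"
  by (simp add: mehler_def abs_square_le_1)

lemma distr_std_gauss_affine:
  assumes t: "\<bar>t\<bar> < 1"
  shows "distr std_gauss borel (\<lambda>b. t * x + sqrt (1 - t\<^sup>2) * b) = density std_gauss (\<lambda>y. ennreal (mehler t x y))"
proof (rule measure_eqI)
  fix A assume "A \<in> sets (distr std_gauss borel (\<lambda>b. t * x + sqrt (1 - t\<^sup>2) * b))"
  then have [measurable]: "A \<in> sets borel" by simp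
  define r where "r = sqrt (1 - t\<^sup>2)"
  have r: "0 < r" "r\<^sup>2 = 1 - t\<^sup>2" using t by (auto simp: r_def abs_square_less_1 abs_square_le_1 less_imp_le)
  have dens: "std_normal_density ((y - t * x) / r) * (1 / r) = std_normal_density y * mehler t x y" for y
  proof -
    have "- ((y - t * x) / r)\<^sup>2 / 2 = - y\<^sup>2 / 2 + (y\<^sup>2 - (y - t * x)\<^sup>2 / r\<^sup>2) / 2"
      by (simp add: power_divide field_simps)
    then show ?thesis
      unfolding std_normal_density_def mehler_def r(2)[symmetric] using r(1) by (simp add: mult_exp_exp)
  qed
  have "emeasure (distr std_gauss borel (\<lambda>b. t * x + r * b)) A = (\<integral>\<^sup>+b. indicator A (t * x + r * b) \<partial>std_gauss)"
    by (subst nn_integral_indicator[symmetric], simp, subst nn_integral_distr) auto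
  also have "\<dots> = (\<integral>\<^sup>+b. ennreal (std_normal_density b) * indicator A (t * x + r * b) \<partial>lborel)"
    by (simp add: nn_integral_std_gauss)
  also have "\<dots> = ennreal \<bar>1 / r\<bar> * (\<integral>\<^sup>+y. ennreal (std_normal_density (- (t * x / r) + 1 / r * y)) * indicator A (t * x + r * (- (t * x / r) + 1 / r * y)) \<partial>lborel)"
    using r by (subst nn_integral_real_affine[where c="1/r" and t="- (t * x / r)"]) auto
  also have "\<dots> = (\<integral>\<^sup>+y. ennreal (std_normal_density ((y - t * x) / r) * (1 / r)) * indicator A y \<partial>lborel)"
  proof -
    have e1: "- (t * x / r) + 1 / r * y = (y - t * x) / r" for y by (simp add: diff_divide_distrib)
    have e2: "t * x + r * ((y - t * x) / r) = y" for y using r by simp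
    show ?thesis unfolding e1 e2 using r(1)
      by (subst nn_integral_cmult[symmetric]) (auto simp: ennreal_mult' mult_ac simp del: times_divide_eq_right times_divide_eq_left intro!: nn_integral_cong)
  qed
  also have "\<dots> = (\<integral>\<^sup>+y. ennreal (mehler t x y) * indicator A y \<partial>std_gauss)"
    unfolding dens using mehler_nonneg[OF t]
    by (subst nn_integral_std_gauss) (auto simp: ennreal_mult' mult_ac)
  also have "\<dots> = emeasure (density std_gauss (\<lambda>y. ennreal (mehler t x y))) A"
    by (simp add: emeasure_density)
  finally show "emeasure (distr std_gauss borel (\<lambda>b. t * x + sqrt (1 - t\<^sup>2) * b)) A
    = emeasure (density std_gauss (\<lambda>y. ennreal (mehler t x y))) A" by (simp add: r_def)
qed simp

lemma has_bochner_integral_mehler: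
  fixes g :: "real \<Rightarrow> real"
  assumes t: "\<bar>t\<bar> < 1" and [measurable]: "g \<in> borel_measurable borel"
  shows "has_bochner_integral std_gauss (\<lambda>y. mehler t x y * g y) I
    \<longleftrightarrow> has_bochner_integral std_gauss (\<lambda>b. g (t * x + sqrt (1 - t\<^sup>2) * b)) I"
proof -
  have "has_bochner_integral std_gauss (\<lambda>y. mehler t x y * g y) I
    \<longleftrightarrow> has_bochner_integral (density std_gauss (\<lambda>y. ennreal (mehler t x y))) g I"
    using mehler_nonneg[OF t] by (auto simp: has_bochner_integral_iff integrable_density integral_density)
  also have "\<dots> \<longleftrightarrow> has_bochner_integral std_gauss (\<lambda>b. g (t * x + sqrt (1 - t\<^sup>2) * b)) I"
    unfolding distr_std_gauss_affine[OF t, symmetric]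
    by (auto simp: has_bochner_integral_iff integrable_distr_eq integral_distr)
  finally show ?thesis .
qed

text \<open>These are the nontrivial moments in the square of
  \<open>mehler t x y - 1 - t * x * y\<close>, the kernel minus its Hermite expansion up to degree
  1.\<close>

lemma mehler_moments:
  assumes t: "\<bar>t\<bar> < 1"
  shows "has_bochner_integral std_gauss (mehler t x) 1"
    and "has_bochner_integral std_gauss (\<lambda>y. mehler t x y * y) (t * x)"
    and "has_bochner_integral std_gauss (\<lambda>y. (mehler t x y)\<^sup>2) (exp (x\<^sup>2 * (t\<^sup>2 / (1 + t\<^sup>2))) / (sqrt (1 - t\<^sup>2) * sqrt (1 + t\<^sup>2)))"
proof -
  have c: "has_bochner_integral std_gauss (\<lambda>b. c) c" for c :: real
    using std_gauss.prob_space by (simp add: has_bochner_integral_iff)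
  show "has_bochner_integral std_gauss (mehler t x) 1"
    using has_bochner_integral_mehler[OF t, of "\<lambda>_. 1" x 1] c[of 1] by simp
  have "has_bochner_integral std_gauss (\<lambda>b. t * x + sqrt (1 - t\<^sup>2) * b) (t * x + sqrt (1 - t\<^sup>2) * 0)"
    by (intro has_bochner_integral_add c has_bochner_integral_mult_right std_gauss_moments)
  then show "has_bochner_integral std_gauss (\<lambda>y. mehler t x y * y) (t * x)"
    using has_bochner_integral_mehler[OF t, of "\<lambda>y. y" x "t * x"] by simp
  define w where "w = 1 - t\<^sup>2"
  have w: "0 < w" using t by (simp add: w_def abs_square_less_1)
  have t2: "t\<^sup>2 = 1 - w" by (simp add: w_def)
  have sq: "(mehler t x y)\<^sup>2 = exp (- (t * x)\<^sup>2 / w) / w * exp ((- t\<^sup>2 / w) * y\<^sup>2 + (2 * t * x / w) * y)" for y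
  proof -
    have "(mehler t x y)\<^sup>2 = exp (y\<^sup>2 - (y - t * x)\<^sup>2 / w) / w"
      using w unfolding mehler_def w_def[symmetric] by (simp add: power_divide exp_double[symmetric])
    also have "y\<^sup>2 - (y - t * x)\<^sup>2 / w = - (t * x)\<^sup>2 / w + ((- t\<^sup>2 / w) * y\<^sup>2 + (2 * t * x / w) * y)"
      using w by (simp add: field_simps) (simp add: power2_eq_square algebra_simps w_def)
    finally show ?thesis by (simp only: exp_add times_divide_eq_left)
  qed
  have "- t\<^sup>2 / w \<le> 0" using w by simp
  then have a: "- t\<^sup>2 / w < 1 / 2" by linarith
  have e: "1 - 2 * (- t\<^sup>2 / w) = (1 + t\<^sup>2) / w" using w by (simp add: field_simps w_def)
  have p: "0 < 1 + t\<^sup>2" by (simp add: add_pos_nonneg)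
  have "has_bochner_integral std_gauss (\<lambda>y. (mehler t x y)\<^sup>2)
    (exp (- (t * x)\<^sup>2 / w) / w * (exp ((2 * t * x / w)\<^sup>2 / (2 * ((1 + t\<^sup>2) / w))) / sqrt ((1 + t\<^sup>2) / w)))"
    unfolding sq using std_gauss_exp_quadratic[OF a, of "2 * t * x / w"]
    unfolding e by (rule has_bochner_integral_mult_right)
  moreover have "exp (- (t * x)\<^sup>2 / w) / w * (exp ((2 * t * x / w)\<^sup>2 / (2 * ((1 + t\<^sup>2) / w))) / sqrt ((1 + t\<^sup>2) / w))
    = exp (x\<^sup>2 * (t\<^sup>2 / (1 + t\<^sup>2))) / (sqrt w * sqrt (1 + t\<^sup>2))"
  proof -
    have "- (t * x)\<^sup>2 / w + (2 * t * x / w)\<^sup>2 / (2 * ((1 + t\<^sup>2) / w)) = x\<^sup>2 * (t\<^sup>2 / (1 + t\<^sup>2))"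
      using w p by (simp add: divide_simps) (simp add: power2_eq_square algebra_simps w_def)
    moreover have "w * sqrt ((1 + t\<^sup>2) / w) = sqrt w * sqrt (1 + t\<^sup>2)"
      using w by (simp add: real_sqrt_divide field_simps)
    ultimately show ?thesis by (simp add: mult_exp_exp)
  qed
  ultimately show "has_bochner_integral std_gauss (\<lambda>y. (mehler t x y)\<^sup>2) (exp (x\<^sup>2 * (t\<^sup>2 / (1 + t\<^sup>2))) / (sqrt (1 - t\<^sup>2) * sqrt (1 + t\<^sup>2)))"
    by (simp add: w_def)
qed

context balanced_sign
begin

lemma integrable_sign[simp]:
  assumes "finite_measure M" "g \<in> borel_measurable M"
  shows "integrable M (\<lambda>x. f (g x))"
  by (rule finite_measure.integrable_const_bound[OF assms(1), of _ 1]) (use assms in auto)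

lemma stab_iterated:
  "stab t = (\<integral>x. f x * (\<integral>b. f (t * x + sqrt (1 - t\<^sup>2) * b) \<partial>std_gauss) \<partial>std_gauss)"
proof -
  have "stab t = (\<integral>x. \<integral>b. f x * f (t * x + sqrt (1 - t\<^sup>2) * b) \<partial>std_gauss \<partial>std_gauss)"
    unfolding stab_eq
    by (subst std_gauss_pair.integral_fst'[symmetric])
       (auto intro!: integrable_sign_prod std_gauss_pair.finite_measure_axioms)
  then show ?thesis by simp
qed

text \<open>In the expansion of the kernel the constant term is killed by balance. The linear term
  contributes at most \<open>t\<close> times the squared mean of \<open>\<bar>x\<bar>\<close>, which
  is \<open>2 / pi\<close>. The remainder is bounded through its second moment.\<close>

lemma stab_le_small:
  assumes t: "0 < t" "t < 1"
  shows "stab t \<le> 2 / pi * t + t\<^sup>2 / sqrt (1 - t\<^sup>2)"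
proof -
  have t': "\<bar>t\<bar> < 1" using t by simp
  define w where "w = 1 - t\<^sup>2"
  have w: "0 < w" using t by (simp add: w_def abs_square_less_1)
  \<comment> \<open>\<open>c\<close> is the L2 norm of the remainder under two independent
    Gaussians, as \<open>1 / w - 1 - t^2 = t^4 / w\<close>. It is the optimal weight in the bound of
    \<open>\<bar>T\<bar>\<close> by \<open>(T^2 / c + c) / 2\<close>; as it does not depend on
    \<open>x\<close>, only the average over \<open>x\<close> of the second moment matters.\<close>
  define c where "c = t\<^sup>2 / sqrt w"
  have c: "0 < c" using t w by (simp add: c_def)
  define h where "h x = exp (x\<^sup>2 * (t\<^sup>2 / (1 + t\<^sup>2))) / (sqrt w * sqrt (1 + t\<^sup>2))" for x :: real
  define B where "B x = t * sqrt (2 / pi) * \<bar>x\<bar> + ((h x - 1 - t\<^sup>2 * x\<^sup>2) / c + c) / 2" for x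
  have const: "has_bochner_integral std_gauss (\<lambda>b. c) c" for c :: real
    using std_gauss.prob_space by (simp add: has_bochner_integral_iff)
  have inner: "\<bar>\<integral>b. f (t * x + sqrt (1 - t\<^sup>2) * b) \<partial>std_gauss\<bar> \<le> B x" for x
  proof -
    let ?T = "\<lambda>y. mehler t x y - 1 - t * x * y"
    have bal: "has_bochner_integral std_gauss f 0"
      using f_balanced by (simp add: has_bochner_integral_iff std_gauss.finite_measure_axioms)
    define I where "I = (\<integral>b. f (t * x + sqrt (1 - t\<^sup>2) * b) \<partial>std_gauss)"
    have "has_bochner_integral std_gauss (\<lambda>y. mehler t x y * f y) I"
      unfolding has_bochner_integral_mehler[OF t' f_measurable] I_def
      by (simp add: has_bochner_integral_iff std_gauss.finite_measure_axioms)
    then have I: "has_bochner_integral std_gauss (\<lambda>y. mehler t x y * f y - f y) (I - 0)"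
      using bal by (rule has_bochner_integral_diff)
    have T2: "has_bochner_integral std_gauss (\<lambda>y. ((mehler t x y)\<^sup>2 + 1 + t\<^sup>2 * x\<^sup>2 * y\<^sup>2) - 2 * mehler t x y - 2 * t * x * (mehler t x y * y) + 2 * t * x * y)
      ((h x + 1 + t\<^sup>2 * x\<^sup>2 * 1) - 2 * 1 - 2 * t * x * (t * x) + 2 * t * x * 0)"
      unfolding h_def w_def
      by (intro has_bochner_integral_add has_bochner_integral_diff has_bochner_integral_mult_right
          mehler_moments[OF t'] std_gauss_moments const)
    have bd: "has_bochner_integral std_gauss (\<lambda>y. t * \<bar>x\<bar> * \<bar>y\<bar> + (1 / c * (((mehler t x y)\<^sup>2 + 1 + t\<^sup>2 * x\<^sup>2 * y\<^sup>2) - 2 * mehler t x y - 2 * t * x * (mehler t x y * y) + 2 * t * x * y) + c) * (1/2))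
      (t * \<bar>x\<bar> * sqrt (2 / pi) + (1 / c * ((h x + 1 + t\<^sup>2 * x\<^sup>2 * 1) - 2 * 1 - 2 * t * x * (t * x) + 2 * t * x * 0) + c) * (1/2))"
      by (intro has_bochner_integral_add has_bochner_integral_mult_right has_bochner_integral_mult_left T2 std_gauss_moments const)
    have le: "\<bar>mehler t x y * f y - f y\<bar> \<le> t * \<bar>x\<bar> * \<bar>y\<bar> + (1 / c * (((mehler t x y)\<^sup>2 + 1 + t\<^sup>2 * x\<^sup>2 * y\<^sup>2) - 2 * mehler t x y - 2 * t * x * (mehler t x y * y) + 2 * t * x * y) + c) * (1/2)" for y
    proof -
      have "\<bar>mehler t x y * f y - f y\<bar> = \<bar>mehler t x y - 1\<bar> * \<bar>f y\<bar>"
        by (subst abs_mult[symmetric]) (simp add: algebra_simps)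
      also have "\<dots> \<le> \<bar>t * x * y\<bar> + \<bar>?T y\<bar>" by simp
      also have "\<bar>?T y\<bar> \<le> (1 / c * (?T y)\<^sup>2 + c) * (1/2)"
      proof -
        have "0 \<le> (\<bar>?T y\<bar> - c)\<^sup>2 / c" using c by simp
        also have "\<dots> = 1 / c * (?T y)\<^sup>2 + c - 2 * \<bar>?T y\<bar>"
          using c by (simp add: power2_diff field_simps) (simp add: power2_eq_square)
        finally show ?thesis by simp
      qed
      also have "(?T y)\<^sup>2 = ((mehler t x y)\<^sup>2 + 1 + t\<^sup>2 * x\<^sup>2 * y\<^sup>2) - 2 * mehler t x y - 2 * t * x * (mehler t x y * y) + 2 * t * x * y"
        by (simp add: power2_eq_square algebra_simps)
      finally show ?thesis using t by (simp add: abs_mult)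
    qed
    have "\<bar>I - 0\<bar> \<le> t * \<bar>x\<bar> * sqrt (2 / pi) + (1 / c * ((h x + 1 + t\<^sup>2 * x\<^sup>2 * 1) - 2 * 1 - 2 * t * x * (t * x) + 2 * t * x * 0) + c) * (1/2)"
      by (rule has_bochner_integral_abs_le[OF I bd le])
    also have "\<dots> = B x" by (simp add: B_def power2_eq_square algebra_simps add_divide_distrib diff_divide_distrib)
    finally show ?thesis by (simp add: I_def)
  qed
  have "has_bochner_integral std_gauss (\<lambda>x. exp (t\<^sup>2 / (1 + t\<^sup>2) * x\<^sup>2 + 0 * x))
     (exp (0\<^sup>2 / (2 * (1 - 2 * (t\<^sup>2 / (1 + t\<^sup>2))))) / sqrt (1 - 2 * (t\<^sup>2 / (1 + t\<^sup>2))))"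
    by (rule std_gauss_exp_quadratic) (use w in \<open>simp add: w_def field_simps add_pos_nonneg\<close>)
  then have "has_bochner_integral std_gauss h (1 / sqrt (1 - 2 * (t\<^sup>2 / (1 + t\<^sup>2))) / (sqrt w * sqrt (1 + t\<^sup>2)))"
    unfolding h_def[abs_def] by (intro has_bochner_integral_divide_zero) (simp add: mult.commute)
  also have "1 / sqrt (1 - 2 * (t\<^sup>2 / (1 + t\<^sup>2))) / (sqrt w * sqrt (1 + t\<^sup>2)) = 1 / w"
  proof -
    have p: "0 < 1 + t\<^sup>2" by (simp add: add_pos_nonneg)
    have "1 - 2 * (t\<^sup>2 / (1 + t\<^sup>2)) = w / (1 + t\<^sup>2)" using p by (simp add: w_def field_simps)
    moreover have "sqrt (w / (1 + t\<^sup>2)) * (sqrt w * sqrt (1 + t\<^sup>2)) = w"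
      using p w by (simp add: real_sqrt_divide)
    ultimately show ?thesis by (simp add: divide_divide_eq_left)
  qed
  finally have h: "has_bochner_integral std_gauss h (1 / w)" .
  have "has_bochner_integral std_gauss B (t * sqrt (2 / pi) * sqrt (2 / pi) + ((1 / w - 1 - t\<^sup>2 * 1) / c + c) / 2)"
    unfolding B_def[abs_def]
    by (intro has_bochner_integral_add has_bochner_integral_diff has_bochner_integral_mult_right
          has_bochner_integral_divide_zero h std_gauss_moments const)
  also have "t * sqrt (2 / pi) * sqrt (2 / pi) + ((1 / w - 1 - t\<^sup>2 * 1) / c + c) / 2 = 2 / pi * t + c"
  proof -
    have "1 / w - 1 - t\<^sup>2 * 1 = c * c"
      using w by (simp add: c_def field_simps power2_eq_square[symmetric]) (simp add: w_def power4_eq_xxxx power2_eq_square algebra_simps)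
    moreover have "t * sqrt (2 / pi) * sqrt (2 / pi) = 2 / pi * t" by (simp add: mult.assoc)
    ultimately show ?thesis using c by simp
  qed
  finally have B: "has_bochner_integral std_gauss B (2 / pi * t + c)" .
  have "stab t \<le> (\<integral>x. B x \<partial>std_gauss)"
    unfolding stab_iterated
  proof (rule integral_mono')
    show "integrable std_gauss B" using B by (simp add: has_bochner_integral_iff)
    fix x
    show "f x * (\<integral>b. f (t * x + sqrt (1 - t\<^sup>2) * b) \<partial>std_gauss) \<le> B x"
      using inner[of x] f_sign[of x] by auto
    show "0 \<le> B x" using inner[of x] by linarith
  qed
  then show ?thesis using B by (simp add: has_bochner_integral_iff c_def w_def)
qed

end

section \<open>The exponential bound and positivity\<close>

lemma ln2_gt: "693 / 1000 \<le> ln (2 :: real)"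
  using ln_approx_bounds[of 2 3] by (simp add: eval_nat_numeral)

text \<open>Quadratic Taylor bound of \<open>exp (t * ln 2)\<close>; \<open>24 / 100\<close> lies
  just below half of the square of \<open>0.693\<close>.\<close>

lemma two_powr_lower:
  fixes t :: real
  assumes "0 \<le> t"
  shows "1 + 693 / 1000 * t + 24 / 100 * t\<^sup>2 \<le> 2 powr t"
proof -
  have "693 / 1000 * t \<le> t * ln 2" using mult_left_mono[OF ln2_gt assms] by (simp only: mult.commute)
  moreover from this have "(693 / 1000 * t)\<^sup>2 \<le> (t * ln 2)\<^sup>2" using assms by (intro power_mono) auto
  moreover have "(693 / 1000 * t)\<^sup>2 = 480249 / 1000000 * t\<^sup>2" by (simp add: power2_eq_square)
  moreover have "0 \<le> t\<^sup>2" by simp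
  ultimately have "1 + 693 / 1000 * t + 24 / 100 * t\<^sup>2 \<le> 1 + t * ln 2 + (t * ln 2)\<^sup>2 / 2" by linarith
  also have "\<dots> \<le> exp (t * ln 2)" using assms by (intro exp_lower_Taylor_quadratic) simp
  finally show ?thesis by (simp add: powr_def)
qed

text \<open>The construction of \<open>corr_gauss\<close> treats its coordinates differently. The
  symmetry shows once both orders are realized as linear forms of the same Gaussian vector, with
  \<open>u\<close> and \<open>v\<close> exchanged.\<close>

lemma corr_gauss_swap:
  assumes s: "\<bar>s\<bar> \<le> 1"
  shows "distr (corr_gauss s) (borel \<Otimes>\<^sub>M borel) (\<lambda>z. (snd z, fst z)) = corr_gauss s"
proof -
  define r where "r = sqrt (1 - s\<^sup>2)"
  have r: "r\<^sup>2 = 1 - s\<^sup>2" using s by (simp add: r_def abs_square_le_1)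
  define u where "u i = (if i = 0 then 1 else 0 :: real)" for i :: nat
  define v where "v i = (if i = 0 then s else r)" for i :: nat
  let ?J = "{0,1::nat}"
  have uu: "(\<Sum>j\<in>?J. (u j)\<^sup>2) = 1" "(\<Sum>j\<in>?J. (v j)\<^sup>2) = 1" "(\<Sum>j\<in>?J. u j * v j) = s" "(\<Sum>j\<in>?J. v j * u j) = s"
    by (auto simp: u_def v_def r)
  have "distr (corr_gauss s) (borel \<Otimes>\<^sub>M borel) (\<lambda>z. (snd z, fst z))
    = distr (distr (gauss_vec ?J) (borel \<Otimes>\<^sub>M borel) (\<lambda>x. (\<Sum>j\<in>?J. x j * u j, \<Sum>j\<in>?J. x j * v j))) (borel \<Otimes>\<^sub>M borel) (\<lambda>z. (snd z, fst z))"
    by (subst distr_gauss_vec) (use uu in auto)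
  also have "\<dots> = distr (gauss_vec ?J) (borel \<Otimes>\<^sub>M borel) ((\<lambda>z. (snd z, fst z)) \<circ> (\<lambda>x. (\<Sum>j\<in>?J. x j * u j, \<Sum>j\<in>?J. x j * v j)))"
    by (rule distr_distr) (auto intro!: measurable_Pair)
  also have "(\<lambda>z. (snd z, fst z)) \<circ> (\<lambda>x. (\<Sum>j\<in>?J. x j * u j, \<Sum>j\<in>?J. x j * v j)) = (\<lambda>x. (\<Sum>j\<in>?J. x j * v j, \<Sum>j\<in>?J. x j * u j))"
    by (auto simp: fun_eq_iff)
  also have "distr (gauss_vec ?J) (borel \<Otimes>\<^sub>M borel) (\<lambda>x. (\<Sum>j\<in>?J. x j * v j, \<Sum>j\<in>?J. x j * u j)) = corr_gauss s"
    by (subst distr_gauss_vec) (use uu in auto)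
  finally show ?thesis .
qed

context balanced_sign
begin

text \<open>The bound is tight at both ends. Near 0 it holds because the slope of \<open>stab\<close> is at most
  \<open>2 / pi < ln 2\<close>; elsewhere because \<open>stab\<close> is convex with values \<open>0\<close>, at most \<open>1 / 2\<close>, and \<open>1\<close>
  at \<open>0\<close>, \<open>sqrt (1 / 2)\<close>, and \<open>1\<close>.\<close>

lemma stab_le_two_powr:
  assumes t: "0 \<le> t" "t \<le> 1"
  shows "1 + stab t \<le> 2 powr t"
proof -
  define q where "q = sqrt (1 / 2 :: real)"
  have q: "0.7071 < q" "q < 0.70711"
    unfolding q_def by (rule real_less_rsqrt, simp add: power2_eq_square, rule real_less_lsqrt, simp_all add: power2_eq_square)
  have sq: "stab q \<le> 1 / 2" unfolding q_def by (rule stab_sqrt_half)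
  \<comment> \<open>The cut \<open>0.07\<close> lies in the narrow window where both neighbouring
    estimates work: the small-correlation bound stays below \<open>0.693 * t + 0.24 * t^2\<close> up
    to about \<open>0.073\<close>, and the chord \<open>q * t\<close> does so from about
    \<open>0.059\<close> on.\<close>
  consider "t = 0" | "0 < t" "t \<le> 0.07" | "0.07 \<le> t" "t \<le> q" | "q \<le> t" using t by linarith
  then show ?thesis
  proof cases
    case 1
    then show ?thesis by simp
  next
    case 2
    have "0.07 * 0.07 \<ge> t * t" using 2 by (intro mult_mono) auto
    then have "0.99 \<le> sqrt (1 - t\<^sup>2)"
      by (intro real_le_rsqrt) (simp add: power2_eq_square)
    then have "t\<^sup>2 / sqrt (1 - t\<^sup>2) \<le> t\<^sup>2 / 0.99"
      by (intro divide_left_mono mult_pos_pos) (auto dest: less_le_trans[of 0 "0.99"] simp del: real_sqrt_gt_0_iff)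
    moreover have "2 / pi \<le> 0.6367"
      using pi_approx by (simp add: field_simps)
    then have "2 / pi * t \<le> 0.6367 * t" using 2 by (intro mult_right_mono) auto
    moreover have "t\<^sup>2 \<le> 0.07 * t" using 2 by (simp add: power2_eq_square mult_right_mono)
    ultimately have "stab t \<le> 0.693 * t + 0.24 * t\<^sup>2"
      using stab_le_small[of t] 2 by simp
    then show ?thesis using two_powr_lower[of t] 2 by simp
  next
    case 3
    have "stab t \<le> stab 0 + (t - 0) / (q - 0) * (stab q - stab 0)"
      by (rule stab_le_chord) (use 3 q in auto)
    also have "\<dots> \<le> t / q * (1 / 2)"
      using mult_left_mono[OF sq, of "t / q"] 3 q by simp
    also have "\<dots> = t * q"
    proof -
      have "q * q = 1 / 2" by (simp add: q_def)
      then show ?thesis using q by (simp add: field_simps)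
    qed
    also have "\<dots> \<le> t * (0.693 + 0.24 * t)" using 3 q by (intro mult_left_mono) auto
    finally show ?thesis using two_powr_lower[of t] 3 by (simp add: power2_eq_square algebra_simps)
  next
    case 4
    have "stab t \<le> stab q + (t - q) / (1 - q) * (stab 1 - stab q)"
      by (rule stab_le_chord) (use 4 q t in auto)
    also have "\<dots> = stab q * (1 - (t - q) / (1 - q)) + (t - q) / (1 - q)"
    proof -
      have "stab q + e * (1 - stab q) = stab q * (1 - e) + e" for e by (simp add: algebra_simps)
      then show ?thesis by (simp only: stab_1)
    qed
    also have "1 - (t - q) / (1 - q) = (1 - t) / (1 - q)"
      using q by (simp add: field_simps)
    also have "stab q * ((1 - t) / (1 - q)) + (t - q) / (1 - q) \<le> 1 / 2 * ((1 - t) / (1 - q)) + (t - q) / (1 - q)"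
      using sq t q by (intro add_right_mono mult_right_mono) auto
    also have "\<dots> = 1 - (1 - t) * (1 / (2 * (1 - q)))"
    proof -
      have "(t - q) / (1 - q) = 1 - (1 - t) / (1 - q)" using q by (simp add: field_simps)
      moreover have "(1 - t) * (1 / (2 * (1 - q))) = 1 / 2 * ((1 - t) / (1 - q))" by simp
      ultimately show ?thesis by linarith
    qed
    \<comment> \<open>The chord from \<open>(q, 1/2)\<close> to \<open>(1, 1)\<close> has slope
      about \<open>1.7\<close>, steeper than the slope \<open>2 * ln 2\<close> of
      \<open>2 powr t\<close> at 1. So to the left of 1 it runs below the tangent, which in turn is
      below the convex function.\<close>
    also have "\<dots> \<le> 1 - (1 - t) * (2 * ln 2)"
    proof -
      have "2 * ln 2 \<le> (1.5 :: real)" using ln2_le_25_over_36 by simp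
      also have "\<dots> \<le> 1 / (2 * (1 - q))" using q by (simp add: field_simps)
      finally show ?thesis using t by (intro diff_left_mono mult_left_mono) auto
    qed
    finally have "1 + stab t \<le> 2 * (1 + (t - 1) * ln 2)" by (simp add: algebra_simps)
    also have "\<dots> \<le> 2 * exp ((t - 1) * ln 2)" by (intro mult_left_mono exp_ge_add_one_self) auto
    also have "\<dots> = 2 powr t" by (simp add: powr_def left_diff_distrib exp_diff)
    finally show ?thesis .
  qed
qed

text \<open>If \<open>stab t = 0\<close>, averaging \<open>f\<close> over \<open>M\<close> Gaussians that share a component with correlation \<open>sqrt t\<close>
  leaves a variance \<open>1 / M\<close>; so that component is uncorrelated with \<open>f\<close> through every bounded test function.\<close>

lemma stab_eq_0_imp_uncorrelated:
  assumes t: "0 \<le> t" "t \<le> 1" and z: "stab t = 0"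
    and [measurable]: "g \<in> borel_measurable borel" and g: "\<And>x. \<bar>g x\<bar> \<le> 1"
  shows "(\<integral>z. g (fst z) * f (snd z) \<partial>corr_gauss (sqrt t)) = 0"
proof -
  define \<kappa> where "\<kappa> = (\<integral>z. g (fst z) * f (snd z) \<partial>corr_gauss (sqrt t))"
  have "real (Suc n) * \<kappa>\<^sup>2 \<le> 1" for n
  proof -
    define M where "M = Suc n"
    define u where "u j = (if j = 0 then 1 else 0 :: real)" for j :: nat
    define v where "v m j = (if j = 0 then sqrt t else if j = Suc m then sqrt (1 - t) else 0)" for m j :: nat
    let ?J = "{..M}"
    interpret prob_space "gauss_vec ?J" by (rule prob_space_gauss_vec)
    have vv: "(\<Sum>j\<in>?J. v m j * v m' j) = (if m = m' then 1 else t)" if "m < M" for m m'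
    proof -
      have "(\<Sum>j\<in>?J. v m j * v m' j) = t + (\<Sum>j<M. v m (Suc j) * v m' (Suc j))"
        using t by (subst sum.atMost_shift) (simp add: v_def)
      also have "(\<Sum>j<M. v m (Suc j) * v m' (Suc j)) = (\<Sum>j<M. if j = m then (if m = m' then 1 - t else 0) else 0)"
        using t by (intro sum.cong) (auto simp: v_def)
      finally show ?thesis using that by simp
    qed
    have uv: "(\<Sum>j\<in>?J. u j * v m j) = sqrt t" and uu: "(\<Sum>j\<in>?J. (u j)\<^sup>2) = 1" for m
      by (subst sum.atMost_shift, simp add: u_def v_def)+
    let ?G = "\<lambda>x. g (\<Sum>j\<in>?J. x j * u j)" and ?F = "\<lambda>m x. f (\<Sum>j\<in>?J. x j * v m j)"
    have v1: "(\<Sum>j\<in>?J. (v m j)\<^sup>2) = 1" if "m < M" for m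
      using vv[OF that, of m] by (simp add: power2_eq_square)
    have GF: "(\<integral>x. ?G x * ?F m x \<partial>gauss_vec ?J) = \<kappa>" if "m < M" for m
      unfolding \<kappa>_def uv[of m, symmetric] using v1[OF that] uu
      by (subst distr_gauss_vec[symmetric]) (simp_all add: integral_distr)
    have FF: "(\<integral>x. ?F m x * ?F m' x \<partial>gauss_vec ?J) = (if m = m' then 1 else 0)" if "m < M" "m' < M" for m m'
      using stab_gauss_vec[of ?J "v m" "v m'"] v1 vv that z by simp
    \<comment> \<open>The minimizer of \<open>M - 2 * L * M * \<kappa> + L^2\<close>, which bounds
      the mean square of the sum of the \<open>M\<close> signs minus \<open>L\<close> times
      \<open>g\<close>. The minimum \<open>M - (M * \<kappa>)^2\<close> must be nonnegative.\<close>
    define L where "L = real M * \<kappa>"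
    have iFF: "integrable (gauss_vec ?J) (\<lambda>x. ?F m x * ?F m' x)" for m m'
      by (intro integrable_sign_prod finite_measure_axioms) measurable
    have iGF: "integrable (gauss_vec ?J) (\<lambda>x. ?G x * ?F m x)" for m
      by (rule integrable_const_bound[of _ 1]) (auto simp: abs_mult g)
    have "0 \<le> (\<integral>x. ((\<Sum>m<M. ?F m x) - L * ?G x)\<^sup>2 \<partial>gauss_vec ?J)" by simp
    also have "\<dots> \<le> (\<integral>x. (\<Sum>m<M. \<Sum>m'<M. ?F m x * ?F m' x) - 2 * L * (\<Sum>m<M. ?G x * ?F m x) + L\<^sup>2 \<partial>gauss_vec ?J)"
    proof (rule integral_mono')
      show "integrable (gauss_vec ?J) (\<lambda>x. (\<Sum>m<M. \<Sum>m'<M. ?F m x * ?F m' x) - 2 * L * (\<Sum>m<M. ?G x * ?F m x) + L\<^sup>2)"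
        using iFF iGF by auto
      fix x
      have "(?G x)\<^sup>2 \<le> 1" using g by (simp add: abs_square_le_1)
      then have "L\<^sup>2 * (?G x)\<^sup>2 \<le> L\<^sup>2" by (simp add: mult_left_le)
      moreover have "((\<Sum>m<M. ?F m x) - L * ?G x)\<^sup>2 = (\<Sum>m<M. \<Sum>m'<M. ?F m x * ?F m' x) - 2 * L * (\<Sum>m<M. ?G x * ?F m x) + L\<^sup>2 * (?G x)\<^sup>2"
        unfolding power2_diff power_mult_distrib sum_product[symmetric] sum_distrib_left[symmetric]
        unfolding power2_eq_square sum_product by (simp add: sum_distrib_left algebra_simps)
      ultimately show "((\<Sum>m<M. ?F m x) - L * ?G x)\<^sup>2 \<le> (\<Sum>m<M. \<Sum>m'<M. ?F m x * ?F m' x) - 2 * L * (\<Sum>m<M. ?G x * ?F m x) + L\<^sup>2"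
        by simp
      then show "0 \<le> (\<Sum>m<M. \<Sum>m'<M. ?F m x * ?F m' x) - 2 * L * (\<Sum>m<M. ?G x * ?F m x) + L\<^sup>2"
        using zero_le_power2 order_trans by blast
    qed
    also have "\<dots> = (\<Sum>m<M. \<Sum>m'<M. if m = m' then 1 else 0) - 2 * L * (\<Sum>m<M. \<kappa>) + L\<^sup>2"
      using iFF iGF prob_space by (simp add: FF GF)
    also have "\<dots> = real M - real M * (real M * \<kappa>\<^sup>2)"
      by (simp add: L_def power2_eq_square)
    finally have "0 \<le> real M * (1 - real M * \<kappa>\<^sup>2)" by (simp add: algebra_simps)
    then show ?thesis by (simp add: zero_le_mult_iff M_def)
  qed
  then have "\<kappa>\<^sup>2 \<le> 1 / real (Suc n)" for n
    by (simp add: field_simps)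
  moreover have "(\<lambda>n. 1 / real (Suc n)) \<longlonglongrightarrow> 0"
    by (intro LIMSEQ_Suc lim_1_over_n)
  ultimately have "\<kappa>\<^sup>2 \<le> 0"
    by (intro LIMSEQ_le_const) auto
  then show ?thesis by (simp add: \<kappa>_def)
qed

text \<open>If \<open>stab t = 0\<close>, then \<open>f\<close> of one Gaussian is uncorrelated with
  every wave in a second Gaussian of correlation \<open>s = sqrt t\<close>. The independent part of
  the second Gaussian factors out as a value of the Gaussian characteristic function, which never
  vanishes. Hence the Fourier transform of \<open>f\<close> with Gaussian weight is zero.\<close>

lemma stab_pos:
  assumes t: "0 < t" "t \<le> 1"
  shows "0 < stab t"
proof (rule ccontr)
  assume "\<not> 0 < stab t"
  then have z: "stab t = 0" using stab_nonneg[of t] t by simp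
  define s where "s = sqrt t"
  have s: "0 < s" "s \<le> 1" "\<bar>s\<bar> \<le> 1" using t by (auto simp: s_def)
  define r where "r = sqrt (1 - s\<^sup>2)"
  have unc: "(\<integral>z. f (fst z) * g (s * fst z + r * snd z) \<partial>(std_gauss \<Otimes>\<^sub>M std_gauss)) = 0"
    if [measurable]: "g \<in> borel_measurable borel" and g: "\<And>x. \<bar>g x\<bar> \<le> 1" for g
  proof -
    have "0 = (\<integral>z. g (fst z) * f (snd z) \<partial>corr_gauss s)"
      using stab_eq_0_imp_uncorrelated[of t g] t z g by (simp add: s_def)
    also have "\<dots> = (\<integral>z. g (snd z) * f (fst z) \<partial>corr_gauss s)"
      by (subst corr_gauss_swap[OF s(3), symmetric], subst integral_distr) auto
    also have "\<dots> = (\<integral>z. f (fst z) * g (s * fst z + r * snd z) \<partial>(std_gauss \<Otimes>\<^sub>M std_gauss))"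
      unfolding corr_gauss_def by (subst integral_distr) (auto simp: case_prod_unfold r_def mult.commute)
    finally show ?thesis by simp
  qed
  define \<Phi> where "\<Phi> \<xi> = (\<integral>x. complex_of_real (f x) * iexp (\<xi> * x) \<partial>std_gauss)" for \<xi>
  have int: "integrable M (\<lambda>x. complex_of_real (f (p x)) * iexp (h x))"
    if "finite_measure M" and [measurable]: "p \<in> borel_measurable M" "h \<in> borel_measurable M" for M :: "'z measure" and p h
    by (rule finite_measure.integrable_const_bound[OF that(1), of _ 1]) (auto simp: norm_mult)
  have "\<Phi> \<xi> = 0" for \<xi>
  proof -
    define \<eta> where "\<eta> = \<xi> / s"
    let ?h = "\<lambda>z :: real \<times> real. complex_of_real (f (fst z)) * iexp (\<eta> * (s * fst z + r * snd z))"
    have inth: "integrable (std_gauss \<Otimes>\<^sub>M std_gauss) ?h"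
      by (rule int[OF std_gauss_pair.finite_measure_axioms]) measurable
    have "(\<integral>z. ?h z \<partial>(std_gauss \<Otimes>\<^sub>M std_gauss)) = 0"
    proof (rule complex_eqI)
      have "Re (\<integral>z. ?h z \<partial>(std_gauss \<Otimes>\<^sub>M std_gauss)) = (\<integral>z. f (fst z) * cos (\<eta> * (s * fst z + r * snd z)) \<partial>(std_gauss \<Otimes>\<^sub>M std_gauss))"
        by (subst integral_Re[OF inth, symmetric]) (simp add: Re_exp)
      then show "Re (\<integral>z. ?h z \<partial>(std_gauss \<Otimes>\<^sub>M std_gauss)) = Re 0"
        using unc[of "\<lambda>x. cos (\<eta> * x)"] by simp
      have "Im (\<integral>z. ?h z \<partial>(std_gauss \<Otimes>\<^sub>M std_gauss)) = (\<integral>z. f (fst z) * sin (\<eta> * (s * fst z + r * snd z)) \<partial>(std_gauss \<Otimes>\<^sub>M std_gauss))"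
        by (subst integral_Im[OF inth, symmetric]) (simp add: Im_exp)
      then show "Im (\<integral>z. ?h z \<partial>(std_gauss \<Otimes>\<^sub>M std_gauss)) = Im 0"
        using unc[of "\<lambda>x. sin (\<eta> * x)"] by simp
    qed
    also have "(\<integral>z. ?h z \<partial>(std_gauss \<Otimes>\<^sub>M std_gauss)) = (\<integral>x. \<integral>y. ?h (x, y) \<partial>std_gauss \<partial>std_gauss)"
      by (rule std_gauss_pair.integral_fst'[symmetric, OF inth])
    also have "\<dots> = (\<integral>x. \<integral>y. (complex_of_real (f x) * iexp (\<xi> * x)) * iexp (\<eta> * r * y) \<partial>std_gauss \<partial>std_gauss)"
      using s by (intro Bochner_Integration.integral_cong refl) (simp add: \<eta>_def exp_add[symmetric] algebra_simps)
    also have "\<dots> = \<Phi> \<xi> * char std_gauss (\<eta> * r)"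
      by (simp add: \<Phi>_def char_def)
    finally show ?thesis
      by (simp add: std_gauss_def char_std_normal_distribution)
  qed
  note \<Phi>0 = this
  \<comment> \<open>Adding 1 turns the signed density \<open>f\<close> into a probability density,
    to which uniqueness of characteristic functions applies. The resulting
    \<open>M = std_gauss\<close> is absurd: the mean of \<open>f\<close> under \<open>M\<close> is
    the mean of \<open>f + f^2\<close>, which is 1.\<close>
  define M where "M = density std_gauss (\<lambda>x. ennreal (1 + f x))"
  have nn: "0 \<le> 1 + f x" for x using f_sign[of x] by auto
  have fi: "integrable std_gauss f" using integrable_sign[OF std_gauss.finite_measure_axioms, of "\<lambda>x. x"] by simp
  have rd: "real_distribution M"
  proof -
    have "emeasure M (space M) = (\<integral>\<^sup>+x. ennreal (1 + f x) \<partial>std_gauss)"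
      by (simp add: M_def emeasure_density)
    also have "\<dots> = ennreal (\<integral>x. 1 + f x \<partial>std_gauss)"
      using fi nn by (intro nn_integral_eq_integral) auto
    also have "(\<integral>x. 1 + f x \<partial>std_gauss) = 1"
      using fi f_balanced std_gauss.prob_space by simp
    finally have "prob_space M" by (intro prob_spaceI) simp
    then show ?thesis by (intro real_distribution.intro) (auto simp: real_distribution_axioms_def M_def)
  qed
  have "char M = char std_gauss"
  proof
    fix \<xi>
    have i1: "integrable std_gauss (\<lambda>x. iexp (\<xi> * x))"
      by (rule std_gauss.integrable_const_bound[of _ 1]) auto
    have i2: "integrable std_gauss (\<lambda>x. complex_of_real (f x) * iexp (\<xi> * x))"
      by (rule int[OF std_gauss.finite_measure_axioms]) measurable
    have "char M \<xi> = (\<integral>x. iexp (\<xi> * x) + complex_of_real (f x) * iexp (\<xi> * x) \<partial>std_gauss)"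
      unfolding char_def M_def using nn
      by (subst integral_density) (auto simp: scaleR_conv_of_real algebra_simps)
    also have "\<dots> = char std_gauss \<xi> + \<Phi> \<xi>"
      using i1 i2 by (simp add: char_def \<Phi>_def)
    finally show "char M \<xi> = char std_gauss \<xi>" by (simp add: \<Phi>0)
  qed
  moreover have "real_distribution std_gauss"
    unfolding std_gauss_def by (rule real_dist_normal_dist)
  ultimately have "M = std_gauss" using rd by (intro Levy_uniqueness)
  then have "(\<integral>x. f x \<partial>M) = 0" using f_balanced by simp
  moreover have "(\<integral>x. f x \<partial>M) = (\<integral>x. f x + 1 \<partial>std_gauss)"
    unfolding M_def using nn by (subst integral_density) (auto simp: algebra_simps)
  ultimately show False
    using fi f_balanced std_gauss.prob_space by simp
qed

end

section \<open>Entropy of noiseless sign observations\<close>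

text \<open>The right side is \<open>ln 2\<close> minus the entropy of a sign with mean
  \<open>m\<close>. Any positive constant in place of \<open>1 / 6\<close> would serve later; this
  one comes from a bound of \<open>x * ln x\<close> on \<open>[0, 2]\<close>, averaged over
  \<open>x = 1 + m\<close> and \<open>x = 1 - m\<close>.\<close>

lemma binary_entropy_gap:
  fixes m :: real
  assumes m: "\<bar>m\<bar> \<le> 1"
  shows "m\<^sup>2 / 6 \<le> (1 + m) / 2 * ln (1 + m) + (1 - m) / 2 * ln (1 - m)"
proof -
  have *: "(x - 1) + (x - 1)\<^sup>2 / 6 \<le> x * ln x" if x: "0 \<le> x" "x \<le> 2" for x :: real
  proof (cases "x = 0")
    case False
    \<comment> \<open>In terms of the root, \<open>ln y \<ge> 1 - 1 / y\<close> gives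
      \<open>x * ln x \<ge> 2 * y^2 - 2 * y\<close>, which exceeds \<open>x - 1\<close> by exactly
      \<open>(y - 1)^2\<close>. The 6 bounds \<open>(y + 1)^2\<close> for
      \<open>y \<le> sqrt 2\<close>.\<close>
    define y where "y = sqrt x"
    have y: "0 < y" "x = y\<^sup>2" using False x by (auto simp: y_def)
    have "y \<le> sqrt 2" unfolding y_def using x by simp
    also have "\<dots> \<le> 1.42" by (rule real_le_lsqrt) (simp_all add: power2_eq_square)
    finally have "(y + 1)\<^sup>2 \<le> 2.42\<^sup>2" using y by (intro power_mono) auto
    then have y6: "(y + 1)\<^sup>2 \<le> 6" by (simp add: power2_eq_square)
    have "ln (1 / y) \<le> 1 / y - 1" using y by (intro ln_le_minus_one) simp
    then have "1 - 1 / y \<le> ln y" using y by (simp add: ln_div)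
    then have "2 * y\<^sup>2 * (1 - 1 / y) \<le> 2 * y\<^sup>2 * ln y" using y by (intro mult_left_mono) auto
    also have "\<dots> = x * ln x" using y by (simp add: ln_realpow)
    finally have "2 * y\<^sup>2 - 2 * y \<le> x * ln x"
      using y by (simp add: algebra_simps power2_eq_square)
    moreover have "(x - 1)\<^sup>2 / 6 \<le> (y - 1)\<^sup>2"
    proof -
      have "(x - 1)\<^sup>2 = (y - 1)\<^sup>2 * (y + 1)\<^sup>2" by (simp add: y power2_eq_square algebra_simps)
      also have "\<dots> \<le> (y - 1)\<^sup>2 * 6" using y6 by (intro mult_left_mono) auto
      finally show ?thesis by simp
    qed
    ultimately show ?thesis by (simp add: y power2_eq_square algebra_simps)
  qed simp
  have "(1 + m) * ln (1 + m) \<ge> m + m\<^sup>2 / 6" "(1 - m) * ln (1 - m) \<ge> - m + m\<^sup>2 / 6"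
    using *[of "1 + m"] *[of "1 - m"] m by auto
  then show ?thesis by simp
qed

text \<open>The entropy argument uses neither Gaussian designs nor sparsity, only a finite parameter
  set with uniform prior, i.i.d. inputs and sign-valued labels.\<close>

locale sign_channel = prob_space \<mu> for \<mu> :: "'x measure" +
  fixes T :: "'a set" and F :: "'a \<Rightarrow> 'x \<Rightarrow> real"
  assumes finite_T[simp]: "finite T" and T_nonempty[simp]: "T \<noteq> {}"
    and F_measurable[measurable]: "a \<in> T \<Longrightarrow> F a \<in> borel_measurable \<mu>"
    and F_sign: "F a x = 1 \<or> F a x = -1"
begin

definition samples :: "nat \<Rightarrow> (nat \<Rightarrow> 'x) measure" where
  "samples n = PiM {..<n} (\<lambda>_. \<mu>)"

text \<open>\<open>match n X a b\<close> is the 0-1 indicator that \<open>a\<close> and \<open>b\<close> produce the same \<open>n\<close> observations.\<close>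

definition match :: "nat \<Rightarrow> (nat \<Rightarrow> 'x) \<Rightarrow> 'a \<Rightarrow> 'a \<Rightarrow> real" where
  "match n X a b = (\<Prod>i<n. (1 + F a (X i) * F b (X i)) / 2)"

definition class_size :: "nat \<Rightarrow> (nat \<Rightarrow> 'x) \<Rightarrow> 'a \<Rightarrow> real" where
  "class_size n X a = (\<Sum>b\<in>T. match n X a b)"

text \<open>Without noise and with a uniform prior, the posterior is uniform on the class of
  parameters that reproduce the labels of the truth \<open>a\<close>; this is the posterior mean of
  \<open>\<phi>\<close>.\<close>

definition post :: "nat \<Rightarrow> (nat \<Rightarrow> 'x) \<Rightarrow> ('a \<Rightarrow> real) \<Rightarrow> 'a \<Rightarrow> real" where
  "post n X \<phi> a = (\<Sum>b\<in>T. match n X a b * \<phi> b) / class_size n X a"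

definition corr :: "'a \<Rightarrow> 'a \<Rightarrow> real" where
  "corr a b = (\<integral>x. F a x * F b x \<partial>\<mu>)"

lemma prob_space_samples: "prob_space (samples n)"
  unfolding samples_def by (intro prob_space_PiM prob_space_axioms)

lemma match_eq: "match n X a b = (if \<forall>i<n. F a (X i) = F b (X i) then 1 else 0)"
proof -
  have s: "(1 + F a x * F b x) / 2 = (if F a x = F b x then 1 else 0)" for x
    using F_sign[of a x] F_sign[of b x] by auto
  show ?thesis unfolding match_def s by (auto simp: prod_eq_1_iff prod_zero_iff)
qed

lemma match_refl[simp]: "match n X a a = 1"
  by (simp add: match_eq)

lemma match_nonneg[simp]: "0 \<le> match n X a b" and match_le_1: "match n X a b \<le> 1"
  by (auto simp: match_eq)

lemma match_sym: "match n X a b = match n X b a"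
  by (auto simp: match_eq)

lemma match_trans: "match n X a b \<noteq> 0 \<Longrightarrow> match n X a = match n X b"
  by (auto simp: match_eq fun_eq_iff split: if_splits)

lemma match_Suc_imp: "match (Suc n) X a b \<noteq> 0 \<Longrightarrow> match n X a b \<noteq> 0"
  by (auto simp: match_eq split: if_splits)

lemma match_cong: "(\<And>i. i < n \<Longrightarrow> X i = Y i) \<Longrightarrow> match n X = match n Y"
  by (auto simp: match_def fun_eq_iff)

lemma class_size_ge_1: "a \<in> T \<Longrightarrow> 1 \<le> class_size n X a"
  unfolding class_size_def using member_le_sum[of a T "match n X a"] by simp

lemma class_size_le: "class_size n X a \<le> real (card T)"
  unfolding class_size_def using sum_bounded_above[of T "match n X a" 1] match_le_1 by simp

lemma class_size_cong: "match n X a b \<noteq> 0 \<Longrightarrow> class_size n X a = class_size n X b"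
  using match_trans[of n X a b] by (simp add: class_size_def)

lemma post_cong: "match n X a b \<noteq> 0 \<Longrightarrow> post n X \<phi> a = post n X \<phi> b"
  using match_trans[of n X a b] by (simp add: post_def class_size_def)

lemma post_const: "a \<in> T \<Longrightarrow> post n X (\<lambda>_. c) a = c"
  using class_size_ge_1[of a n X] by (simp add: post_def class_size_def sum_distrib_right[symmetric])

lemma post_mono: "(\<And>b. b \<in> T \<Longrightarrow> \<phi> b \<le> \<psi> b) \<Longrightarrow> a \<in> T \<Longrightarrow> post n X \<phi> a \<le> post n X \<psi> a"
  using class_size_ge_1[of a n X] unfolding post_def by (intro divide_right_mono sum_mono mult_left_mono) auto

lemma abs_post_le:
  assumes "\<And>b. b \<in> T \<Longrightarrow> \<bar>\<phi> b\<bar> \<le> c" "a \<in> T"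
  shows "\<bar>post n X \<phi> a\<bar> \<le> c"
proof -
  have "post n X \<phi> a \<le> post n X (\<lambda>_. c) a" "post n X (\<lambda>_. - c) a \<le> post n X \<phi> a"
    by (intro post_mono; use assms in \<open>force simp: abs_le_iff\<close>)+
  then show ?thesis using post_const[OF assms(2), of n X] by (simp add: abs_le_iff)
qed

text \<open>\<open>post\<close> averages over classes, so it is the orthogonal projection onto
  class-constant functions for the counting measure on \<open>T\<close>; pairing with such a
  \<open>g\<close> does not see it. This is the tower property in finite form.\<close>

lemma sum_post_mult:
  assumes g: "\<And>a b. a \<in> T \<Longrightarrow> b \<in> T \<Longrightarrow> match n X a b \<noteq> 0 \<Longrightarrow> g a = g b"
  shows "(\<Sum>a\<in>T. post n X \<phi> a * g a) = (\<Sum>a\<in>T. \<phi> a * g a)"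
proof -
  have "(\<Sum>a\<in>T. post n X \<phi> a * g a) = (\<Sum>a\<in>T. \<Sum>b\<in>T. match n X a b * \<phi> b / class_size n X a * g a)"
    by (simp add: post_def sum_divide_distrib sum_distrib_right)
  also have "\<dots> = (\<Sum>a\<in>T. \<Sum>b\<in>T. match n X b a * \<phi> b / class_size n X b * g b)"
    by (intro sum.cong refl) (metis g match_sym mult_eq_0_iff class_size_cong div_0)
  also have "\<dots> = (\<Sum>b\<in>T. \<Sum>a\<in>T. match n X b a * \<phi> b / class_size n X b * g b)"
    by (rule sum.swap)
  also have "\<dots> = (\<Sum>b\<in>T. class_size n X b * (\<phi> b / class_size n X b * g b))"
  proof (intro sum.cong refl)
    fix b
    have "class_size n X b * (\<phi> b / S * g b) = (\<Sum>a\<in>T. match n X b a * \<phi> b / S * g b)" for S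
      unfolding class_size_def sum_distrib_right by (simp add: mult_ac)
    then show "(\<Sum>a\<in>T. match n X b a * \<phi> b / class_size n X b * g b) = class_size n X b * (\<phi> b / class_size n X b * g b)"
      by simp
  qed
  also have "\<dots> = (\<Sum>b\<in>T. \<phi> b * g b)"
    using class_size_ge_1 by (intro sum.cong refl) (auto, metis not_one_le_zero)
  finally show ?thesis .
qed

lemma sum_post_square: "(\<Sum>a\<in>T. (post n X \<phi> a)\<^sup>2) = (\<Sum>a\<in>T. \<phi> a * post n X \<phi> a)"
  unfolding power2_eq_square by (rule sum_post_mult) (rule post_cong)

text \<open>Classes at time \<open>Suc n\<close> refine those at time \<open>n\<close>, so the
  projections are nested. Their difference is orthogonal to the coarser one, and its squared norm is
  the increase.\<close>

lemma sum_post_square_mono: "(\<Sum>a\<in>T. (post n X \<phi> a)\<^sup>2) \<le> (\<Sum>a\<in>T. (post (Suc n) X \<phi> a)\<^sup>2)"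
proof -
  let ?p = "post n X \<phi>" and ?q = "post (Suc n) X \<phi>"
  have "(\<Sum>a\<in>T. ?q a * ?p a) = (\<Sum>a\<in>T. \<phi> a * ?p a)"
    by (rule sum_post_mult, rule post_cong, rule match_Suc_imp)
  then have "(\<Sum>a\<in>T. ?q a * ?p a) = (\<Sum>a\<in>T. (?p a)\<^sup>2)" by (simp add: sum_post_square)
  then have "(\<Sum>a\<in>T. (?q a - ?p a)\<^sup>2) = (\<Sum>a\<in>T. (?q a)\<^sup>2) - (\<Sum>a\<in>T. (?p a)\<^sup>2)"
    by (simp add: power2_diff sum.distrib sum_subtractf sum_distrib_left[symmetric] mult.assoc)
  moreover have "0 \<le> (\<Sum>a\<in>T. (?q a - ?p a)\<^sup>2)" by (intro sum_nonneg) simp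
  ultimately show ?thesis by simp
qed

lemma measurable_match[measurable]:
  assumes "n \<le> m" "a \<in> T" "b \<in> T"
  shows "(\<lambda>X. match n X a b) \<in> borel_measurable (samples m)"
proof -
  have [measurable]: "(\<lambda>X. F c (X i)) \<in> borel_measurable (samples m)" if "i < n" "c \<in> T" for c i
    unfolding samples_def
    by (rule measurable_compose[OF measurable_component_singleton[of i] F_measurable[of c]]) (use that assms in auto)
  show ?thesis unfolding match_def using assms
    by (intro borel_measurable_prod borel_measurable_divide borel_measurable_add borel_measurable_times) auto
qed

lemma measurable_class_size[measurable]:
  assumes "n \<le> m" "a \<in> T"
  shows "(\<lambda>X. class_size n X a) \<in> borel_measurable (samples m)"
  unfolding class_size_def using assms by (intro borel_measurable_sum measurable_match) auto

lemma measurable_post[measurable]: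
  assumes "n \<le> m" "a \<in> T"
  shows "(\<lambda>X. post n X \<phi> a) \<in> borel_measurable (samples m)"
  unfolding post_def using assms
  by (intro borel_measurable_divide borel_measurable_sum borel_measurable_times measurable_match measurable_class_size) auto

lemma integrable_post:
  assumes "n \<le> m" "a \<in> T"
  shows "integrable (samples m) (\<lambda>X. post n X \<phi> a)"
proof -
  interpret S: prob_space "samples m" by (rule prob_space_samples)
  have "\<bar>post n X \<phi> a\<bar> \<le> (\<Sum>b\<in>T. \<bar>\<phi> b\<bar>)" for X
    by (rule abs_post_le[OF _ assms(2)]) (auto intro: member_le_sum)
  then show ?thesis
    by (intro S.integrable_const_bound[of _ "\<Sum>b\<in>T. \<bar>\<phi> b\<bar>"] measurable_post assms) auto
qed

lemma integrable_ln_class_size: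
  assumes "n \<le> m" "a \<in> T"
  shows "integrable (samples m) (\<lambda>X. ln (class_size n X a))"
proof -
  interpret S: prob_space "samples m" by (rule prob_space_samples)
  have "\<bar>ln (class_size n X a)\<bar> \<le> ln (real (card T))" for X
    using class_size_ge_1[OF assms(2), of n X] class_size_le[of n X a] by simp
  then show ?thesis
    by (intro S.integrable_const_bound[of _ "ln (real (card T))"] borel_measurable_ln measurable_class_size assms) auto
qed

lemma integrable_match:
  assumes "n \<le> m" "a \<in> T" "b \<in> T"
  shows "integrable (samples m) (\<lambda>X. match n X a b)"
proof -
  interpret S: prob_space "samples m" by (rule prob_space_samples)
  show ?thesis
    by (intro S.integrable_const_bound[of _ 1] measurable_match assms) (auto simp: match_le_1)
qed

lemma integrable_F_prod:
  assumes "a \<in> T" "b \<in> T"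
  shows "integrable \<mu> (\<lambda>x. F a x * F b x)"
proof (rule integrable_const_bound[of _ 1])
  show "AE x in \<mu>. norm (F a x * F b x) \<le> 1"
    using F_sign by (intro AE_I2) (metis abs_1 abs_minus_cancel abs_mult mult_1 order_refl real_norm_def)
qed (use assms in measurable)

lemma abs_corr_le: "\<bar>corr a b\<bar> \<le> 1"
proof -
  have "\<bar>F a x * F b x\<bar> = 1" for x using F_sign[of a x] F_sign[of b x] by auto
  then show ?thesis
    using integral_norm_bound[of \<mu> "\<lambda>x. F a x * F b x"] prob_space by (simp add: corr_def)
qed

lemma integral_match:
  assumes "a \<in> T" "b \<in> T"
  shows "(\<integral>X. match n X a b \<partial>samples n) = ((1 + corr a b) / 2) ^ n"
proof -
  interpret P: product_prob_space "\<lambda>_ :: nat. \<mu>" UNIV by standard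
  have "(\<integral>X. match n X a b \<partial>samples n) = (\<Prod>i<n. \<integral>x. (1 + F a x * F b x) / 2 \<partial>\<mu>)"
    unfolding match_def samples_def
    by (rule P.product_integral_prod) (use integrable_F_prod[OF assms] in auto)
  also have "(\<integral>x. (1 + F a x * F b x) / 2 \<partial>\<mu>) = (1 + corr a b) / 2"
    using integrable_F_prod[OF assms] prob_space by (simp add: corr_def)
  finally show ?thesis by simp
qed

lemma integral_samples_Suc:
  fixes h :: "(nat \<Rightarrow> 'x) \<Rightarrow> real"
  assumes "integrable (samples (Suc n)) h"
  shows "(\<integral>X. h X \<partial>samples (Suc n)) = (\<integral>X. \<integral>x. h (X(n := x)) \<partial>\<mu> \<partial>samples n)"
proof -
  interpret P: product_prob_space "\<lambda>_ :: nat. \<mu>" UNIV by standard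
  show ?thesis
    using P.product_integral_insert[of "{..<n}" n h] assms
    by (simp add: samples_def lessThan_Suc)
qed

text \<open>Up to normalization by \<open>card T\<close>, the mean correlation between the labels of
  the truth and those of a posterior sample, for given inputs \<open>X\<close>.\<close>

definition gain :: "nat \<Rightarrow> (nat \<Rightarrow> 'x) \<Rightarrow> real" where
  "gain n X = (\<Sum>a\<in>T. post n X (corr a) a)"

text \<open>By the projection property the squares sum to the products of \<open>F a y\<close> with
  its posterior mean, and integration over a fresh input \<open>y\<close> turns
  \<open>F a y * F b y\<close> into \<open>corr a b\<close>. The representation by squares makes the
  gain nonnegative and monotone, and ties it to how predictable the next label is.\<close>

lemma has_integral_gain:
  "has_bochner_integral \<mu> (\<lambda>y. \<Sum>a\<in>T. (post n X (\<lambda>b. F b y) a)\<^sup>2) (gain n X)"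
proof -
  have "has_bochner_integral \<mu> (\<lambda>y. \<Sum>a\<in>T. \<Sum>b\<in>T. match n X a b / class_size n X a * (F a y * F b y))
    (\<Sum>a\<in>T. \<Sum>b\<in>T. match n X a b / class_size n X a * corr a b)"
    unfolding corr_def
    by (intro has_bochner_integral_sum has_bochner_integral_mult_right has_bochner_integral_integrable integrable_F_prod)
  moreover have "(\<Sum>a\<in>T. (post n X (\<lambda>b. F b y) a)\<^sup>2) = (\<Sum>a\<in>T. \<Sum>b\<in>T. match n X a b / class_size n X a * (F a y * F b y))" for y
    unfolding sum_post_square by (simp add: post_def sum_divide_distrib sum_distrib_left mult_ac)
  ultimately show ?thesis by (simp add: gain_def post_def sum_divide_distrib)
qed

lemma gain_mono: "gain n X \<le> gain (Suc n) X"
proof -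
  have "(\<integral>y. (\<Sum>a\<in>T. (post n X (\<lambda>b. F b y) a)\<^sup>2) \<partial>\<mu>) \<le> (\<integral>y. (\<Sum>a\<in>T. (post (Suc n) X (\<lambda>b. F b y) a)\<^sup>2) \<partial>\<mu>)"
    using has_integral_gain[of n X] has_integral_gain[of "Suc n" X]
    by (intro integral_mono sum_post_square_mono) (simp_all add: has_bochner_integral_iff)
  then show ?thesis
    using has_integral_gain[of n X] has_integral_gain[of "Suc n" X] by (simp add: has_bochner_integral_iff)
qed

lemma gain_nonneg: "0 \<le> gain n X"
proof -
  have "0 \<le> (\<integral>y. (\<Sum>a\<in>T. (post n X (\<lambda>b. F b y) a)\<^sup>2) \<partial>\<mu>)"
    by (intro integral_nonneg_AE AE_I2 sum_nonneg) simp
  then show ?thesis using has_integral_gain[of n X] by (simp add: has_bochner_integral_iff)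
qed

lemma integrable_gain: "n \<le> m \<Longrightarrow> integrable (samples m) (gain n)"
  unfolding gain_def[abs_def] by (intro Bochner_Integration.integrable_sum integrable_post)

definition mean_gain :: "nat \<Rightarrow> real" where
  "mean_gain n = (\<integral>X. gain n X \<partial>samples n) / real (card T)"

lemma integral_gain_Suc: "(\<integral>X. gain n X \<partial>samples (Suc n)) = (\<integral>X. gain n X \<partial>samples n)"
proof -
  have "gain n (X(n := x)) = gain n X" for X x
  proof -
    have "match n (X(n := x)) = match n X" by (rule match_cong) simp
    then show ?thesis unfolding gain_def post_def class_size_def by simp
  qed
  then show ?thesis
    using integral_samples_Suc[OF integrable_gain, of n n] prob_space by simp
qed

lemma mean_gain_mono: "n \<le> m \<Longrightarrow> mean_gain n \<le> mean_gain m"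
proof (induction rule: dec_induct)
  case (step m)
  have "mean_gain m \<le> mean_gain (Suc m)"
    unfolding mean_gain_def integral_gain_Suc[of m, symmetric]
    by (intro divide_right_mono integral_mono integrable_gain gain_mono) auto
  then show ?case using step by simp
qed simp

lemma mean_gain_nonneg: "0 \<le> mean_gain n"
  unfolding mean_gain_def by (intro divide_nonneg_nonneg integral_nonneg_AE) (auto simp: gain_nonneg)

text \<open>The last factor is the posterior probability of the new label that \<open>a\<close>
  produces, hence the fraction of the class that survives.\<close>

lemma class_size_Suc:
  assumes "a \<in> T"
  shows "class_size (Suc n) (X(n := x)) a = class_size n X a * ((1 + F a x * post n X (\<lambda>b. F b x) a) / 2)"
proof -
  have "match n (X(n := x)) = match n X" by (rule match_cong) simp
  then have "match (Suc n) (X(n := x)) a b = match n X a b * ((1 + F a x * F b x) / 2)" for b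
    by (simp add: match_def fun_eq_iff)
  then have "class_size (Suc n) (X(n := x)) a = (class_size n X a + F a x * (\<Sum>b\<in>T. match n X a b * F b x)) / 2"
    by (simp add: class_size_def sum_distrib_left sum.distrib[symmetric] sum_divide_distrib algebra_simps add_divide_distrib)
  moreover have "class_size n X a * (1 + F a x * post n X (\<lambda>b. F b x) a) = class_size n X a + F a x * (\<Sum>b\<in>T. match n X a b * F b x)"
    using class_size_ge_1[OF assms, of n X] by (simp add: post_def distrib_left)
  ultimately show ?thesis by simp
qed

text \<open>One more observation splits each class of indistinguishable parameters in proportion \<open>1 + m : 1 - m\<close>,
  where \<open>m\<close> is the posterior mean of the new sign; the entropy gained is \<open>ln 2\<close> minus the gap.\<close>

lemma sum_ln_class_size_Suc:
  "(\<Sum>a\<in>T. ln (class_size n X a)) - real (card T) * ln 2 + (\<Sum>a\<in>T. (post n X (\<lambda>b. F b x) a)\<^sup>2) / 6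
    \<le> (\<Sum>a\<in>T. ln (class_size (Suc n) (X(n := x)) a))"
proof -
  define m where "m a = post n X (\<lambda>b. F b x) a" for a
  have mcong: "match n X a b \<noteq> 0 \<Longrightarrow> m a = m b" for a b unfolding m_def by (rule post_cong)
  have m1: "\<bar>m a\<bar> \<le> 1" if "a \<in> T" for a
    unfolding m_def by (rule abs_post_le[OF _ that]) (metis F_sign abs_1 abs_minus_cancel order_refl)
  \<comment> \<open>As \<open>F a x\<close> is a sign, \<open>ln (1 + F a x * m a)\<close> is affine
    in it. The slope \<open>q\<close> depends on \<open>m\<close> only, so it is class-constant, and
    \<open>sum_post_mult\<close> may replace the sign by its posterior mean. This produces the
    binary entropy gap.\<close>
  define p where "p a = (ln (1 + m a) + ln (1 - m a)) / 2" for a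
  define q where "q a = (ln (1 + m a) - ln (1 - m a)) / 2" for a
  have split: "ln (1 + F a x * m a) = p a + F a x * q a" for a
    using F_sign[of a x] by (auto simp: p_def q_def add_divide_distrib[symmetric] diff_divide_distrib[symmetric])
  have "(\<Sum>a\<in>T. (m a)\<^sup>2) / 6 \<le> (\<Sum>a\<in>T. (1 + m a) / 2 * ln (1 + m a) + (1 - m a) / 2 * ln (1 - m a))"
    unfolding sum_divide_distrib by (intro sum_mono binary_entropy_gap m1)
  also have "\<dots> = (\<Sum>a\<in>T. p a) + (\<Sum>a\<in>T. m a * q a)"
    unfolding sum.distrib[symmetric] by (intro sum.cong refl) (simp add: p_def q_def field_simps)
  also have "(\<Sum>a\<in>T. m a * q a) = (\<Sum>a\<in>T. F a x * q a)"
    unfolding m_def[of "_ :: 'a", abs_def]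
    by (rule sum_post_mult) (simp add: q_def mcong)
  also have "(\<Sum>a\<in>T. p a) + (\<Sum>a\<in>T. F a x * q a) = (\<Sum>a\<in>T. ln (1 + F a x * m a))"
    by (simp add: split sum.distrib)
  also have "\<dots> = (\<Sum>a\<in>T. ln (class_size (Suc n) (X(n := x)) a) - ln (class_size n X a) + ln 2)"
  proof (intro sum.cong refl)
    fix a assume a: "a \<in> T"
    have s: "0 < class_size n X a" "0 < class_size (Suc n) (X(n := x)) a"
      using class_size_ge_1[OF a, of n X] class_size_ge_1[OF a, of "Suc n" "X(n := x)"] by auto
    then have "1 + F a x * m a = class_size (Suc n) (X(n := x)) a / class_size n X a * 2"
      using class_size_Suc[OF a, of n X x] by (simp add: m_def)
    then show "ln (1 + F a x * m a) = ln (class_size (Suc n) (X(n := x)) a) - ln (class_size n X a) + ln 2"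
      using s by (simp add: ln_mult ln_div)
  qed
  finally show ?thesis by (simp add: m_def sum.distrib sum_subtractf)
qed

text \<open>The conditional entropy of a uniform parameter given the data, because the posterior is
  uniform on a class.\<close>

definition mean_log_size :: "nat \<Rightarrow> real" where
  "mean_log_size n = (\<integral>X. (\<Sum>a\<in>T. ln (class_size n X a)) \<partial>samples n) / real (card T)"

lemma card_T_pos: "0 < real (card T)"
  by (simp add: card_gt_0_iff)

lemma mean_log_size_Suc:
  "mean_log_size n - ln 2 + mean_gain n / 6 \<le> mean_log_size (Suc n)"
proof -
  interpret S: prob_space "samples n" by (rule prob_space_samples)
  let ?L = "\<lambda>n X. \<Sum>a\<in>T. ln (class_size n X a)"
  have intL: "integrable (samples m) (?L m)" for m by (intro Bochner_Integration.integrable_sum integrable_ln_class_size) auto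
  have bnd: "?L n X - real (card T) * ln 2 + gain n X / 6 \<le> (\<integral>x. ?L (Suc n) (X(n := x)) \<partial>\<mu>)" if X: "X \<in> space (samples n)" for X
  proof -
    have "?L n X - real (card T) * ln 2 + gain n X / 6
      = (\<integral>x. ?L n X - real (card T) * ln 2 + (\<Sum>a\<in>T. (post n X (\<lambda>b. F b x) a)\<^sup>2) / 6 \<partial>\<mu>)"
      using has_integral_gain[of n X] prob_space by (simp add: has_bochner_integral_iff)
    also have "\<dots> \<le> (\<integral>x. ?L (Suc n) (X(n := x)) \<partial>\<mu>)"
    proof (rule integral_mono[OF _ _ sum_ln_class_size_Suc])
      show "integrable \<mu> (\<lambda>x. ?L n X - real (card T) * ln 2 + (\<Sum>a\<in>T. (post n X (\<lambda>b. F b x) a)\<^sup>2) / 6)"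
        using has_integral_gain[of n X] by (simp add: has_bochner_integral_iff)
      show "integrable \<mu> (\<lambda>x. ?L (Suc n) (X(n := x)))"
      proof (intro Bochner_Integration.integrable_sum)
        fix a assume a: "a \<in> T"
        have "(\<lambda>x. X(n := x)) \<in> measurable \<mu> (samples (Suc n))"
          using measurable_compose[OF measurable_Pair1'[OF X[unfolded samples_def]] measurable_add_dim[of n "{..<n}" "\<lambda>_. \<mu>"]]
          unfolding samples_def lessThan_Suc by simp
        then have "(\<lambda>x. class_size (Suc n) (X(n := x)) a) \<in> borel_measurable \<mu>"
          by (rule measurable_compose[OF _ measurable_class_size]) (auto simp: a)
        moreover have "\<bar>ln (class_size (Suc n) Y a)\<bar> \<le> ln (real (card T))" for Y
          using class_size_ge_1[OF a, of "Suc n" Y] class_size_le[of "Suc n" Y a] by simp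
        ultimately show "integrable \<mu> (\<lambda>x. ln (class_size (Suc n) (X(n := x)) a))"
          by (intro integrable_const_bound[of _ "ln (real (card T))"] borel_measurable_ln) auto
      qed
    qed
    finally show ?thesis .
  qed
  have "(\<integral>X. ?L n X \<partial>samples n) - real (card T) * ln 2 + (\<integral>X. gain n X \<partial>samples n) / 6
    = (\<integral>X. ?L n X - real (card T) * ln 2 + gain n X / 6 \<partial>samples n)"
    using intL integrable_gain[of n n] S.prob_space by simp
  also have "\<dots> \<le> (\<integral>X. (\<integral>x. ?L (Suc n) (X(n := x)) \<partial>\<mu>) \<partial>samples n)"
  proof (rule integral_mono[OF _ _ bnd])
    interpret P: product_prob_space "\<lambda>_ :: nat. \<mu>" UNIV by standard
    interpret PS: pair_prob_space "samples n" \<mu> ..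
    have "(\<lambda>(X, x). X(n := x)) \<in> measurable (samples n \<Otimes>\<^sub>M \<mu>) (samples (Suc n))"
      unfolding samples_def lessThan_Suc by (rule measurable_add_dim)
    then have "integrable (samples n \<Otimes>\<^sub>M \<mu>) (\<lambda>p. ?L (Suc n) ((\<lambda>(X, x). X(n := x)) p))"
    proof (intro Bochner_Integration.integrable_sum)
      fix a assume a: "a \<in> T" and m: "(\<lambda>(X, x). X(n := x)) \<in> measurable (samples n \<Otimes>\<^sub>M \<mu>) (samples (Suc n))"
      have "(\<lambda>p. class_size (Suc n) ((\<lambda>(X, x). X(n := x)) p) a) \<in> borel_measurable (samples n \<Otimes>\<^sub>M \<mu>)"
        by (rule measurable_compose[OF m measurable_class_size]) (auto simp: a)
      moreover have "\<bar>ln (class_size (Suc n) Y a)\<bar> \<le> ln (real (card T))" for Y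
        using class_size_ge_1[OF a, of "Suc n" Y] class_size_le[of "Suc n" Y a] by simp
      ultimately show "integrable (samples n \<Otimes>\<^sub>M \<mu>) (\<lambda>p. ln (class_size (Suc n) ((\<lambda>(X, x). X(n := x)) p) a))"
        by (intro PS.integrable_const_bound[of _ "ln (real (card T))"] borel_measurable_ln) auto
    qed
    then show "integrable (samples n) (\<lambda>X. \<integral>x. ?L (Suc n) (X(n := x)) \<partial>\<mu>)"
      using PS.integrable_fst'[of "\<lambda>p. ?L (Suc n) ((\<lambda>(X, x). X(n := x)) p)"] by simp
  qed (use intL integrable_gain[of n n] in auto)
  also have "\<dots> = (\<integral>X. ?L (Suc n) X \<partial>samples (Suc n))"
    by (rule integral_samples_Suc[symmetric, OF intL])
  finally have "((\<integral>X. ?L n X \<partial>samples n) - real (card T) * ln 2 + (\<integral>X. gain n X \<partial>samples n) / 6) / real (card T)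
     \<le> mean_log_size (Suc n)"
    unfolding mean_log_size_def by (rule divide_right_mono) simp
  then show ?thesis
    using card_T_pos by (simp add: mean_log_size_def mean_gain_def add_divide_distrib diff_divide_distrib mult.commute)
qed

lemma mean_log_size_lower:
  "ln (real (card T)) - real M * ln 2 + (\<Sum>n<M. mean_gain n) / 6 \<le> mean_log_size M"
proof (induction M)
  case 0
  interpret S: prob_space "samples 0" by (rule prob_space_samples)
  have "class_size 0 X a = real (card T)" for X a by (simp add: class_size_def match_def)
  then show ?case using card_T_pos S.prob_space by (simp add: mean_log_size_def)
next
  case (Suc M)
  then show ?case using mean_log_size_Suc[of M] by (simp add: algebra_simps add_divide_distrib)
qed

section \<open>Expected number of consistent parameters, as an upper bound for the conditional
  entropy\<close>

definition mean_size :: "nat \<Rightarrow> real" where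
  "mean_size n = (\<Sum>a\<in>T. \<Sum>b\<in>T. ((1 + corr a b) / 2) ^ n) / real (card T)"

lemma mean_size_eq: "mean_size n = (\<integral>X. (\<Sum>a\<in>T. class_size n X a) \<partial>samples n) / real (card T)"
  unfolding mean_size_def class_size_def by (simp add: integrable_match integral_match)

lemma integrable_class_size: "n \<le> m \<Longrightarrow> a \<in> T \<Longrightarrow> integrable (samples m) (\<lambda>X. class_size n X a)"
  unfolding class_size_def by (intro Bochner_Integration.integrable_sum integrable_match) auto

lemma mean_size_ge_1: "1 \<le> mean_size n"
proof -
  interpret S: prob_space "samples n" by (rule prob_space_samples)
  have "1 = (\<integral>X. (\<Sum>a\<in>T. 1) \<partial>samples n) / real (card T)" using S.prob_space card_T_pos by simp
  also have "\<dots> \<le> mean_size n" unfolding mean_size_eq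
    by (intro divide_right_mono integral_mono sum_mono class_size_ge_1 Bochner_Integration.integrable_sum integrable_class_size) auto
  finally show ?thesis .
qed

text \<open>Jensen's inequality for \<open>ln\<close>, obtained by integrating the tangent bound at
  the mean \<open>c\<close>.\<close>

lemma mean_log_size_upper: "mean_log_size n \<le> ln (mean_size n)"
proof -
  interpret S: prob_space "samples n" by (rule prob_space_samples)
  note ints = integrable_class_size[of n n]
  define c where "c = mean_size n"
  have c: "1 \<le> c" unfolding c_def by (rule mean_size_ge_1)
  have "ln y \<le> y / c - 1 + ln c" if "1 \<le> y" for y
    using ln_le_minus_one[of "y / c"] that c by (simp add: ln_div)
  then have "(\<integral>X. (\<Sum>a\<in>T. ln (class_size n X a)) \<partial>samples n) \<le> (\<integral>X. (\<Sum>a\<in>T. class_size n X a / c - 1 + ln c) \<partial>samples n)"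
    by (intro integral_mono sum_mono Bochner_Integration.integrable_sum integrable_ln_class_size) (use ints class_size_ge_1 in auto)
  also have "\<dots> = (\<integral>X. (\<Sum>a\<in>T. class_size n X a) / c + real (card T) * (ln c - 1) \<partial>samples n)"
    by (simp add: sum.distrib sum_subtractf sum_divide_distrib algebra_simps)
  also have "\<dots> = (\<integral>X. (\<Sum>a\<in>T. class_size n X a) \<partial>samples n) / c + real (card T) * (ln c - 1)"
    using ints S.prob_space by (simp add: Bochner_Integration.integrable_sum)
  also have "(\<integral>X. (\<Sum>a\<in>T. class_size n X a) \<partial>samples n) = c * real (card T)"
    using card_T_pos by (simp add: c_def mean_size_eq)
  finally have "(\<integral>X. (\<Sum>a\<in>T. ln (class_size n X a)) \<partial>samples n) \<le> real (card T) * ln c"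
    using c by (simp add: algebra_simps)
  then show ?thesis
    using card_T_pos by (simp add: mean_log_size_def c_def divide_le_eq mult.commute)
qed

text \<open>By monotonicity, a gain at time \<open>n\<close> persists up to time \<open>M\<close>, where it costs entropy.\<close>

lemma mean_gain_bound:
  assumes "n \<le> M"
  shows "(real M - real n) * mean_gain n \<le> 6 * (real M * ln 2 - ln (real (card T)) + ln (mean_size M))"
proof -
  have "(real M - real n) * mean_gain n = (\<Sum>i\<in>{n..<M}. mean_gain n)" using assms by (simp add: of_nat_diff)
  also have "\<dots> \<le> (\<Sum>i\<in>{n..<M}. mean_gain i)" by (intro sum_mono mean_gain_mono) auto
  also have "\<dots> \<le> (\<Sum>i<M. mean_gain i)" by (intro sum_mono2) (auto simp: mean_gain_nonneg)
  finally show ?thesis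
    using mean_log_size_lower[of M] mean_log_size_upper[of M] by simp
qed

end

section \<open>Sparse parameters and Gaussian designs\<close>

definition supp :: "nat \<Rightarrow> (nat \<Rightarrow> real) \<Rightarrow> nat set" where
  "supp N t = {j \<in> {..<N}. t j \<noteq> 0}"

lemma finite_supp[simp]: "finite (supp N t)" and supp_subset: "supp N t \<subseteq> {..<N}"
  by (auto simp: supp_def)

lemma card_supp: "t \<in> Theta N k \<Longrightarrow> card (supp N t) = k"
  by (simp add: Theta_def supp_def)

lemma Theta_apply: "t \<in> Theta N k \<Longrightarrow> j < N \<Longrightarrow> t j = (if j \<in> supp N t then 1 / sqrt (real k) else 0)"
  by (auto simp: Theta_def supp_def PiE_iff)

lemma supp_inj: "inj_on (supp N) (Theta N k)"
proof
  fix s t assume s: "s \<in> Theta N k" and t: "t \<in> Theta N k" and eq: "supp N s = supp N t"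
  show "s = t"
  proof (rule PiE_ext)
    show "s \<in> PiE {..<N} (\<lambda>_. {0, 1 / sqrt (real k)})" "t \<in> PiE {..<N} (\<lambda>_. {0, 1 / sqrt (real k)})"
      using s t by (auto simp: Theta_def)
    show "s j = t j" if "j \<in> {..<N}" for j
      using Theta_apply[OF s] Theta_apply[OF t] that eq by auto
  qed
qed

lemma supp_image:
  assumes "0 < k"
  shows "supp N ` Theta N k = {S. S \<subseteq> {..<N} \<and> card S = k}"
proof (intro equalityI subsetI)
  fix S assume S: "S \<in> {S. S \<subseteq> {..<N} \<and> card S = k}"
  define t where "t = (\<lambda>j\<in>{..<N}. if j \<in> S then 1 / sqrt (real k) else 0)"
  have "supp N t = S" using S assms by (auto simp: supp_def t_def)
  moreover from this have "t \<in> Theta N k"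
    using S by (auto simp: Theta_def t_def supp_def)
  ultimately show "S \<in> supp N ` Theta N k" by blast
qed (use supp_subset in \<open>auto simp: card_supp\<close>)

lemma finite_Theta[simp]: "finite (Theta N k)"
  by (rule finite_subset[of _ "{..<N} \<rightarrow>\<^sub>E {0, 1 / sqrt (real k)}"]) (auto simp: Theta_def intro!: finite_PiE)

lemma card_Theta: "0 < k \<Longrightarrow> card (Theta N k) = N choose k"
  using card_image[OF supp_inj, of N k] n_subsets[of "{..<N}" k] by (simp add: supp_image)

lemma inprod_Theta:
  assumes "0 < k" "s \<in> Theta N k" "t \<in> Theta N k"
  shows "inprod N s t = 1 - real (card (supp N s - supp N t)) / real k"
proof -
  have "inprod N s t = (\<Sum>j<N. if j \<in> supp N s \<inter> supp N t then 1 / real k else 0)"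
    unfolding inprod_def using assms by (intro sum.cong) (auto simp: Theta_apply)
  also have "\<dots> = (\<Sum>j\<in>{..<N} \<inter> (supp N s \<inter> supp N t). 1 / real k)"
    by (subst sum.inter_restrict) auto
  also have "{..<N} \<inter> (supp N s \<inter> supp N t) = supp N s \<inter> supp N t"
    using supp_subset by blast
  also have "(\<Sum>j\<in>supp N s \<inter> supp N t. 1 / real k) = real (card (supp N s \<inter> supp N t)) / real k"
    by simp
  also have "card (supp N s \<inter> supp N t) + card (supp N s - supp N t) = k"
    using card_Int_Diff[of "supp N s" "supp N t"] card_supp[OF assms(2)] by simp
  then have "real (card (supp N s \<inter> supp N t)) = real k - real (card (supp N s - supp N t))"
    by linarith
  finally show ?thesis using assms by (simp add: diff_divide_distrib)
qed

lemma card_supp_diff_le: "s \<in> Theta N k \<Longrightarrow> card (supp N s - supp N t) \<le> k"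
  using card_mono[of "supp N s" "supp N s - supp N t"] by (simp add: card_supp)

text \<open>A support is determined by the points it drops from that of \<open>s\<close> and the
  points it adds. Both sets have \<open>j\<close> elements since supports have equal size; letting
  the added points range over all of \<open>{..<N}\<close> loses little when \<open>k\<close> is
  small against \<open>N\<close>.\<close>

lemma card_Theta_at_distance:
  assumes s: "s \<in> Theta N k"
  shows "card {t \<in> Theta N k. card (supp N s - supp N t) = j} \<le> (k choose j) * (N choose j)"
proof -
  let ?S = "supp N s"
  let ?g = "\<lambda>t. (?S - supp N t, supp N t - ?S)"
  have "card {t \<in> Theta N k. card (?S - supp N t) = j}
    \<le> card ({U. U \<subseteq> ?S \<and> card U = j} \<times> {V. V \<subseteq> {..<N} \<and> card V = j})"
  proof (rule card_inj_on_le[of ?g])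
    show "inj_on ?g {t \<in> Theta N k. card (?S - supp N t) = j}"
    proof (rule inj_onI)
      fix t t' assume t: "t \<in> {t \<in> Theta N k. card (?S - supp N t) = j}" "t' \<in> {t \<in> Theta N k. card (?S - supp N t) = j}"
        and eq: "?g t = ?g t'"
      have "supp N t = (?S - (?S - supp N t)) \<union> (supp N t - ?S)" for t by blast
      then have "supp N t = supp N t'" using eq by (metis prod.inject)
      then show "t = t'" using supp_inj[of N k] t by (auto dest: inj_onD)
    qed
    show "?g ` {t \<in> Theta N k. card (?S - supp N t) = j} \<subseteq> {U. U \<subseteq> ?S \<and> card U = j} \<times> {V. V \<subseteq> {..<N} \<and> card V = j}"
    proof (intro image_subsetI)
      fix t assume t: "t \<in> {t \<in> Theta N k. card (?S - supp N t) = j}"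
      have "card (?S - supp N t) = card (supp N t - ?S)"
        using t s by (intro card_le_sym_Diff[THEN antisym] card_le_sym_Diff) (auto simp: card_supp)
      then show "?g t \<in> {U. U \<subseteq> ?S \<and> card U = j} \<times> {V. V \<subseteq> {..<N} \<and> card V = j}"
        using t supp_subset[of N t] by auto
    qed
    show "finite ({U. U \<subseteq> ?S \<and> card U = j} \<times> {V. V \<subseteq> {..<N} \<and> card V = j})"
      by (intro finite_cartesian_product) (auto intro: finite_subset[of _ "Pow ?S"] finite_subset[of _ "Pow {..<N}"])
  qed
  then show ?thesis
    using n_subsets[of ?S j] n_subsets[of "{..<N}" j] card_supp[OF s] by (simp add: card_cartesian_product)
qed

lemma sum_Theta_le:
  fixes w :: "nat \<Rightarrow> real"
  assumes s: "s \<in> Theta N k" and w: "\<And>j. 0 \<le> w j"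
  shows "(\<Sum>t\<in>Theta N k. w (card (supp N s - supp N t))) \<le> (\<Sum>j\<le>k. real (k choose j) * real (N choose j) * w j)"
proof -
  let ?d = "\<lambda>t. card (supp N s - supp N t)"
  have "(\<Sum>t\<in>Theta N k. w (?d t)) = (\<Sum>j\<le>k. \<Sum>t\<in>{t \<in> Theta N k. ?d t = j}. w (?d t))"
    using card_supp_diff_le[OF s] by (intro sum.group[symmetric]) auto
  also have "\<dots> = (\<Sum>j\<le>k. real (card {t \<in> Theta N k. ?d t = j}) * w j)"
    by (intro sum.cong refl) simp
  also have "\<dots> \<le> (\<Sum>j\<le>k. real (k choose j) * real (N choose j) * w j)"
    using card_Theta_at_distance[OF s] w by (intro sum_mono mult_right_mono) (auto simp flip: of_nat_mult)
  finally show ?thesis .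
qed

text \<open>Bounds the expected number of parameters that differ from the true one in \<open>j\<close> support points
  and reproduce all \<open>n\<close> observations.\<close>

definition first_moment :: "nat \<Rightarrow> nat \<Rightarrow> nat \<Rightarrow> nat \<Rightarrow> real" where
  "first_moment N k n j = real (k choose j) * real (N choose j) * 2 powr (- (real j / real k * real n))"

locale perceptron =
  fixes A :: "real set" and N k :: nat
  assumes A_borel[measurable]: "A \<in> sets borel" and A_half: "measure std_gauss A = 1 / 2"
    and k_pos: "0 < k" and k_le: "k \<le> N"
begin

definition sgnA :: "real \<Rightarrow> real" where
  "sgnA x = 2 * indicator A x - 1"

lemma sgnA_measurable[measurable]: "sgnA \<in> borel_measurable borel"
  unfolding sgnA_def[abs_def] by measurable

sublocale balanced_sign sgnA
proof
  show "(\<integral>x. sgnA x \<partial>std_gauss) = 0"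
    using A_half std_gauss.prob_space unfolding sgnA_def
    by (subst Bochner_Integration.integral_diff) (auto simp: std_gauss.emeasure_eq_measure)
  show "sgnA x = 1 \<or> sgnA x = -1" for x by (simp add: sgnA_def indicator_def)
qed measurable

lemma Theta_nonempty: "Theta N k \<noteq> {}"
  using card_Theta[OF k_pos, of N] k_le by (metis card.empty zero_less_binomial_iff less_irrefl)

lemma measurable_inprod[measurable]: "(\<lambda>x. inprod N x t) \<in> borel_measurable (gauss_vec {..<N})"
  unfolding inprod_def by measurable

sublocale sign_channel "gauss_vec {..<N}" "Theta N k" "\<lambda>t x. sgnA (inprod N x t)"
proof (intro sign_channel.intro prob_space_gauss_vec sign_channel_axioms.intro)
qed (auto simp: Theta_nonempty f_sign)

lemma samples_eq: "samples n = design N n"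
  by (simp add: samples_def design_def)

abbreviation D :: "(nat \<Rightarrow> real) \<Rightarrow> (nat \<Rightarrow> real) \<Rightarrow> nat" where
  "D s t \<equiv> card (supp N s - supp N t)"

lemma inprod_bounds:
  assumes "s \<in> Theta N k" "t \<in> Theta N k"
  shows "0 \<le> inprod N s t" "inprod N s t \<le> 1"
  using inprod_Theta[OF k_pos assms] card_supp_diff_le[OF assms(1), of t] k_pos by auto

lemma inprod_self: "t \<in> Theta N k \<Longrightarrow> (\<Sum>j<N. (t j)\<^sup>2) = 1"
  using inprod_Theta[OF k_pos, of t N t] by (simp add: inprod_def power2_eq_square)

lemma corr_eq:
  assumes "s \<in> Theta N k" "t \<in> Theta N k"
  shows "corr s t = stab (inprod N s t)"
proof -
  have "corr s t = (\<integral>x. sgnA (inprod N x s) * sgnA (inprod N x t) \<partial>gauss_vec {..<N})"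
    by (rule corr_def)
  also have "\<dots> = stab (inprod N s t)"
    unfolding inprod_def by (rule stab_gauss_vec) (auto simp: inprod_self assms)
  finally show ?thesis .
qed

definition mean_overlap :: "nat \<Rightarrow> real" where
  "mean_overlap n = (\<integral>X. (\<Sum>a\<in>Theta N k. post n X (inprod N a) a) \<partial>samples n) / real (card (Theta N k))"

lemma mean_post_le:
  assumes "\<And>X. (\<Sum>a\<in>Theta N k. post n X (\<phi> a) a) \<le> (\<Sum>a\<in>Theta N k. h X a)"
    "\<And>a. a \<in> Theta N k \<Longrightarrow> integrable (samples n) (\<lambda>X. h X a)"
  shows "(\<integral>X. (\<Sum>a\<in>Theta N k. post n X (\<phi> a) a) \<partial>samples n) \<le> (\<Sum>a\<in>Theta N k. \<integral>X. h X a \<partial>samples n)"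
proof -
  have "(\<integral>X. (\<Sum>a\<in>Theta N k. post n X (\<phi> a) a) \<partial>samples n) \<le> (\<integral>X. (\<Sum>a\<in>Theta N k. h X a) \<partial>samples n)"
    by (intro integral_mono Bochner_Integration.integrable_sum integrable_post assms) auto
  also have "\<dots> = (\<Sum>a\<in>Theta N k. \<integral>X. h X a \<partial>samples n)"
    by (rule Bochner_Integration.integral_sum[OF assms(2)])
  finally show ?thesis .
qed

lemma mean_overlap_nonneg: "0 \<le> mean_overlap n"
proof -
  have "0 \<le> post n X (inprod N a) a" if a: "a \<in> Theta N k" for X a
    using post_mono[of "\<lambda>_. 0" "inprod N a" a n X] inprod_bounds a post_const[OF a, of n X 0] by auto
  then show ?thesis
    unfolding mean_overlap_def by (intro divide_nonneg_nonneg integral_nonneg_AE AE_I2 sum_nonneg) auto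
qed

lemma post_linear: "post n X (\<lambda>b. c * \<phi> b + d * \<psi> b) a = c * post n X \<phi> a + d * post n X \<psi> a"
  by (simp add: post_def sum.distrib sum_distrib_left add_divide_distrib algebra_simps)

text \<open>A Markov-type argument: an overlap above \<open>\<delta>\<close> has \<open>stab\<close>
  at least \<open>stab \<delta>\<close>, so the quotient is at least 1 and dominates the overlap. It
  converts label correlation, which entropy controls, into parameter overlap.\<close>

lemma mean_overlap_le:
  assumes \<delta>: "0 < \<delta>" "\<delta> \<le> 1"
  shows "mean_overlap n \<le> \<delta> + mean_gain n / stab \<delta>"
proof -
  have sp: "0 < stab \<delta>" by (rule stab_pos[OF \<delta>])
  have le: "inprod N a b \<le> \<delta> * 1 + (1 / stab \<delta>) * corr a b" if "a \<in> Theta N k" "b \<in> Theta N k" for a b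
  proof (cases "inprod N a b \<le> \<delta>")
    case True
    moreover have "0 \<le> stab (inprod N a b)" using inprod_bounds[OF that] by (rule stab_nonneg)
    ultimately show ?thesis using sp by (simp add: corr_eq that add_increasing2)
  next
    case False
    then have "stab \<delta> \<le> stab (inprod N a b)" using \<delta> inprod_bounds[OF that] by (intro stab_mono) auto
    then have "1 \<le> stab (inprod N a b) / stab \<delta>" using sp by simp
    then show ?thesis using inprod_bounds[OF that] \<delta> by (simp add: corr_eq that)
  qed
  have "(\<integral>X. (\<Sum>a\<in>Theta N k. post n X (inprod N a) a) \<partial>samples n)
    \<le> (\<Sum>a\<in>Theta N k. \<integral>X. \<delta> + (1 / stab \<delta>) * post n X (corr a) a \<partial>samples n)"
  proof (rule mean_post_le)
    fix X
    show "(\<Sum>a\<in>Theta N k. post n X (inprod N a) a) \<le> (\<Sum>a\<in>Theta N k. \<delta> + (1 / stab \<delta>) * post n X (corr a) a)"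
    proof (rule sum_mono)
      fix a assume a: "a \<in> Theta N k"
      have "post n X (inprod N a) a \<le> post n X (\<lambda>b. \<delta> * 1 + (1 / stab \<delta>) * corr a b) a"
        using le a by (intro post_mono) auto
      then show "post n X (inprod N a) a \<le> \<delta> + (1 / stab \<delta>) * post n X (corr a) a"
        unfolding post_linear using post_const[OF a, of n X 1] by simp
    qed
  next
    interpret S: prob_space "samples n" by (rule prob_space_samples)
    fix a assume "a \<in> Theta N k"
    then show "integrable (samples n) (\<lambda>X. \<delta> + (1 / stab \<delta>) * post n X (corr a) a)"
      using integrable_post[of n n a "corr a"] by simp
  qed
  also have "\<dots> = (\<Sum>a\<in>Theta N k. \<delta> + (1 / stab \<delta>) * (\<integral>X. post n X (corr a) a \<partial>samples n))"
  proof (rule sum.cong[OF refl])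
    interpret S: prob_space "samples n" by (rule prob_space_samples)
    fix a assume "a \<in> Theta N k"
    then show "(\<integral>X. \<delta> + (1 / stab \<delta>) * post n X (corr a) a \<partial>samples n) = \<delta> + (1 / stab \<delta>) * (\<integral>X. post n X (corr a) a \<partial>samples n)"
      using integrable_post[of n n a "corr a"] S.prob_space by simp
  qed
  also have "\<dots> = real (card (Theta N k)) * \<delta> + (1 / stab \<delta>) * (\<integral>X. gain n X \<partial>samples n)"
    unfolding gain_def by (subst Bochner_Integration.integral_sum) (auto simp: sum.distrib sum_distrib_left integrable_post)
  finally show ?thesis
    using card_T_pos by (simp add: mean_overlap_def mean_gain_def divide_le_eq field_simps)
qed

text \<open>The exponential bound on \<open>stab\<close> enters here. Since the overlap is
  \<open>1 - D s t / k\<close>, the survival probability decays geometrically in the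
  distance.\<close>

lemma agree_le:
  assumes "s \<in> Theta N k" "t \<in> Theta N k"
  shows "((1 + corr s t) / 2) ^ n \<le> 2 powr (- (real (D s t) / real k * real n))" "0 \<le> ((1 + corr s t) / 2) ^ n"
proof -
  have "(1 + corr s t) / 2 \<le> 2 powr (inprod N s t) / 2"
    using stab_le_two_powr[OF inprod_bounds[OF assms]] by (simp add: corr_eq assms)
  also have "\<dots> = 2 powr (- (real (D s t) / real k))"
    by (simp add: inprod_Theta[OF k_pos assms] powr_diff powr_minus_divide)
  finally have le: "(1 + corr s t) / 2 \<le> 2 powr (- (real (D s t) / real k))" .
  have nn: "0 \<le> (1 + corr s t) / 2" using abs_corr_le[of s t] by simp
  then have "((1 + corr s t) / 2) ^ n \<le> (2 powr (- (real (D s t) / real k))) ^ n" using le by (intro power_mono)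
  also have "\<dots> = 2 powr (- (real (D s t) / real k * real n))" by (subst powr_realpow[symmetric]) (simp_all add: powr_powr)
  finally show "((1 + corr s t) / 2) ^ n \<le> 2 powr (- (real (D s t) / real k * real n))" .
  show "0 \<le> ((1 + corr s t) / 2) ^ n" using nn by simp
qed

lemma mean_size_le: "mean_size n \<le> (\<Sum>j\<le>k. first_moment N k n j)"
proof -
  have "(\<Sum>b\<in>Theta N k. ((1 + corr a b) / 2) ^ n) \<le> (\<Sum>j\<le>k. first_moment N k n j)" if a: "a \<in> Theta N k" for a
  proof -
    have "(\<Sum>b\<in>Theta N k. ((1 + corr a b) / 2) ^ n) \<le> (\<Sum>b\<in>Theta N k. 2 powr (- (real (D a b) / real k * real n)))"
      by (intro sum_mono agree_le a)
    also have "\<dots> \<le> (\<Sum>j\<le>k. first_moment N k n j)"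
      unfolding first_moment_def by (rule sum_Theta_le[OF a]) simp
    finally show ?thesis .
  qed
  then have "(\<Sum>a\<in>Theta N k. \<Sum>b\<in>Theta N k. ((1 + corr a b) / 2) ^ n) \<le> real (card (Theta N k)) * (\<Sum>j\<le>k. first_moment N k n j)"
    by (rule sum_bounded_above)
  then show ?thesis using card_T_pos by (simp add: mean_size_def divide_le_eq mult.commute)
qed

text \<open>Losing more than \<open>\<delta>\<close> of overlap requires a distance above
  \<open>\<delta> * k\<close>. The posterior weight of such parameters is at most their number among
  the consistent ones, because the class contains the truth and so has size at least 1.\<close>

lemma mean_overlap_ge:
  assumes \<delta>: "0 < \<delta>"
  shows "1 - \<delta> - (\<Sum>j\<in>{j. j \<le> k \<and> \<delta> * real k < real j}. first_moment N k n j) \<le> mean_overlap n"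
proof -
  interpret S: prob_space "samples n" by (rule prob_space_samples)
  define bad where "bad j = (if \<delta> * real k < real j then 1 else 0 :: real)" for j
  have le: "1 - inprod N a b \<le> \<delta> * 1 + 1 * bad (D a b)" if "a \<in> Theta N k" "b \<in> Theta N k" for a b
  proof (cases "\<delta> * real k < real (D a b)")
    case True
    then show ?thesis using inprod_bounds[OF that] \<delta> by (simp add: bad_def)
  next
    case False
    then show ?thesis using inprod_Theta[OF k_pos that] k_pos by (simp add: bad_def divide_le_eq)
  qed
  define B where "B = (\<Sum>j\<in>{j. j \<le> k \<and> \<delta> * real k < real j}. first_moment N k n j)"
  have "(\<integral>X. (\<Sum>a\<in>Theta N k. post n X (\<lambda>b. 1 - inprod N a b) a) \<partial>samples n)
    \<le> (\<Sum>a\<in>Theta N k. \<integral>X. \<delta> + (\<Sum>b\<in>Theta N k. match n X a b * bad (D a b)) \<partial>samples n)"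
  proof (rule mean_post_le)
    fix X
    show "(\<Sum>a\<in>Theta N k. post n X (\<lambda>b. 1 - inprod N a b) a)
       \<le> (\<Sum>a\<in>Theta N k. \<delta> + (\<Sum>b\<in>Theta N k. match n X a b * bad (D a b)))"
    proof (rule sum_mono)
      fix a assume a: "a \<in> Theta N k"
      have "post n X (\<lambda>b. 1 - inprod N a b) a \<le> post n X (\<lambda>b. \<delta> * 1 + 1 * bad (D a b)) a"
        using le a by (intro post_mono) auto
      also have "\<dots> = \<delta> + post n X (\<lambda>b. bad (D a b)) a"
        unfolding post_linear using post_const[OF a, of n X 1] by simp
      also have "post n X (\<lambda>b. bad (D a b)) a \<le> (\<Sum>b\<in>Theta N k. match n X a b * bad (D a b)) / 1"
        unfolding post_def using class_size_ge_1[OF a, of n X]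
        by (intro divide_left_mono sum_nonneg) (auto simp: bad_def)
      finally show "post n X (\<lambda>b. 1 - inprod N a b) a \<le> \<delta> + (\<Sum>b\<in>Theta N k. match n X a b * bad (D a b))" by simp
    qed
  next
    fix a assume "a \<in> Theta N k"
    then show "integrable (samples n) (\<lambda>X. \<delta> + (\<Sum>b\<in>Theta N k. match n X a b * bad (D a b)))"
      by (intro Bochner_Integration.integrable_add Bochner_Integration.integrable_sum integrable_mult_left integrable_match) auto
  qed
  also have "\<dots> \<le> (\<Sum>a\<in>Theta N k. \<delta> + B)"
  proof (rule sum_mono)
    fix a assume a: "a \<in> Theta N k"
    have "(\<integral>X. \<delta> + (\<Sum>b\<in>Theta N k. match n X a b * bad (D a b)) \<partial>samples n)
      = \<delta> + (\<Sum>b\<in>Theta N k. ((1 + corr a b) / 2) ^ n * bad (D a b))"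
      using S.prob_space a by (simp add: integrable_match integral_match)
    also have "(\<Sum>b\<in>Theta N k. ((1 + corr a b) / 2) ^ n * bad (D a b))
      \<le> (\<Sum>b\<in>Theta N k. 2 powr (- (real (D a b) / real k * real n)) * bad (D a b))"
      using a by (intro sum_mono mult_right_mono agree_le) (auto simp: bad_def)
    also have "\<dots> \<le> (\<Sum>j\<le>k. real (k choose j) * real (N choose j) * (2 powr (- (real j / real k * real n)) * bad j))"
      by (rule sum_Theta_le[OF a, where w="\<lambda>j. 2 powr (- (real j / real k * real n)) * bad j"]) (simp add: bad_def)
    also have "\<dots> = (\<Sum>j\<le>k. if \<delta> * real k < real j then first_moment N k n j else 0)"
      by (intro sum.cong refl) (simp add: bad_def first_moment_def)
    also have "\<dots> = B"
      unfolding B_def by (subst sum.inter_filter[symmetric]) (auto intro!: sum.cong)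
    finally show "(\<integral>X. \<delta> + (\<Sum>b\<in>Theta N k. match n X a b * bad (D a b)) \<partial>samples n) \<le> \<delta> + B" by simp
  qed
  finally have 1: "(\<integral>X. (\<Sum>a\<in>Theta N k. post n X (\<lambda>b. 1 - inprod N a b) a) \<partial>samples n) \<le> real (card (Theta N k)) * (\<delta> + B)"
    by simp
  have "(\<Sum>a\<in>Theta N k. post n X (\<lambda>b. 1 - inprod N a b) a) = real (card (Theta N k)) - (\<Sum>a\<in>Theta N k. post n X (inprod N a) a)" for X
  proof -
    have "post n X (\<lambda>b. 1 - inprod N a b) a = 1 - post n X (inprod N a) a" if a: "a \<in> Theta N k" for a
      using post_linear[of n X 1 "\<lambda>_. 1" "-1" "inprod N a" a] post_const[OF a, of n X 1] by simp
    then show ?thesis by (simp add: sum_subtractf)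
  qed
  then have "(\<integral>X. (\<Sum>a\<in>Theta N k. post n X (\<lambda>b. 1 - inprod N a b) a) \<partial>samples n)
    = (\<integral>X. real (card (Theta N k)) - (\<Sum>a\<in>Theta N k. post n X (inprod N a) a) \<partial>samples n)"
    by (intro Bochner_Integration.integral_cong refl)
  also have "\<dots> = real (card (Theta N k)) - (\<integral>X. (\<Sum>a\<in>Theta N k. post n X (inprod N a) a) \<partial>samples n)"
    using S.prob_space
    by (subst Bochner_Integration.integral_diff) (auto intro!: Bochner_Integration.integrable_sum integrable_post)
  also have "\<dots> = real (card (Theta N k)) * (1 - mean_overlap n)"
    using card_T_pos by (simp add: mean_overlap_def algebra_simps)
  finally have "(\<integral>X. (\<Sum>a\<in>Theta N k. post n X (\<lambda>b. 1 - inprod N a b) a) \<partial>samples n)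
    = real (card (Theta N k)) * (1 - mean_overlap n)" .
  then show ?thesis using 1 card_T_pos by (simp add: B_def)
qed

end

section \<open>The minimum mean square error as an overlap\<close>

context perceptron
begin

abbreviation U :: "(nat \<Rightarrow> real) measure" where
  "U \<equiv> uniform_count_measure (Theta N k)"

lemma prob_space_U: "prob_space U"
  by (rule prob_space_uniform_count_measure) (auto simp: Theta_nonempty)

lemma pair_prob_space_model: "pair_prob_space U (samples n)"
  by (intro pair_prob_space.intro pair_sigma_finite.intro prob_space_imp_sigma_finite prob_space_U prob_space_samples)

lemma model_eq: "model N k n = U \<Otimes>\<^sub>M samples n"
  by (simp add: model_def samples_eq)

lemma space_model: "space (model N k n) = Theta N k \<times> space (samples n)"
  by (simp add: model_eq space_pair_measure space_uniform_count_measure)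

lemma prob_space_model: "prob_space (model N k n)"
proof -
  interpret pair_prob_space U "samples n" by (rule pair_prob_space_model)
  show ?thesis unfolding model_eq by (rule prob_space_axioms)
qed

lemma integral_model:
  fixes h :: "(nat \<Rightarrow> real) \<times> (nat \<Rightarrow> nat \<Rightarrow> real) \<Rightarrow> real"
  assumes "integrable (model N k n) h"
  shows "(\<integral>\<omega>. h \<omega> \<partial>model N k n) = (\<integral>X. (\<Sum>a\<in>Theta N k. h (a, X)) / real (card (Theta N k)) \<partial>samples n)"
proof -
  interpret P: pair_prob_space U "samples n" by (rule pair_prob_space_model)
  have "(\<integral>\<omega>. h \<omega> \<partial>model N k n) = (\<integral>X. (\<integral>a. h (a, X) \<partial>U) \<partial>samples n)"
    using P.integral_snd[of "\<lambda>a X. h (a, X)"] assms by (simp add: model_eq)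
  then show ?thesis by (simp add: integral_uniform_count_measure)
qed

lemma measurable_coord[measurable]: "(\<lambda>\<omega>. fst \<omega> j) \<in> borel_measurable (model N k n)"
proof -
  have "(\<lambda>t. t j) \<in> borel_measurable U"
    by (auto simp: measurable_def space_uniform_count_measure sets_uniform_count_measure)
  then show ?thesis unfolding model_eq by (rule measurable_compose[OF measurable_fst])
qed

lemma measurable_design[measurable]:
  "i < n \<Longrightarrow> j < N \<Longrightarrow> (\<lambda>\<omega>. snd \<omega> i j) \<in> borel_measurable (model N k n)"
  unfolding model_eq samples_def
  by (rule measurable_compose[OF measurable_snd], rule measurable_compose[OF measurable_component_singleton])
     (auto intro: measurable_component_singleton)

lemma sets_samples: "sets (samples n) = sets (PiM {..<n} (\<lambda>_. PiM {..<N} (\<lambda>_. borel :: real measure)))"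
  unfolding samples_def by (intro sets_PiM_cong refl) simp

lemma measurable_obs: "obs A N n \<in> measurable (model N k n) (obs_space N n)"
  unfolding obs_def obs_space_def
proof (rule measurable_Pair)
  show "(\<lambda>\<omega>. \<lambda>i\<in>{..<n}. indicator A (inprod N (snd \<omega> i) (fst \<omega>)) :: real)
    \<in> model N k n \<rightarrow>\<^sub>M PiM {..<n} (\<lambda>_. borel)"
  proof (rule measurable_restrict)
    fix i assume i: "i \<in> {..<n}"
    have "(\<lambda>\<omega>. inprod N (snd \<omega> i) (fst \<omega>)) \<in> borel_measurable (model N k n)"
      unfolding inprod_def using i by (intro borel_measurable_sum borel_measurable_times measurable_design measurable_coord) auto
    then show "(\<lambda>\<omega>. indicator A (inprod N (snd \<omega> i) (fst \<omega>)) :: real) \<in> borel_measurable (model N k n)"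
      by (rule measurable_compose) measurable
  qed
  have "snd \<in> model N k n \<rightarrow>\<^sub>M samples n" unfolding model_eq by (rule measurable_snd)
  then show "snd \<in> model N k n \<rightarrow>\<^sub>M PiM {..<n} (\<lambda>_. PiM {..<N} (\<lambda>_. borel))"
    by (simp cong: measurable_cong_sets add: sets_samples measurable_cong_sets[OF refl sets_samples])
qed

lemma subalgebra_obs: "subalgebra (model N k n) (obs_sigma A N k n)"
proof -
  have "sets (obs_sigma A N k n) \<subseteq> sets (model N k n)"
    unfolding obs_sigma_def by (rule sets_image_in_sets) (auto simp: measurable_obs)
  then show ?thesis by (simp add: subalgebra_def obs_sigma_def)
qed

definition posterior_coord :: "nat \<Rightarrow> nat \<Rightarrow> (nat \<Rightarrow> real) \<times> (nat \<Rightarrow> nat \<Rightarrow> real) \<Rightarrow> real" where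
  "posterior_coord n j \<omega> = post n (snd \<omega>) (\<lambda>b. b j) (fst \<omega>)"

text \<open>The truth enters only through its labels, so the posterior mean factors through
  \<open>obs\<close>. In this factorization \<open>2 * y - 1\<close> turns an observed 0-1 label
  into the sign \<open>sgnA\<close>.\<close>

lemma measurable_posterior_coord: "posterior_coord n j \<in> borel_measurable (obs_sigma A N k n)"
proof -
  define m where "m z b = (\<Prod>i<n. (1 + (2 * fst z i - 1) * sgnA (inprod N (snd z i) b)) / 2)"
    for z :: "(nat \<Rightarrow> real) \<times> (nat \<Rightarrow> nat \<Rightarrow> real)" and b
  define G where "G z = (\<Sum>b\<in>Theta N k. m z b * b j) / (\<Sum>b\<in>Theta N k. m z b)" for z
  have obs: "obs A N n \<in> obs_sigma A N k n \<rightarrow>\<^sub>M obs_space N n"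
    unfolding obs_sigma_def
    by (rule measurable_vimage_algebra1) (use measurable_space[OF measurable_obs] in auto)
  have [measurable]: "(\<lambda>z. fst z i) \<in> borel_measurable (obs_space N n)" if "i < n" for i
    unfolding obs_space_def
    by (rule measurable_compose[OF measurable_fst]) (use that in \<open>auto intro: measurable_component_singleton\<close>)
  have [measurable]: "(\<lambda>z. snd z i l) \<in> borel_measurable (obs_space N n)" if "i < n" "l < N" for i l
    unfolding obs_space_def
    by (rule measurable_compose[OF measurable_snd], rule measurable_compose[OF measurable_component_singleton])
       (use that in \<open>auto intro: measurable_component_singleton\<close>)
  have "m' \<in> borel_measurable (obs_space N n)" if "m' = (\<lambda>z. m z b)" for b m'
    unfolding that m_def inprod_def
    by (intro borel_measurable_prod borel_measurable_divide borel_measurable_add borel_measurable_times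
          borel_measurable_diff borel_measurable_const measurable_compose[OF _ sgnA_measurable] borel_measurable_sum) auto
  then have "G \<in> borel_measurable (obs_space N n)"
    unfolding G_def[abs_def] by (intro borel_measurable_divide borel_measurable_sum borel_measurable_times borel_measurable_const) auto
  then have "(\<lambda>\<omega>. G (obs A N n \<omega>)) \<in> borel_measurable (obs_sigma A N k n)"
    by (rule measurable_compose[OF obs])
  also have "(\<lambda>\<omega>. G (obs A N n \<omega>)) = posterior_coord n j"
  proof
    fix \<omega> :: "(nat \<Rightarrow> real) \<times> (nat \<Rightarrow> nat \<Rightarrow> real)"
    have "m (obs A N n \<omega>) b = match n (snd \<omega>) (fst \<omega>) b" for b
      unfolding m_def match_def by (intro prod.cong) (auto simp: obs_def sgnA_def)
    then show "G (obs A N n \<omega>) = posterior_coord n j \<omega>"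
      by (simp add: G_def posterior_coord_def post_def class_size_def)
  qed
  finally show ?thesis .
qed

lemma obs_cong:
  assumes "match n X a b \<noteq> 0"
  shows "obs A N n (a, X) = obs A N n (b, X)"
proof -
  have "sgnA (inprod N (X i) a) = sgnA (inprod N (X i) b)" if "i < n" for i
    using assms that by (auto simp: match_eq split: if_splits)
  then have "indicator A (inprod N (X i) a) = (indicator A (inprod N (X i) b) :: real)" if "i < n" for i
    using that by (simp add: sgnA_def)
  then show ?thesis by (auto simp: obs_def fun_eq_iff restrict_def)
qed

lemma abs_coord_le: "a \<in> Theta N k \<Longrightarrow> \<bar>a j\<bar> \<le> (\<Sum>b\<in>Theta N k. \<bar>b j\<bar>)"
  by (rule member_le_sum[where f="\<lambda>b. \<bar>b j\<bar>"]) auto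

lemma integrable_coord: "integrable (model N k n) (\<lambda>\<omega>. fst \<omega> j)"
proof -
  interpret M: prob_space "model N k n" by (rule prob_space_model)
  show ?thesis
    by (rule M.integrable_const_bound[of _ "\<Sum>b\<in>Theta N k. \<bar>b j\<bar>"])
       (auto simp: space_model abs_coord_le intro!: AE_I2)
qed

lemma abs_posterior_coord_le: "\<omega> \<in> space (model N k n) \<Longrightarrow> \<bar>posterior_coord n j \<omega>\<bar> \<le> (\<Sum>b\<in>Theta N k. \<bar>b j\<bar>)"
  unfolding posterior_coord_def
  by (rule abs_post_le[OF abs_coord_le]) (auto simp: space_model)

lemma measurable_posterior_coord_model[measurable]: "posterior_coord n j \<in> borel_measurable (model N k n)"
  by (rule measurable_from_subalg[OF subalgebra_obs measurable_posterior_coord])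

lemma integrable_posterior_coord: "integrable (model N k n) (posterior_coord n j)"
proof -
  interpret M: prob_space "model N k n" by (rule prob_space_model)
  show ?thesis
    by (rule M.integrable_const_bound[of _ "\<Sum>b\<in>Theta N k. \<bar>b j\<bar>"]) (auto simp: abs_posterior_coord_le intro!: AE_I2)
qed

text \<open>For fixed inputs, an event determined by the observations is a union of classes. Its
  indicator is class-constant, and \<open>sum_post_mult\<close> gives the integral identity that
  characterizes the conditional expectation.\<close>

lemma cond_exp_coord:
  "AE \<omega> in model N k n. real_cond_exp (model N k n) (obs_sigma A N k n) (\<lambda>\<omega>'. fst \<omega>' j) \<omega> = posterior_coord n j \<omega>"
proof -
  interpret M: prob_space "model N k n" by (rule prob_space_model)
  interpret finite_measure_subalgebra "model N k n" "obs_sigma A N k n"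
    by unfold_locales (rule subalgebra_obs)
  show ?thesis
  proof (rule real_cond_exp_charact)
    fix B assume B: "B \<in> sets (obs_sigma A N k n)"
    then obtain B' where B': "B = obs A N n -` B' \<inter> space (model N k n)"
      unfolding obs_sigma_def
      by (subst (asm) sets_vimage_algebra2) (use measurable_space[OF measurable_obs] in auto)
    have Bm: "B \<in> sets (model N k n)" using B subalgebra_obs by (auto simp: subalgebra_def)
    have inv: "indicator B (a, X) = (indicator B (b, X) :: real)"
      if "a \<in> Theta N k" "b \<in> Theta N k" "match n X a b \<noteq> 0" for a b X
      using obs_cong[OF that(3)] that by (auto simp: B' space_model indicator_def)
    have set_int: "(\<integral>\<omega>\<in>B. h \<omega> \<partial>model N k n)
      = (\<integral>X. (\<Sum>a\<in>Theta N k. indicator B (a, X) * h (a, X)) / real (card (Theta N k)) \<partial>samples n)"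
      if "integrable (model N k n) h" for h :: "(nat \<Rightarrow> real) \<times> (nat \<Rightarrow> nat \<Rightarrow> real) \<Rightarrow> real"
      unfolding set_lebesgue_integral_def using integral_model[OF integrable_mult_indicator[OF Bm that]] by simp
    have "(\<integral>\<omega>\<in>B. fst \<omega> j \<partial>model N k n)
      = (\<integral>X. (\<Sum>a\<in>Theta N k. indicator B (a, X) * a j) / real (card (Theta N k)) \<partial>samples n)"
      using set_int[OF integrable_coord] by simp
    also have "\<dots> = (\<integral>X. (\<Sum>a\<in>Theta N k. indicator B (a, X) * posterior_coord n j (a, X)) / real (card (Theta N k)) \<partial>samples n)"
    proof (intro Bochner_Integration.integral_cong refl arg_cong2[where f="(/)"])
      fix X
      show "(\<Sum>a\<in>Theta N k. indicator B (a, X) * a j) = (\<Sum>a\<in>Theta N k. indicator B (a, X) * posterior_coord n j (a, X))"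
        using sum_post_mult[where g="\<lambda>a. indicator B (a, X)" and \<phi>="\<lambda>b. b j", OF inv, of n X]
        by (simp add: posterior_coord_def mult.commute)
    qed
    also have "\<dots> = (\<integral>\<omega>\<in>B. posterior_coord n j \<omega> \<partial>model N k n)"
      using set_int[OF integrable_posterior_coord] by simp
    finally show "(\<integral>\<omega>\<in>B. fst \<omega> j \<partial>model N k n) = (\<integral>\<omega>\<in>B. posterior_coord n j \<omega> \<partial>model N k n)" .
  qed (rule integrable_coord integrable_posterior_coord measurable_posterior_coord)+
qed

text \<open>Pythagoras for the posterior projection, coordinate by coordinate. Parameters have norm
  1, and the sum over coordinates of \<open>a j\<close> times its posterior mean is the posterior
  mean of the overlap with \<open>a\<close>.\<close>

lemma MMSE_eq: "MMSE A N k n = 1 - mean_overlap n"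
proof -
  interpret M: prob_space "model N k n" by (rule prob_space_model)
  interpret S: prob_space "samples n" by (rule prob_space_samples)
  interpret finite_measure_subalgebra "model N k n" "obs_sigma A N k n"
    by unfold_locales (rule subalgebra_obs)
  let ?E = "\<lambda>\<omega>. \<Sum>j<N. (fst \<omega> j - posterior_coord n j \<omega>)\<^sup>2"
  have "AE \<omega> in model N k n. \<forall>j\<in>{..<N}. real_cond_exp (model N k n) (obs_sigma A N k n) (\<lambda>\<omega>'. fst \<omega>' j) \<omega> = posterior_coord n j \<omega>"
    by (intro AE_finite_allI cond_exp_coord) simp
  then have "MMSE A N k n = (\<integral>\<omega>. ?E \<omega> \<partial>model N k n)"
    unfolding MMSE_def by (intro integral_cong_AE) (auto elim!: eventually_mono)
  also have "\<dots> = (\<integral>X. (\<Sum>a\<in>Theta N k. ?E (a, X)) / real (card (Theta N k)) \<partial>samples n)"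
  proof (rule integral_model)
    have "integrable (model N k n) (\<lambda>\<omega>. (fst \<omega> j - posterior_coord n j \<omega>)\<^sup>2)" for j
    proof (rule M.integrable_const_bound[of _ "(2 * (\<Sum>b\<in>Theta N k. \<bar>b j\<bar>))\<^sup>2"])
      have "\<bar>fst \<omega> j\<bar> \<le> (\<Sum>b\<in>Theta N k. \<bar>b j\<bar>)" if "\<omega> \<in> space (model N k n)" for \<omega>
        using that by (auto simp: space_model abs_coord_le)
      then have "\<bar>fst \<omega> j - posterior_coord n j \<omega>\<bar> \<le> 2 * (\<Sum>b\<in>Theta N k. \<bar>b j\<bar>)" if "\<omega> \<in> space (model N k n)" for \<omega>
        using abs_posterior_coord_le[OF that, of j] that by (smt (verit))
      then have "(fst \<omega> j - posterior_coord n j \<omega>)\<^sup>2 \<le> (2 * (\<Sum>b\<in>Theta N k. \<bar>b j\<bar>))\<^sup>2" if "\<omega> \<in> space (model N k n)" for \<omega>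
        using power_mono[OF _ abs_ge_zero, of "fst \<omega> j - posterior_coord n j \<omega>" _ 2, unfolded power2_abs] that by blast
      then show "AE \<omega> in model N k n. norm ((fst \<omega> j - posterior_coord n j \<omega>)\<^sup>2) \<le> (2 * (\<Sum>b\<in>Theta N k. \<bar>b j\<bar>))\<^sup>2"
        by (intro AE_I2) simp
    qed measurable
    then show "integrable (model N k n) ?E" by (rule Bochner_Integration.integrable_sum)
  qed
  also have "\<dots> = (\<integral>X. 1 - (\<Sum>a\<in>Theta N k. post n X (inprod N a) a) / real (card (Theta N k)) \<partial>samples n)"
  proof (intro Bochner_Integration.integral_cong refl)
    fix X
    let ?p = "\<lambda>j. post n X (\<lambda>b. b j)"
    have "(\<Sum>a\<in>Theta N k. ?E (a, X)) = (\<Sum>j<N. \<Sum>a\<in>Theta N k. (a j - ?p j a)\<^sup>2)"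
      unfolding posterior_coord_def by (subst sum.swap) simp
    also have "\<dots> = (\<Sum>j<N. (\<Sum>a\<in>Theta N k. (a j)\<^sup>2) - (\<Sum>a\<in>Theta N k. a j * ?p j a))"
    proof (rule sum.cong[OF refl])
      fix j
      have "(\<Sum>a\<in>Theta N k. (a j - ?p j a)\<^sup>2)
        = (\<Sum>a\<in>Theta N k. (a j)\<^sup>2) + (\<Sum>a\<in>Theta N k. (?p j a)\<^sup>2) - 2 * (\<Sum>a\<in>Theta N k. a j * ?p j a)"
        by (simp add: power2_diff sum.distrib sum_subtractf sum_distrib_left mult.assoc)
      then show "(\<Sum>a\<in>Theta N k. (a j - ?p j a)\<^sup>2) = (\<Sum>a\<in>Theta N k. (a j)\<^sup>2) - (\<Sum>a\<in>Theta N k. a j * ?p j a)"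
        by (simp add: sum_post_square)
    qed
    also have "\<dots> = (\<Sum>a\<in>Theta N k. \<Sum>j<N. (a j)\<^sup>2) - (\<Sum>a\<in>Theta N k. \<Sum>j<N. a j * ?p j a)"
      unfolding sum_subtractf by (subst (1 2) sum.swap) simp
    also have "(\<Sum>a\<in>Theta N k. \<Sum>j<N. (a j)\<^sup>2) = real (card (Theta N k))"
      by (simp add: inprod_self)
    also have "(\<Sum>a\<in>Theta N k. \<Sum>j<N. a j * ?p j a) = (\<Sum>a\<in>Theta N k. post n X (inprod N a) a)"
    proof (rule sum.cong[OF refl])
      fix a
      have "(\<Sum>j<N. a j * ?p j a) = (\<Sum>j<N. \<Sum>b\<in>Theta N k. match n X a b * (a j * b j)) / class_size n X a"
        by (simp add: post_def sum_divide_distrib sum_distrib_left mult_ac)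
      also have "(\<Sum>j<N. \<Sum>b\<in>Theta N k. match n X a b * (a j * b j)) = (\<Sum>b\<in>Theta N k. match n X a b * inprod N a b)"
        unfolding inprod_def sum_distrib_left by (rule sum.swap)
      finally show "(\<Sum>j<N. a j * ?p j a) = post n X (inprod N a) a" by (simp add: post_def)
    qed
    finally show "(\<Sum>a\<in>Theta N k. ?E (a, X)) / real (card (Theta N k))
      = 1 - (\<Sum>a\<in>Theta N k. post n X (inprod N a) a) / real (card (Theta N k))"
      using card_T_pos by (simp add: diff_divide_distrib)
  qed
  also have "\<dots> = 1 - mean_overlap n"
    using S.prob_space by (simp add: mean_overlap_def Bochner_Integration.integrable_sum integrable_post)
  finally show ?thesis .
qed

lemma MMSE_nonneg: "0 \<le> MMSE A N k n"
  unfolding MMSE_def by (intro integral_nonneg_AE AE_I2 sum_nonneg) simp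

lemma MMSE_le_1: "MMSE A N k n \<le> 1"
  using mean_overlap_nonneg[of n] by (simp add: MMSE_eq)

lemma MMSE_le:
  assumes "0 < \<delta>"
  shows "MMSE A N k n \<le> \<delta> + (\<Sum>j\<in>{j. j \<le> k \<and> \<delta> * real k < real j}. first_moment N k n j)"
  using mean_overlap_ge[OF assms, of n] by (simp add: MMSE_eq)

text \<open>\<open>M\<close> is a free later time. Slightly above the critical size the numerator is
  a small multiple of \<open>ln (N choose k)\<close>, while \<open>M - n\<close> is still of that
  order for \<open>n\<close> below it.\<close>

lemma MMSE_ge:
  assumes \<delta>: "0 < \<delta>" "\<delta> \<le> 1" and n: "n < M"
  shows "1 - \<delta> - 6 * (real M * ln 2 - ln (real (N choose k)) + ln (\<Sum>j\<le>k. first_moment N k M j))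
      / ((real M - real n) * stab \<delta>) \<le> MMSE A N k n"
proof -
  let ?Q = "6 * (real M * ln 2 - ln (real (N choose k)) + ln (\<Sum>j\<le>k. first_moment N k M j))"
  have "(real M - real n) * mean_gain n \<le> 6 * (real M * ln 2 - ln (real (N choose k)) + ln (mean_size M))"
    using mean_gain_bound[of n M] n by (simp add: card_Theta k_pos)
  also have "ln (mean_size M) \<le> ln (\<Sum>j\<le>k. first_moment N k M j)"
    using mean_size_le[of M] mean_size_ge_1[of M] by simp
  finally have "mean_gain n \<le> ?Q / (real M - real n)"
    using n by (simp add: le_divide_eq mult.commute)
  then have "mean_gain n / stab \<delta> \<le> ?Q / (real M - real n) / stab \<delta>"
    using stab_pos[OF \<delta>] by (intro divide_right_mono) auto
  also have "\<dots> = ?Q / ((real M - real n) * stab \<delta>)"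
    by (rule divide_divide_eq_left)
  finally have "mean_gain n / stab \<delta> \<le> ?Q / ((real M - real n) * stab \<delta>)" .
  then show ?thesis using mean_overlap_le[OF \<delta>, of n] by (simp add: MMSE_eq)
qed

end

section \<open>First moment estimates\<close>

lemma sum_power_div_fact_le_exp:
  fixes x :: real
  assumes "0 \<le> x" "finite J"
  shows "(\<Sum>j\<in>J. x ^ j / fact j) \<le> exp x"
proof -
  have "(\<lambda>j. x ^ j / fact j) sums exp x"
    using exp_converges[of x] by (simp add: divide_inverse mult.commute)
  then show ?thesis
    using sum_le_suminf[of "\<lambda>j. x ^ j / fact j" J] assms by (auto simp: sums_iff)
qed

lemma choose_le_power_div_fact: "real (n choose j) \<le> real n ^ j / fact j"
  using binomial_fact_pow[of n j]
  by (simp add: le_divide_eq) (metis of_nat_fact of_nat_le_iff of_nat_mult of_nat_power)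

lemma n_star_bounds:
  assumes "0 < k" "k \<le> N"
  shows "real (n_star N k) \<le> ln (real (N choose k)) / ln 2"
    "ln (real (N choose k)) / ln 2 - 1 \<le> real (n_star N k)"
proof -
  have "0 < N choose k" using assms by simp
  then have "1 \<le> real (N choose k)" by linarith
  then have "0 \<le> ln (real (N choose k)) / ln 2" by simp
  then show "real (n_star N k) \<le> ln (real (N choose k)) / ln 2"
    "ln (real (N choose k)) / ln 2 - 1 \<le> real (n_star N k)"
    unfolding n_star_def by linarith+
qed

lemma ln_choose_bounds:
  assumes "0 < k" "k \<le> N"
  shows "real k * ln (real N / real k) \<le> ln (real (N choose k))"
    "ln (real (N choose k)) \<le> real k * ln (real N / real k) + real k"
proof -
  have pos: "0 < real N / real k" "0 < real (N choose k)" using assms by auto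
  have "real k * ln (real N / real k) = ln ((real N / real k) ^ k)" using pos by (simp add: ln_realpow)
  also have "\<dots> \<le> ln (real (N choose k))"
    using binomial_ge_n_over_k_pow_k[OF assms(2), where 'a = real] pos by (subst ln_le_cancel_iff) auto
  finally show "real k * ln (real N / real k) \<le> ln (real (N choose k))" .
  have "real (N choose k) \<le> real N ^ k / fact k" by (rule choose_le_power_div_fact)
  also have "\<dots> = (real N / real k) ^ k * (real k ^ k / fact k)" using assms by (simp add: power_divide)
  also have "\<dots> \<le> (real N / real k) ^ k * exp (real k)"
    using sum_power_div_fact_le_exp[of "real k" "{k}"] by (intro mult_left_mono) auto
  finally have "ln (real (N choose k)) \<le> ln ((real N / real k) ^ k * exp (real k))"
    using pos by (subst ln_le_cancel_iff) auto
  also have "\<dots> = real k * ln (real N / real k) + real k"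
    using pos(1) by (subst ln_mult_pos) (simp_all only: ln_realpow zero_less_power exp_gt_zero ln_exp)
  finally show "ln (real (N choose k)) \<le> real k * ln (real N / real k) + real k" .
qed

text \<open>The slack \<open>\<beta> + 1\<close> pays for two floors, the one in
  \<open>n_star\<close> (times \<open>\<beta>\<close>) and the one in the sample size, and costs the
  factor \<open>2 powr (\<beta> + 1)\<close>. By
  \<open>ln (N choose k) \<ge> k * ln (N / k)\<close>, the factor \<open>(N / k) ^ j\<close> from
  counting meets a survival probability of order \<open>(k / N) powr (\<beta> * j)\<close>; what
  remains is the square of \<open>k ^ j / fact j\<close>.\<close>

lemma first_moment_le:
  assumes k: "0 < k" "k \<le> N" and j: "j \<le> k" and \<beta>: "0 \<le> \<beta>"
    and n: "\<beta> * (ln (real (N choose k)) / ln 2) - (\<beta> + 1) \<le> real n"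
  shows "first_moment N k n j
    \<le> 2 powr (\<beta> + 1) * ((real k * (real k / real N) powr ((\<beta> - 1) / 2)) ^ j / fact j)\<^sup>2"
proof -
  define r where "r = ln (real N / real k)"
  have x: "real k / real N = exp (- r)" "real N = real k * exp r"
    using k by (auto simp: r_def exp_minus)
  have jk: "0 \<le> real j / real k" "real j / real k \<le> 1" using j k by auto
  have "2 powr (- (real j / real k * real n))
    \<le> 2 powr (- (real j / real k * (\<beta> * (ln (real (N choose k)) / ln 2) - (\<beta> + 1))))"
    using mult_left_mono[OF n jk(1)] by (intro powr_mono) auto
  also have "\<dots> = 2 powr (real j / real k * (\<beta> + 1)) * exp (- (real j / real k * (\<beta> * ln (real (N choose k)))))"
    by (simp add: powr_def exp_add[symmetric] algebra_simps)
  also have "\<dots> \<le> 2 powr (\<beta> + 1) * exp (- (real j / real k * (\<beta> * (real k * r))))"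
  proof (rule mult_mono)
    show "2 powr (real j / real k * (\<beta> + 1)) \<le> 2 powr (\<beta> + 1)"
      using jk \<beta> by (intro powr_mono mult_left_le_one_le) auto
    have "real j / real k * (\<beta> * (real k * r)) \<le> real j / real k * (\<beta> * ln (real (N choose k)))"
      unfolding r_def using jk \<beta> by (intro mult_left_mono ln_choose_bounds k) auto
    then show "exp (- (real j / real k * (\<beta> * ln (real (N choose k))))) \<le> exp (- (real j / real k * (\<beta> * (real k * r))))"
      by simp
  qed auto
  also have "real j / real k * (\<beta> * (real k * r)) = real j * (\<beta> * r)" using k by simp
  finally have "first_moment N k n j
    \<le> (real k ^ j / fact j) * (real N ^ j / fact j) * (2 powr (\<beta> + 1) * exp (- (real j * (\<beta> * r))))"
    unfolding first_moment_def by (intro mult_mono choose_le_power_div_fact) auto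
  also have "real N ^ j = real k ^ j * exp (real j * r)"
    by (subst x(2)) (simp add: power_mult_distrib exp_of_nat_mult)
  also have "(real k ^ j / fact j) * (real k ^ j * exp (real j * r) / fact j) * (2 powr (\<beta> + 1) * exp (- (real j * (\<beta> * r))))
    = 2 powr (\<beta> + 1) * ((real k ^ j / fact j)\<^sup>2 * exp (real j * r - real j * (\<beta> * r)))"
    by (simp add: power2_eq_square exp_diff exp_minus divide_inverse mult_ac)
  also have "exp (real j * r - real j * (\<beta> * r)) = (exp (- r * ((\<beta> - 1) / 2)) ^ j)\<^sup>2"
    by (simp add: power2_eq_square exp_of_nat_mult[symmetric] exp_add[symmetric] algebra_simps add_divide_distrib diff_divide_distrib)
  also have "exp (- r * ((\<beta> - 1) / 2)) = (real k / real N) powr ((\<beta> - 1) / 2)"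
    by (simp add: x(1) powr_def mult.commute)
  finally show ?thesis
    by (simp add: power_mult_distrib power_divide)
qed

text \<open>The terms are squares of exponential series terms. Bounding one factor of each by the
  whole series leaves the series itself.\<close>

lemma sum_first_moment_le:
  assumes k: "0 < k" "k \<le> N" and \<beta>: "0 \<le> \<beta>"
    and n: "\<beta> * (ln (real (N choose k)) / ln 2) - (\<beta> + 1) \<le> real n"
  shows "(\<Sum>j\<le>k. first_moment N k n j) \<le> 2 powr (\<beta> + 1) * (exp (real k * (real k / real N) powr ((\<beta> - 1) / 2)))\<^sup>2"
proof -
  define b where "b = real k * (real k / real N) powr ((\<beta> - 1) / 2)"
  have b: "0 \<le> b" by (simp add: b_def)
  have "(\<Sum>j\<le>k. first_moment N k n j) \<le> (\<Sum>j\<le>k. 2 powr (\<beta> + 1) * (b ^ j / fact j)\<^sup>2)"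
    unfolding b_def by (intro sum_mono first_moment_le assms) auto
  also have "\<dots> = 2 powr (\<beta> + 1) * (\<Sum>j\<le>k. (b ^ j / fact j) * (b ^ j / fact j))"
    by (simp add: sum_distrib_left power2_eq_square)
  also have "\<dots> \<le> 2 powr (\<beta> + 1) * (\<Sum>j\<le>k. exp b * (b ^ j / fact j))"
    using b sum_power_div_fact_le_exp[OF b, of "{_}"] by (intro mult_left_mono sum_mono mult_right_mono) auto
  also have "\<dots> = 2 powr (\<beta> + 1) * (exp b * (\<Sum>j\<le>k. b ^ j / fact j))"
    by (simp add: sum_distrib_left)
  also have "\<dots> \<le> 2 powr (\<beta> + 1) * (exp b * exp b)"
    using sum_power_div_fact_le_exp[OF b, of "{..k}"] by (intro mult_left_mono) auto
  finally show ?thesis by (simp add: b_def power2_eq_square)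
qed

text \<open>For \<open>j > \<delta> * k\<close>, Stirling in the form
  \<open>j ^ j / fact j \<le> exp j\<close> bounds \<open>k ^ j / fact j\<close> by
  \<open>(exp 1 / \<delta>) ^ j\<close>. So the tail is dominated by a geometric series of ratio
  \<open>q\<close>, starting at \<open>j = 1\<close> as \<open>\<delta> * k > 0\<close>.\<close>

lemma sum_first_moment_tail_le:
  assumes k: "0 < k" "k \<le> N" and \<beta>: "0 \<le> \<beta>" and \<delta>: "0 < \<delta>"
    and n: "\<beta> * (ln (real (N choose k)) / ln 2) - (\<beta> + 1) \<le> real n"
    and small: "exp 1 * (real k / real N) powr ((\<beta> - 1) / 2) / \<delta> \<le> 1 / 2"
  shows "(\<Sum>j\<in>{j. j \<le> k \<and> \<delta> * real k < real j}. first_moment N k n j)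
    \<le> 2 powr (\<beta> + 2) * (exp 1 * (real k / real N) powr ((\<beta> - 1) / 2) / \<delta>)"
proof -
  define y where "y = (real k / real N) powr ((\<beta> - 1) / 2)"
  define q where "q = exp 1 * y / \<delta>"
  have q: "0 \<le> q" "q \<le> 1 / 2" using small \<delta> by (auto simp: q_def y_def)
  have bound: "first_moment N k n j \<le> 2 powr (\<beta> + 1) * q ^ j" if j: "j \<le> k" "\<delta> * real k < real j" for j
  proof -
    have j0: "0 < real j" using j \<delta> k by (metis le_less_trans mult_nonneg_nonneg of_nat_0_le_iff less_imp_le)
    have "real j ^ j / fact j \<le> exp (real j)"
      using sum_power_div_fact_le_exp[of "real j" "{j}"] by simp
    then have f: "1 / fact j \<le> (exp 1 / real j) ^ j"
      using j0 by (simp add: power_divide exp_of_nat_mult[symmetric] field_simps)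
    have "(real k * y) ^ j / fact j = (real k * y) ^ j * (1 / fact j)" by simp
    also have "\<dots> \<le> (real k * y) ^ j * (exp 1 / real j) ^ j"
      using f by (intro mult_left_mono) (auto simp: y_def)
    also have "\<dots> = (exp 1 * y * (real k / real j)) ^ j" by (simp add: power_mult_distrib[symmetric] mult_ac)
    also have "\<dots> \<le> q ^ j"
    proof (rule power_mono)
      have "real k / real j \<le> 1 / \<delta>" using j j0 \<delta> by (simp add: field_simps)
      then have "exp 1 * y * (real k / real j) \<le> exp 1 * y * (1 / \<delta>)"
        by (intro mult_left_mono) (auto simp: y_def)
      then show "exp 1 * y * (real k / real j) \<le> q" by (simp add: q_def)
      show "0 \<le> exp 1 * y * (real k / real j)" by (simp add: y_def)
    qed
    finally have a: "(real k * y) ^ j / fact j \<le> q ^ j" .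
    have "((real k * y) ^ j / fact j)\<^sup>2 \<le> (q ^ j)\<^sup>2" by (rule power_mono[OF a]) (simp add: y_def)
    also have "\<dots> \<le> q ^ j * 1" unfolding power2_eq_square using q by (intro mult_left_mono power_le_one) auto
    finally have "2 powr (\<beta> + 1) * ((real k * y) ^ j / fact j)\<^sup>2 \<le> 2 powr (\<beta> + 1) * q ^ j"
      by (intro mult_left_mono) auto
    then show ?thesis using first_moment_le[OF k j(1) \<beta> n, folded y_def] by (rule order_trans[rotated])
  qed
  have pos: "1 \<le> j" if "\<delta> * real k < real j" for j
    using that \<delta> k by (metis less_one mult_nonneg_nonneg not_less of_nat_0 of_nat_0_le_iff less_imp_le)
  have "(\<Sum>j\<in>{j. j \<le> k \<and> \<delta> * real k < real j}. first_moment N k n j)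
    \<le> (\<Sum>j\<in>{j. j \<le> k \<and> \<delta> * real k < real j}. 2 powr (\<beta> + 1) * q ^ j)"
    by (intro sum_mono bound) auto
  also have "\<dots> \<le> (\<Sum>j\<in>{1..k}. 2 powr (\<beta> + 1) * q ^ j)"
    using q pos by (intro sum_mono2) auto
  also have "\<dots> = 2 powr (\<beta> + 1) * (q * (\<Sum>j<k. q ^ j))"
    by (simp add: sum_distrib_left sum.atLeast1_atMost_eq)
  also have "\<dots> \<le> 2 powr (\<beta> + 1) * (q * 2)"
  proof (intro mult_left_mono)
    have "(\<Sum>j<k. q ^ j) \<le> (\<Sum>j<k. (1/2) ^ j)" using q by (intro sum_mono power_mono) auto
    also have "\<dots> \<le> 2" by (simp add: sum_gp_strict)
    finally show "(\<Sum>j<k. q ^ j) \<le> 2" .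
  qed (use q in auto)
  also have "\<dots> = 2 powr (\<beta> + 2) * q" by (simp add: powr_add)
  finally show ?thesis by (simp add: q_def y_def)
qed

section \<open>Asymptotics in the sparse regime\<close>

text \<open>Once \<open>ln (N / k) \<ge> 1\<close>, the bound \<open>k \<le> ln (N choose k)\<close>
  expresses the exponent in units of the total entropy. For \<open>\<beta> > 1\<close> its
  coefficient tends to 0 when \<open>k / N\<close> does.\<close>

lemma ln_sum_first_moment_le:
  assumes k: "0 < k" "k \<le> N" and r: "1 \<le> ln (real N / real k)" and \<beta>: "0 \<le> \<beta>"
    and n: "\<beta> * (ln (real (N choose k)) / ln 2) - (\<beta> + 1) \<le> real n"
  shows "ln (\<Sum>j\<le>k. first_moment N k n j)
    \<le> (\<beta> + 1) * ln 2 + 2 * ((real k / real N) powr ((\<beta> - 1) / 2) * ln (real (N choose k)))"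
proof -
  define y where "y = (real k / real N) powr ((\<beta> - 1) / 2)"
  have "first_moment N k n 0 \<le> (\<Sum>j\<le>k. first_moment N k n j)"
    by (rule member_le_sum) (auto simp: first_moment_def)
  then have "1 \<le> (\<Sum>j\<le>k. first_moment N k n j)" by (simp add: first_moment_def)
  then have "ln (\<Sum>j\<le>k. first_moment N k n j) \<le> ln (2 powr (\<beta> + 1) * (exp (real k * y))\<^sup>2)"
    using sum_first_moment_le[OF k \<beta> n] unfolding y_def by (subst ln_le_cancel_iff) auto
  also have "\<dots> = (\<beta> + 1) * ln 2 + 2 * (real k * y)"
    by (subst ln_mult_pos) (simp_all add: ln_realpow ln_powr)
  also have "real k * y \<le> y * ln (real (N choose k))"
  proof -
    have "real k * 1 \<le> real k * ln (real N / real k)" using r by (intro mult_left_mono) auto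
    also have "\<dots> \<le> ln (real (N choose k))" by (rule ln_choose_bounds(1)[OF k])
    finally have "y * real k \<le> y * ln (real (N choose k))" by (intro mult_left_mono) (auto simp: y_def)
    then show ?thesis by (simp add: mult.commute)
  qed
  finally show ?thesis by (simp add: y_def)
qed

locale sparse_regime =
  fixes k :: "nat \<Rightarrow> nat"
  assumes k_pos: "\<And>N. 0 < k N" and k_o: "(\<lambda>N. real (k N) / real N) \<longlonglongrightarrow> 0"
begin

abbreviation lnC :: "nat \<Rightarrow> real" where
  "lnC N \<equiv> ln (real (N choose k N))"

lemma eventually_k_le: "\<forall>\<^sub>F N in sequentially. k N \<le> N"
proof -
  have "\<forall>\<^sub>F N in sequentially. real (k N) / real N < 1" using k_o by (rule order_tendstoD) simp
  then show ?thesis using eventually_gt_at_top[of 0]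
    by eventually_elim (simp add: divide_less_eq)
qed

lemma ratio_at_right: "filterlim (\<lambda>N. real (k N) / real N) (at_right 0) sequentially"
proof -
  have "\<forall>\<^sub>F N in sequentially. real (k N) / real N \<in> {0<..} \<and> real (k N) / real N \<noteq> 0"
    using eventually_gt_at_top[of 0] by eventually_elim (use k_pos in auto)
  then show ?thesis using k_o by (simp add: filterlim_at)
qed

lemma ln_ratio_at_top: "filterlim (\<lambda>N. ln (real N / real (k N))) at_top sequentially"
proof -
  have "filterlim (\<lambda>N. - ln (real (k N) / real N)) at_top sequentially"
    using filterlim_compose[OF ln_at_0 ratio_at_right] by (simp add: filterlim_uminus_at_bot)
  moreover have "\<forall>\<^sub>F N in sequentially. - ln (real (k N) / real N) = ln (real N / real (k N))"
    using eventually_gt_at_top[of 0] by eventually_elim (simp add: ln_div k_pos)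
  ultimately show ?thesis by (rule filterlim_cong[OF refl refl, THEN iffD1, rotated])
qed

lemma lnC_at_top: "filterlim lnC at_top sequentially"
proof (rule filterlim_at_top_mono[OF ln_ratio_at_top])
  have "\<forall>\<^sub>F N in sequentially. 1 \<le> ln (real N / real (k N))"
    using ln_ratio_at_top by (simp add: filterlim_at_top)
  then show "\<forall>\<^sub>F N in sequentially. ln (real N / real (k N)) \<le> lnC N"
    using eventually_k_le
  proof eventually_elim
    case (elim N)
    have "1 * ln (real N / real (k N)) \<le> real (k N) * ln (real N / real (k N))"
      using k_pos[of N] elim by (intro mult_right_mono) auto
    also have "\<dots> \<le> lnC N" using elim k_pos by (intro ln_choose_bounds) auto
    finally show ?case by simp
  qed
qed

lemma inverse_lnC_tendsto: "(\<lambda>N. 1 / lnC N) \<longlonglongrightarrow> 0"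
  using tendsto_inverse_0_at_top[OF lnC_at_top] by (simp add: inverse_eq_divide)

lemma eventually_lnC_pos: "\<forall>\<^sub>F N in sequentially. 0 < lnC N"
  using lnC_at_top by (simp add: filterlim_at_top_dense)

lemma n_star_over_lnC: "(\<lambda>N. real (n_star N (k N)) / lnC N) \<longlonglongrightarrow> 1 / ln 2"
proof (rule tendsto_sandwich)
  show "\<forall>\<^sub>F N in sequentially. 1 / ln 2 - 1 / lnC N \<le> real (n_star N (k N)) / lnC N"
    using eventually_lnC_pos eventually_k_le
  proof eventually_elim
    case (elim N)
    then have "(lnC N / ln 2 - 1) / lnC N \<le> real (n_star N (k N)) / lnC N"
      using n_star_bounds[of "k N" N] k_pos by (intro divide_right_mono) auto
    moreover have "(lnC N / ln 2 - 1) / lnC N = 1 / ln 2 - 1 / lnC N"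
      using elim by (simp add: diff_divide_distrib)
    ultimately show ?case by simp
  qed
  show "\<forall>\<^sub>F N in sequentially. real (n_star N (k N)) / lnC N \<le> 1 / ln 2"
    using eventually_lnC_pos eventually_k_le
  proof eventually_elim
    case (elim N)
    then have "real (n_star N (k N)) / lnC N \<le> (lnC N / ln 2) / lnC N"
      using n_star_bounds[of "k N" N] k_pos by (intro divide_right_mono) auto
    then show ?case using elim by simp
  qed
  show "(\<lambda>N. 1 / ln 2 - 1 / lnC N) \<longlonglongrightarrow> 1 / ln 2"
    using tendsto_diff[OF tendsto_const inverse_lnC_tendsto, of "1 / ln 2"] by simp
qed simp

lemma lnC_asymp: "(\<lambda>N. lnC N / (real (k N) * ln (real N / real (k N)))) \<longlonglongrightarrow> 1"
proof (rule tendsto_sandwich)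
  have pos: "\<forall>\<^sub>F N in sequentially. 1 \<le> ln (real N / real (k N))"
    using ln_ratio_at_top by (simp add: filterlim_at_top)
  show "\<forall>\<^sub>F N in sequentially. 1 \<le> lnC N / (real (k N) * ln (real N / real (k N)))"
    using pos eventually_k_le
  proof eventually_elim
    case (elim N)
    then have "0 < real (k N) * ln (real N / real (k N))" using k_pos[of N] by (intro mult_pos_pos; linarith)
    then show ?case using ln_choose_bounds(1)[OF k_pos elim(2)] by simp
  qed
  show "\<forall>\<^sub>F N in sequentially. lnC N / (real (k N) * ln (real N / real (k N))) \<le> 1 + inverse (ln (real N / real (k N)))"
    using pos eventually_k_le
  proof eventually_elim
    case (elim N)
    then have p: "0 < real (k N) * ln (real N / real (k N))" using k_pos[of N] by (intro mult_pos_pos; linarith)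
    have "(1 + inverse (ln (real N / real (k N)))) * (real (k N) * ln (real N / real (k N))) = real (k N) * ln (real N / real (k N)) + real (k N)"
      using elim by (simp add: distrib_right)
    then show ?case using ln_choose_bounds(2)[OF k_pos elim(2)] p by (simp add: divide_le_eq)
  qed
  show "(\<lambda>N. 1 + inverse (ln (real N / real (k N)))) \<longlonglongrightarrow> 1"
    using tendsto_add[OF tendsto_const tendsto_inverse_0_at_top[OF ln_ratio_at_top], of 1] by simp
qed simp

lemma n_star_asymp: "(\<lambda>N. real (n_star N (k N)) / (real (k N) * log 2 (real N / real (k N)))) \<longlonglongrightarrow> 1"
proof -
  have "(\<lambda>N. real (n_star N (k N)) / lnC N * (lnC N / (real (k N) * ln (real N / real (k N)))) * ln 2) \<longlonglongrightarrow> 1 / ln 2 * 1 * ln 2"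
    by (intro tendsto_mult n_star_over_lnC lnC_asymp tendsto_const)
  moreover have "\<forall>\<^sub>F N in sequentially.
     real (n_star N (k N)) / lnC N * (lnC N / (real (k N) * ln (real N / real (k N)))) * ln 2
     = real (n_star N (k N)) / (real (k N) * log 2 (real N / real (k N)))"
    using eventually_lnC_pos by eventually_elim (simp add: log_def)
  ultimately have "(\<lambda>N. real (n_star N (k N)) / (real (k N) * log 2 (real N / real (k N)))) \<longlonglongrightarrow> 1 / ln 2 * 1 * ln 2"
    by (rule Lim_transform_eventually)
  then show ?thesis by simp
qed

lemma sample_size_ge:
  assumes "k N \<le> N" "0 \<le> \<beta>"
  shows "\<beta> * (lnC N / ln 2) - (\<beta> + 1) \<le> real (nat \<lfloor>\<beta> * real (n_star N (k N))\<rfloor>)"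
proof -
  have "\<beta> * (lnC N / ln 2 - 1) \<le> \<beta> * real (n_star N (k N))"
    using n_star_bounds(2)[OF k_pos assms(1)] assms(2) by (intro mult_left_mono) auto
  moreover have "0 \<le> \<beta> * real (n_star N (k N))" using assms(2) by simp
  ultimately show ?thesis by (simp add: algebra_simps) linarith
qed

lemma power_ratio_tendsto: "0 < c \<Longrightarrow> (\<lambda>N. (real (k N) / real N) powr c) \<longlonglongrightarrow> 0"
  using tendsto_powr[OF k_o tendsto_const, of c] tendsto_zero_powrI[OF k_o tendsto_const] by simp

section \<open>The two sides of the threshold\<close>

context
  fixes A :: "real set"
  assumes A: "A \<in> sets borel" "measure std_gauss A = 1 / 2"
begin

lemma perceptron: "k N \<le> N \<Longrightarrow> perceptron A N (k N)"
  using A k_pos by unfold_locales auto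

lemma MMSE_all:
  assumes \<beta>: "1 < \<beta>"
  shows "(\<lambda>N. MMSE A N (k N) (nat \<lfloor>\<beta> * real (n_star N (k N))\<rfloor>)) \<longlonglongrightarrow> 0"
proof (rule tendstoI)
  fix \<eta> :: real assume \<eta>: "0 < \<eta>"
  \<comment> \<open>Half of \<open>\<eta>\<close> covers the parameters within distance
    \<open>\<delta> * k\<close> of the truth, the other half the tail of the first moment.\<close>
  define \<delta> where "\<delta> = \<eta> / 2"
  have \<delta>: "0 < \<delta>" using \<eta> by (simp add: \<delta>_def)
  define q where "q N = exp 1 * (real (k N) / real N) powr ((\<beta> - 1) / 2) / \<delta>" for N
  have q0: "q \<longlonglongrightarrow> exp 1 * 0 / \<delta>"
    unfolding q_def[abs_def] using \<beta> \<delta> by (intro tendsto_intros power_ratio_tendsto) auto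
  have "(\<lambda>N. 2 powr (\<beta> + 2) * q N) \<longlonglongrightarrow> 2 powr (\<beta> + 2) * (exp 1 * 0 / \<delta>)"
    by (intro tendsto_mult tendsto_const q0)
  then have "\<forall>\<^sub>F N in sequentially. 2 powr (\<beta> + 2) * q N < \<eta> / 2"
    by (rule order_tendstoD) (use \<eta> in simp)
  moreover have "\<forall>\<^sub>F N in sequentially. q N < 1 / 2" using q0 by (rule order_tendstoD) simp
  ultimately show "\<forall>\<^sub>F N in sequentially. dist (MMSE A N (k N) (nat \<lfloor>\<beta> * real (n_star N (k N))\<rfloor>)) 0 < \<eta>"
    using eventually_k_le
  proof eventually_elim
    case (elim N)
    interpret perceptron A N "k N" by (rule perceptron[OF elim(3)])
    let ?n = "nat \<lfloor>\<beta> * real (n_star N (k N))\<rfloor>"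
    have "MMSE A N (k N) ?n \<le> \<delta> + 2 powr (\<beta> + 2) * q N"
      using MMSE_le[OF \<delta>, of ?n] elim \<beta>
        sum_first_moment_tail_le[OF k_pos elim(3) _ \<delta> sample_size_ge[OF elim(3)], of \<beta>]
      by (simp add: q_def)
    then show ?case using elim MMSE_nonneg[of ?n] by (simp add: \<delta>_def)
  qed
qed

lemma MMSE_nothing:
  assumes \<beta>: "0 < \<beta>" "\<beta> < 1"
  shows "(\<lambda>N. MMSE A N (k N) (nat \<lfloor>\<beta> * real (n_star N (k N))\<rfloor>)) \<longlonglongrightarrow> 1"
proof (rule tendstoI)
  fix \<eta> :: real assume \<eta>: "0 < \<eta>"
  define \<delta> where "\<delta> = min 1 (\<eta> / 3)"
  have \<delta>: "0 < \<delta>" "\<delta> \<le> 1" "\<delta> \<le> \<eta> / 3" using \<eta> by (auto simp: \<delta>_def)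
  \<comment> \<open>\<open>stab\<close> depends on \<open>A\<close> alone, so \<open>p\<close> is
    fixed before \<open>N\<close> and \<open>\<epsilon>\<close> may depend on it.\<close>
  define p where "p = balanced_sign.stab (perceptron.sgnA A) \<delta>"
  have p: "0 < p"
  proof -
    \<comment> \<open>The smallest legal dimensions; they only give access to facts about
      \<open>sgnA A\<close>, which do not involve them.\<close>
    interpret perceptron A 1 1 using A by unfold_locales auto
    show ?thesis unfolding p_def by (rule stab_pos[OF \<delta>(1,2)])
  qed
  \<comment> \<open>Chosen so that the limit of the error quotient,
    \<open>6 * \<epsilon> * ln 2 / ((\<gamma> - \<beta>) * p)\<close>, is at most
    \<open>\<eta> / 6\<close>, strictly below the allotted \<open>\<eta> / 3\<close>. One factor 6
    of the 36 is the constant of the entropy gap.\<close>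
  define \<epsilon> where "\<epsilon> = \<eta> * (1 - \<beta>) * p / 36"
  have \<epsilon>: "0 < \<epsilon>" using \<eta> \<beta> p by (simp add: \<epsilon>_def)
  define \<gamma> where "\<gamma> = 1 + \<epsilon>"
  define y where "y N = (real (k N) / real N) powr ((\<gamma> - 1) / 2)" for N
  define L where "L N = real (n_star N (k N))" for N
  \<comment> \<open>\<open>num\<close> bounds the entropy excess at the later time and
    \<open>den\<close> the number of observations in between, with 1 lost to rounding. Divided by
    \<open>lnC\<close>, both have finite limits.\<close>
  define num where "num N = lnC N * (\<epsilon> + 2 * y N) + (\<gamma> + 1) * ln 2" for N
  define den where "den N = (\<gamma> - \<beta>) * L N - 1" for N
  have \<gamma>\<beta>: "0 < \<gamma> - \<beta>" "1 - \<beta> \<le> \<gamma> - \<beta>" using \<epsilon> \<beta> by (auto simp: \<gamma>_def)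
  have y0: "y \<longlonglongrightarrow> 0"
    unfolding y_def[abs_def] using \<epsilon> by (intro power_ratio_tendsto) (simp add: \<gamma>_def)
  have den': "(\<lambda>N. (\<gamma> - \<beta>) * (L N / lnC N) - 1 / lnC N) \<longlonglongrightarrow> (\<gamma> - \<beta>) * (1 / ln 2) - 0"
    unfolding L_def by (intro tendsto_intros n_star_over_lnC inverse_lnC_tendsto)
  have den'_eq: "\<forall>\<^sub>F N in sequentially. (\<gamma> - \<beta>) * (L N / lnC N) - 1 / lnC N = den N / lnC N"
    using eventually_lnC_pos by eventually_elim (simp add: den_def diff_divide_distrib)
  have lim: "(\<lambda>N. 6 * ((\<epsilon> + 2 * y N) + (\<gamma> + 1) * ln 2 * (1 / lnC N)) / (((\<gamma> - \<beta>) * (L N / lnC N) - 1 / lnC N) * p))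
     \<longlonglongrightarrow> 6 * ((\<epsilon> + 2 * 0) + (\<gamma> + 1) * ln 2 * 0) / (((\<gamma> - \<beta>) * (1 / ln 2) - 0) * p)"
    using \<gamma>\<beta> p by (intro tendsto_divide tendsto_mult tendsto_add tendsto_const y0 inverse_lnC_tendsto den') auto
  have "6 * ((\<epsilon> + 2 * 0) + (\<gamma> + 1) * ln 2 * 0) / (((\<gamma> - \<beta>) * (1 / ln 2) - 0) * p) = 6 * \<epsilon> * ln 2 / ((\<gamma> - \<beta>) * p)"
    by simp
  also have "\<dots> \<le> 6 * \<epsilon> * 1 / ((1 - \<beta>) * p)"
    using \<epsilon> \<gamma>\<beta> p \<beta> ln2_le_25_over_36 by (intro frac_le mult_left_mono mult_right_mono mult_pos_pos) auto
  also have "6 * \<epsilon> * 1 = \<eta> / 6 * ((1 - \<beta>) * p)" by (simp add: \<epsilon>_def)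
  also have "\<eta> / 6 * ((1 - \<beta>) * p) / ((1 - \<beta>) * p) = \<eta> / 6" using \<beta> p by simp
  also have "\<dots> < \<eta> / 3" using \<eta> by simp
  finally have "\<forall>\<^sub>F N in sequentially. 6 * ((\<epsilon> + 2 * y N) + (\<gamma> + 1) * ln 2 * (1 / lnC N)) / (((\<gamma> - \<beta>) * (L N / lnC N) - 1 / lnC N) * p) < \<eta> / 3"
    by (rule order_tendstoD(2)[OF lim])
  moreover have "\<forall>\<^sub>F N in sequentially. 0 < (\<gamma> - \<beta>) * (L N / lnC N) - 1 / lnC N"
    by (rule order_tendstoD(1)[OF den']) (use \<gamma>\<beta> in simp)
  moreover have "\<forall>\<^sub>F N in sequentially. 1 \<le> ln (real N / real (k N))"
    using ln_ratio_at_top by (simp add: filterlim_at_top)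
  ultimately show "\<forall>\<^sub>F N in sequentially. dist (MMSE A N (k N) (nat \<lfloor>\<beta> * real (n_star N (k N))\<rfloor>)) 1 < \<eta>"
    using eventually_k_le eventually_lnC_pos den'_eq
  proof eventually_elim
    case (elim N)
    interpret perceptron A N "k N" by (rule perceptron[OF elim(4)])
    let ?n = "nat \<lfloor>\<beta> * real (n_star N (k N))\<rfloor>" and ?M = "nat \<lfloor>\<gamma> * real (n_star N (k N))\<rfloor>"
    have den: "0 < den N" using elim(2) unfolding elim(6) using elim(5) by (simp add: zero_less_divide_iff)
    have \<gamma>0: "0 \<le> \<gamma>" using \<epsilon> by (simp add: \<gamma>_def)
    have M: "real ?M \<le> \<gamma> * L N" "\<gamma> * L N - 1 \<le> real ?M" "real ?n \<le> \<beta> * L N"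
      using \<gamma>0 \<beta> by (auto simp: L_def)
    then have Mn: "den N \<le> real ?M - real ?n" by (simp add: den_def algebra_simps)
    then have "?n < ?M" using den by linarith
    note ge = MMSE_ge[OF \<delta>(1,2) this]
    let ?num = "real ?M * ln 2 - lnC N + ln (\<Sum>j\<le>k N. first_moment N (k N) ?M j)"
    have "real ?M * ln 2 \<le> \<gamma> * lnC N"
    proof -
      have "real ?M * ln 2 \<le> \<gamma> * (lnC N / ln 2) * ln 2"
        using M(1) mult_left_mono[OF n_star_bounds(1)[OF k_pos elim(4)] \<gamma>0] by (intro mult_right_mono) (auto simp: L_def)
      then show ?thesis by simp
    qed
    moreover have "ln (\<Sum>j\<le>k N. first_moment N (k N) ?M j) \<le> (\<gamma> + 1) * ln 2 + 2 * (y N * lnC N)"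
      unfolding y_def by (rule ln_sum_first_moment_le[OF k_pos elim(4,3) \<gamma>0 sample_size_ge[OF elim(4) \<gamma>0]])
    ultimately have "?num \<le> num N" by (simp add: num_def \<gamma>_def algebra_simps)
    moreover have num0: "0 \<le> num N"
      using elim(5) \<epsilon> \<gamma>0 unfolding num_def y_def by (intro add_nonneg_nonneg mult_nonneg_nonneg) auto
    ultimately have "6 * ?num / ((real ?M - real ?n) * p) \<le> 6 * num N / (den N * p)"
      using Mn den p by (intro frac_le mult_right_mono mult_pos_pos) auto
    also have "\<dots> = 6 * (num N / lnC N) / (den N / lnC N * p)"
      using elim(5) by simp
    also have "num N / lnC N = (\<epsilon> + 2 * y N) + (\<gamma> + 1) * ln 2 * (1 / lnC N)"
      using elim(5) by (simp add: num_def add_divide_distrib)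
    finally have "6 * ?num / ((real ?M - real ?n) * p) < \<eta> / 3"
      using elim(1) unfolding elim(6) by linarith
    then have "1 - \<delta> - \<eta> / 3 < MMSE A N (k N) ?n" using ge unfolding p_def by linarith
    then show ?case using \<delta>(3) MMSE_le_1[of ?n] \<eta> by (simp add: dist_real_def)
  qed
qed

end

end

theorem theorem3:
  fixes k :: "nat \<Rightarrow> nat" and A :: "real set"
  assumes kpos: "\<And>N. k N > 0"
    and k_o: "(\<lambda>N. real (k N) / real N) \<longlonglongrightarrow> 0"
    and A_borel: "A \<in> sets borel"
    and A_half: "measure std_gauss A = 1 / 2"
  shows "(\<forall>\<beta>::real. 0 < \<beta> \<and> \<beta> < 1 \<longrightarrow>
            (\<lambda>N. MMSE A N (k N) (nat \<lfloor>\<beta> * real (n_star N (k N))\<rfloor>)) \<longlonglongrightarrow> 1)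
       \<and> (\<forall>\<beta>::real. \<beta> > 1 \<longrightarrow>
            (\<lambda>N. MMSE A N (k N) (nat \<lfloor>\<beta> * real (n_star N (k N))\<rfloor>)) \<longlonglongrightarrow> 0)
       \<and> (\<lambda>N. real (n_star N (k N)) / (real (k N) * log 2 (real N / real (k N)))) \<longlonglongrightarrow> 1"
proof -
  interpret sparse_regime k by unfold_locales (rule kpos, rule k_o)
  show ?thesis
    using MMSE_nothing[OF A_borel A_half] MMSE_all[OF A_borel A_half] n_star_asymp by blast
qed

end
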